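(* For any $\alpha\in E(\mathcal A)$, $\dim\big(\mathcal H_{alg}(\alpha)(\mathcal U)\big)\ge d+1$.
   Context: Setting: $m\ge 1$ and $0<k_1<\dots<k_m<d$ are integers with $\gcd(k_1,\dots,k_m,d)=1$; $\Lambda=\{0,k_1,\dots,k_m,d\}$, and all $(m+2)$-tuples are indexed by $\Lambda$. $\mathbb N=\{0,1,2,\dots\}$. $\mathcal A$ is the $2\times(m+2)$ integer matrix whose columns are $(1,j)^T$, $j\in\Lambda$. Variables $x=(x_j)_{j\in\Lambda}\in\mathbb C^{m+2}$. The $\mathcal A$-hypergeometric system with exponent $\alpha=(\alpha_1,\alpha_2)$ consists of the equations $\prod_{v_j>0}(\partial/\partial x_j)^{v_j}\varphi=\prod_{v_j<0}(\partial/\partial x_j)^{-v_j}\varphi$ for all $v\in\mathbb Z^{\Lambda}$ with $\mathcal A v=0$, together with $\sum_{j}x_j\,\partial\varphi/\partial x_j=\alpha_1\varphi$ and $\sum_{j}j\,x_j\,\partial\varphi/\partial x_j=\alpha_2\varphi$. Let $f(x;t)=\sum_{j\in\Lambda}x_jt^j$, and let $\Sigma\subset\mathbb C^{m+2}$ be the set where $x_0=0$, or $x_d=0$, or the discriminant of $f(x;t)$ (as a polynomial in $t$) vanishes. $\mathcal U\subset\mathbb C^{m+2}\setminus\Sigma$ is a nonempty simply-connected open set. $\mathcal H_{alg}(\alpha)(\mathcal U)$ is the complex vector space of holomorphic functions on $\mathcal U$ that solve the $\mathcal A$-hypergeometric system with exponent $\alpha$ and are algebraic (over $\mathbb C(x)$).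 Let $\mathcal B$ be the matrix obtained from $\mathcal A$ by deleting the column $(1,d)^T$ and $\mathcal C$ the matrix obtained by deleting the column $(1,0)^T$. Put $I(\mathcal A)=\mathcal A\cdot\mathbb N^{m+2}$, $F_0(\mathcal A)=\mathcal C\cdot\mathbb N^{m+1}-\mathbb N(1,0)$, $F_d(\mathcal A)=\mathcal B\cdot\mathbb N^{m+1}-\mathbb N(1,d)$, $E_0(\mathcal A)=F_0(\mathcal A)\setminus I(\mathcal A)$, $E_d(\mathcal A)=F_d(\mathcal A)\setminus I(\mathcal A)$, $E(\mathcal A)=E_0(\mathcal A)\cap E_d(\mathcal A)$ (all subsets of $\mathbb Z^2$). *)

theory Defs
  imports
    "HOL-Analysis.Analysis"
    "HOL-Library.Extended_Nat"
    "HOL-Library.Function_Algebras"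
    "Subresultants.Resultant_Prelim"
begin

no_notation vec_index (infixl "$" 100)

text \<open>
  The exponent set is a set \<open>\<Lambda>\<close> of naturals. Points of \<open>\<complex>\<^sup>\<Lambda>\<close> are vectors over a finite index
  type \<open>'n\<close>, and a bijection \<open>e\<close> from \<open>'n\<close> to \<open>\<Lambda>\<close> labels the coordinates: \<open>x $ i\<close> is the variable
  usually written \<open>x\<^sub>j\<close> for \<open>j = e i\<close>, that is, \<open>x\<^sub>j\<close> is \<open>x $ inv_into UNIV e j\<close>.
\<close>

definition exponents :: "nat \<Rightarrow> (nat \<Rightarrow> nat) \<Rightarrow> nat \<Rightarrow> nat set" where
  "exponents m k d = {0} \<union> k ` {1..m} \<union> {d}"


section \<open>Integer points\<close>

text \<open>The set \<open>M \<cdot> \<nat>\<^sup>J\<close> for the integer matrix \<open>M\<close> with columns \<open>(1, j)\<^sup>T\<close>, \<open>j \<in> J\<close>.\<close>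

definition nat_span :: "nat set \<Rightarrow> (int \<times> int) set" where
  "nat_span J = {(\<Sum>j\<in>J. int (u j), \<Sum>j\<in>J. int (u j) * int j) | u :: nat \<Rightarrow> nat. True}"

definition I_set :: "nat set \<Rightarrow> (int \<times> int) set" where
  "I_set \<Lambda> = nat_span \<Lambda>"

definition F0_set :: "nat set \<Rightarrow> (int \<times> int) set" where
  "F0_set \<Lambda> = {(a - int n, b) | a b n. (a, b) \<in> nat_span (\<Lambda> - {0})}"

definition Fd_set :: "nat set \<Rightarrow> nat \<Rightarrow> (int \<times> int) set" where
  "Fd_set \<Lambda> d = {(a - int n, b - int n * int d) | a b n. (a, b) \<in> nat_span (\<Lambda> - {d})}"

definition E0_set :: "nat set \<Rightarrow> (int \<times> int) set" where
  "E0_set \<Lambda> = F0_set \<Lambda> - I_set \<Lambda>"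

definition Ed_set :: "nat set \<Rightarrow> nat \<Rightarrow> (int \<times> int) set" where
  "Ed_set \<Lambda> d = Fd_set \<Lambda> d - I_set \<Lambda>"

definition E_set :: "nat set \<Rightarrow> nat \<Rightarrow> (int \<times> int) set" where
  "E_set \<Lambda> d = E0_set \<Lambda> \<inter> Ed_set \<Lambda> d"


section \<open>The hypergeometric system\<close>

definition partial :: "'n::finite \<Rightarrow> (complex ^ 'n \<Rightarrow> complex) \<Rightarrow> complex ^ 'n \<Rightarrow> complex" where
  "partial i \<phi> x = deriv (\<lambda>z. \<phi> (\<chi> j. if j = i then z else x $ j)) (x $ i)"

text \<open>
  The operator \<open>\<Prod>\<^sub>i (\<partial>/\<partial>x\<^sub>i) ^ u i\<close>. The factors are composed in the order of the labels;
  on holomorphic functions the order is irrelevant.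
\<close>

definition mixed_partial ::
  "('n::finite \<Rightarrow> nat) \<Rightarrow> ('n \<Rightarrow> nat) \<Rightarrow> (complex ^ 'n \<Rightarrow> complex) \<Rightarrow> complex ^ 'n \<Rightarrow> complex" where
  "mixed_partial e u \<phi> =
     foldr (\<lambda>j. partial (inv_into UNIV e j) ^^ u (inv_into UNIV e j)) (sorted_list_of_set (range e)) \<phi>"

definition solves_hypergeometric ::
  "('n::finite \<Rightarrow> nat) \<Rightarrow> complex \<times> complex \<Rightarrow> (complex ^ 'n) set \<Rightarrow> (complex ^ 'n \<Rightarrow> complex) \<Rightarrow> bool" where
  "solves_hypergeometric e \<alpha> U \<phi> \<longleftrightarrow>
     (\<forall>v :: 'n \<Rightarrow> int. (\<Sum>i\<in>UNIV. v i) = 0 \<and> (\<Sum>i\<in>UNIV. int (e i) * v i) = 0 \<longrightarrow>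
        (\<forall>x\<in>U. mixed_partial e (\<lambda>i. nat (v i)) \<phi> x = mixed_partial e (\<lambda>i. nat (- v i)) \<phi> x)) \<and>
     (\<forall>x\<in>U. (\<Sum>i\<in>UNIV. x $ i * partial i \<phi> x) = fst \<alpha> * \<phi> x) \<and>
     (\<forall>x\<in>U. (\<Sum>i\<in>UNIV. of_nat (e i) * x $ i * partial i \<phi> x) = snd \<alpha> * \<phi> x)"


section \<open>The singular locus\<close>

text \<open>\<open>f(x;t)\<close> as a polynomial in \<open>t\<close>.\<close>

definition generic_poly :: "('n::finite \<Rightarrow> nat) \<Rightarrow> complex ^ 'n \<Rightarrow> complex poly" where
  "generic_poly e x = (\<Sum>i\<in>UNIV. monom (x $ i) (e i))"

definition discriminant :: "complex poly \<Rightarrow> complex" where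
  "discriminant p =
     (- 1) ^ (degree p * (degree p - 1) div 2) * resultant p (pderiv p) / lead_coeff p"

text \<open>
  The discriminant is taken with respect to the actual degree; this is harmless because it
  differs from \<open>d\<close> only where \<open>x\<^sub>d = 0\<close>, and that locus is contained in the set anyway.
\<close>

definition singular_locus :: "('n::finite \<Rightarrow> nat) \<Rightarrow> nat \<Rightarrow> (complex ^ 'n) set" where
  "singular_locus e d =
     {x. x $ (inv_into UNIV e 0) = 0 \<or> x $ (inv_into UNIV e d) = 0 \<or> discriminant (generic_poly e x) = 0}"


section \<open>Algebraic holomorphic solutions\<close>

definition holomorphic_several :: "(complex ^ 'n \<Rightarrow> complex) \<Rightarrow> (complex ^ 'n::finite) set \<Rightarrow> bool" where
  "holomorphic_several \<phi> U \<longleftrightarrow>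
     (\<forall>x\<in>U. \<exists>D. (\<phi> has_derivative D) (at x) \<and> (\<forall>c v. D (c *s v) = c * D v))"

text \<open>
  The ring \<open>\<complex>[x]\<close>, as polynomial functions. (The library's \<open>polynomial_function\<close> is about real
  polynomials and would admit complex conjugation.)
\<close>

inductive complex_polynomial :: "(complex ^ 'n::finite \<Rightarrow> complex) \<Rightarrow> bool" where
  const: "complex_polynomial (\<lambda>x. c)"
| coord: "complex_polynomial (\<lambda>x. x $ i)"
| add: "complex_polynomial p \<Longrightarrow> complex_polynomial q \<Longrightarrow> complex_polynomial (\<lambda>x. p x + q x)"
| mult: "complex_polynomial p \<Longrightarrow> complex_polynomial q \<Longrightarrow> complex_polynomial (\<lambda>x. p x * q x)"

text \<open>
  Algebraicity over \<open>\<complex>(x)\<close>: a nonzero polynomial with coefficients in \<open>\<complex>(x)\<close> annihilates \<open>\<phi>\<close>;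
  denominators are cleared, so the coefficients \<open>a i\<close> lie in \<open>\<complex>[x]\<close>.
\<close>

definition algebraic_on :: "(complex ^ 'n::finite \<Rightarrow> complex) \<Rightarrow> (complex ^ 'n) set \<Rightarrow> bool" where
  "algebraic_on \<phi> U \<longleftrightarrow>
     (\<exists>(N::nat) a. (\<forall>i\<le>N. complex_polynomial (a i)) \<and> (\<exists>i\<le>N. \<exists>x. a i x \<noteq> 0) \<and>
        (\<forall>x\<in>U. (\<Sum>i\<le>N. a i x * \<phi> x ^ i) = 0))"

text \<open>A function on \<open>U\<close> is represented by its extension by zero.\<close>

definition H_alg ::
  "('n::finite \<Rightarrow> nat) \<Rightarrow> complex \<times> complex \<Rightarrow> (complex ^ 'n) set \<Rightarrow> (complex ^ 'n \<Rightarrow> complex) set" where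
  "H_alg e \<alpha> U =
     {\<phi>. (\<forall>x. x \<notin> U \<longrightarrow> \<phi> x = 0) \<and> holomorphic_several \<phi> U \<and>
         solves_hypergeometric e \<alpha> U \<phi> \<and> algebraic_on \<phi> U}"

lemma vector_space_complex_functions:
  "vector_space (\<lambda>(c::complex) (f :: 'a \<Rightarrow> complex) x. c * f x)"
  by unfold_locales (auto simp: fun_eq_iff algebra_simps)

text \<open>
  The dimension of a complex vector space \<open>V\<close> of functions, with value \<open>\<infinity>\<close> if it is infinite
  (the library's \<open>dim\<close> is \<open>0\<close> in that case).
\<close>

definition complex_dim :: "('a \<Rightarrow> complex) set \<Rightarrow> enat" where
  "complex_dim V =
     (SUP B \<in> {B. B \<subseteq> V \<and> finite B \<and>
        \<not> module.dependent (\<lambda>(c::complex) (f :: 'a \<Rightarrow> complex) x. c * f x) B}. enat (card B))"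

end

theory Submission
  imports
    Defs
    "HOL-Computational_Algebra.Fundamental_Theorem_Algebra"
    "HOL-Computational_Algebra.Field_as_Ring"
    "Jordan_Normal_Form.Char_Poly"
    "Subresultants.Subresultant_Gcd"
begin

text \<open>
  Write \<open>f(x;t) = \<Sum>\<^sub>i x\<^sub>i t\<^bsup>e i\<^esup>\<close> and \<open>\<alpha> = (n, b)\<close>. Formally, the integral of
  \<open>f\<^sup>n t\<^bsup>-b\<^esup> dt/t\<close> over a cycle solves the hypergeometric system, and differentiating it with
  respect to \<open>x\<^sub>i\<close> replaces \<open>(n, b)\<close> by \<open>(n - 1, b - e i)\<close>, up to a constant factor that a
  normalization removes. The whole proof is organized by this observation: a \<open>contiguous_family\<close> is
  a doubly indexed family of functions \<open>H a s\<close> such that the derivative of \<open>H a s\<close> in direction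
  \<open>i\<close> is \<open>H (a - 1) (s - e i)\<close> and the two Euler equations hold, at all indices outside the
  semigroup \<open>I\<close> generated by the columns of the matrix. The binomial equations are then automatic,
  since an iterated derivative depends only on the total shift of the index
  (\<open>contiguous_family_solves\<close>). The complement of \<open>I\<close> is stable under these shifts, and \<open>I\<close> is
  exactly the obstruction: outside \<open>I\<close> the integrand has no term \<open>dt/t\<close>, so no logarithms appear.

  Membership in the exceptional set forces \<open>n \<ge> 0\<close> and \<open>b > 0\<close>, and makes \<open>d + 2\<close> algebraic solutions
  available. Primitives of \<open>f\<^sup>n t\<^bsup>-b-1\<^esup>\<close> evaluated at the roots \<open>\<rho>\<close> of \<open>f\<close> give \<open>d\<close>
  solutions (\<open>root_contiguous\<close>); the roots are globally defined on the domain because they form a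
  covering space and the domain is simply connected (\<open>global_root_sections\<close>). Residues at \<open>0\<close> and at
  infinity of \<open>f\<^sup>n log f t\<^bsup>-b-1\<^esup>\<close> give two Laurent polynomials, one with powers of \<open>x\<^sub>0\<close> and one
  with powers of \<open>x\<^sub>d\<close> in the denominator (\<open>laurent_contiguous\<close>).

  These \<open>d + 2\<close> functions span a space of dimension at least \<open>d + 1\<close>: the two Laurent polynomials
  together with all root solutions but one are linearly independent. Indeed a vanishing linear
  combination vanishes at every index \<open>\<alpha> - t\<close> with \<open>t \<in> I\<close>. Deep in the strip \<open>a < 0\<close>,
  \<open>d a < s < 0\<close> the Laurent families are zero, the semigroup contains \<open>d\<close> consecutive points because
  the exponents have greatest common divisor \<open>1\<close>, and the two Euler equations give a recurrence of
  order \<open>d\<close> in \<open>s\<close> whose extreme coefficients vanish only at the edges of the strip. So the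
  combination vanishes in the entire strip (\<open>interior_zeros\<close>). On the level \<open>a = -1\<close> this reads
  \<open>\<Sum>\<^sub>r c\<^sub>r \<rho>\<^sub>r\<^sup>m / f'(\<rho>\<^sub>r) = 0\<close> for \<open>0 \<le> m < d - 1\<close>, and as only \<open>d - 1\<close> roots occur, a Vandermonde
  argument shows that all \<open>c\<^sub>r\<close> are zero. The Laurent polynomials are separated from each other by their
  values at the corners \<open>(-k, 0)\<close> and \<open>(-k, -k d)\<close> of the strip, where exactly one of the two
  families is nonzero (\<open>laurent_solution_corner\<close>).
\<close>

text \<open>The dollar sign denotes components in \<open>\<complex>\<^sup>\<Lambda>\<close>, not of vectors of variable length.\<close>

no_notation vec_index (infixl "$" 100)

section \<open>Gradients of holomorphic functions of several variables\<close>

text \<open>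
The derivative at a point is required to be complex linear, given by a vector of partial
derivatives; all differential calculus below is done with this predicate.
\<close>

definition has_gradient :: "(complex ^ 'n::finite \<Rightarrow> complex) \<Rightarrow> ('n \<Rightarrow> complex) \<Rightarrow> complex ^ 'n \<Rightarrow> bool" where
  "has_gradient \<phi> g x \<longleftrightarrow> (\<phi> has_derivative (\<lambda>v. \<Sum>i\<in>UNIV. g i * v $ i)) (at x)"

lemma has_gradient_const: "has_gradient (\<lambda>_. c) (\<lambda>_. 0) x"
  by (simp add: has_gradient_def)

lemma has_gradient_coord: "has_gradient (\<lambda>x :: complex ^ 'a::finite. x $ j) (\<lambda>i. if i = j then 1 else 0) x"
proof -
  have "(\<lambda>v::complex^'a. \<Sum>i\<in>UNIV. (if i = j then 1 else 0) * v $ i) = (\<lambda>v. v $ j)"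
    by (rule ext) (simp add: if_distrib[where f = "\<lambda>c. c * _"] cong: if_cong)
  then show ?thesis
    unfolding has_gradient_def
    using bounded_linear_imp_has_derivative[OF bounded_linear_vec_nth[of j]] by simp
qed

lemma has_gradient_add:
  assumes "has_gradient \<phi> g x" "has_gradient \<psi> h x"
  shows "has_gradient (\<lambda>x. \<phi> x + \<psi> x) (\<lambda>i. g i + h i) x"
  using has_derivative_add[OF assms[unfolded has_gradient_def]]
  by (simp add: has_gradient_def sum.distrib distrib_right)

lemma has_gradient_mult:
  assumes "has_gradient \<phi> g x" "has_gradient \<psi> h x"
  shows "has_gradient (\<lambda>x. \<phi> x * \<psi> x) (\<lambda>i. g i * \<psi> x + \<phi> x * h i) x"
proof -
  have "(\<lambda>v. \<phi> x * (\<Sum>i\<in>UNIV. h i * v $ i) + (\<Sum>i\<in>UNIV. g i * v $ i) * \<psi> x) =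
        (\<lambda>v. \<Sum>i\<in>UNIV. (g i * \<psi> x + \<phi> x * h i) * v $ i)"
    by (rule ext)
      (simp add: sum.distrib distrib_left distrib_right sum_distrib_left sum_distrib_right mult_ac)
  then show ?thesis
    using has_derivative_mult[OF assms[unfolded has_gradient_def]]
    by (simp add: has_gradient_def)
qed

lemma has_gradient_cmult:
  assumes "has_gradient \<phi> g x"
  shows "has_gradient (\<lambda>x. c * \<phi> x) (\<lambda>i. c * g i) x"
  using has_gradient_mult[OF has_gradient_const[of c] assms] by simp

lemma has_gradient_sum:
  assumes "\<And>k. k \<in> A \<Longrightarrow> has_gradient (\<phi> k) (g k) x"
  shows "has_gradient (\<lambda>x. \<Sum>k\<in>A. \<phi> k x) (\<lambda>i. \<Sum>k\<in>A. g k i) x"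
  using assms
  by (induction A rule: infinite_finite_induct) (auto intro: has_gradient_const has_gradient_add)

lemma has_gradient_chain:
  assumes "has_gradient \<phi> g x" "(F has_field_derivative F') (at (\<phi> x))"
  shows "has_gradient (\<lambda>x. F (\<phi> x)) (\<lambda>i. F' * g i) x"
proof -
  have "((\<lambda>x. F (\<phi> x)) has_derivative (\<lambda>v. F' * (\<Sum>i\<in>UNIV. g i * v $ i))) (at x)"
    by (rule has_derivative_compose[OF assms(1)[unfolded has_gradient_def]
          assms(2)[unfolded has_field_derivative_def]])
  then show ?thesis
    by (simp add: has_gradient_def sum_distrib_left mult_ac)
qed

lemma has_gradient_cong:
  assumes "has_gradient \<phi> g x" "open U" "x \<in> U" "\<And>y. y \<in> U \<Longrightarrow> \<psi> y = \<phi> y" "\<And>i. h i = g i"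
  shows "has_gradient \<psi> h x"
proof -
  have "h = g" using assms(5) by auto
  then show ?thesis
    using has_derivative_transform_within_open[OF assms(1)[unfolded has_gradient_def] assms(2,3)] assms(4)
    unfolding has_gradient_def by simp
qed

lemma has_gradient_partial:
  assumes "has_gradient \<phi> g x"
  shows "partial i \<phi> x = g i"
proof -
  let ?s = "\<lambda>z. (\<chi> j. if j = i then z else x $ j) :: complex ^ 'a"
  have s: "?s = (\<lambda>z. x + (z - x $ i) *s axis i 1)"
    by (rule ext) (auto simp: Finite_Cartesian_Product.vec_eq_iff axis_def)
  have "((\<lambda>z. x + (z - x $ i) *s axis i 1) has_derivative (\<lambda>z. z *s axis i 1)) (at (x $ i))"
  proof -
    have "bounded_linear (\<lambda>z::complex. z *s (axis i 1 :: complex ^ 'a))"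
      unfolding linear_conv_bounded_linear[symmetric]
      by (rule linearI) (auto simp: Finite_Cartesian_Product.vec_eq_iff algebra_simps)
    from has_derivative_add[OF has_derivative_const
        bounded_linear.has_derivative[OF this
          has_derivative_diff[OF has_derivative_ident has_derivative_const]]]
    show ?thesis by simp
  qed
  then have d: "(?s has_derivative (\<lambda>z. z *s axis i 1)) (at (x $ i))" by (simp only: s)
  have "?s (x $ i) = x" by (auto simp: Finite_Cartesian_Product.vec_eq_iff)
  then have "(\<phi> has_derivative (\<lambda>v. \<Sum>i\<in>UNIV. g i * v $ i)) (at (?s (x $ i)))"
    using assms unfolding has_gradient_def by simp
  from has_derivative_compose[OF d this] have "((\<lambda>z. \<phi> (?s z)) has_derivative (\<lambda>z. \<Sum>j\<in>UNIV. g j * (z *s axis i 1) $ j)) (at (x $ i))" .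
  moreover have "(\<lambda>z. \<Sum>j\<in>UNIV. g j * ((z::complex) *s axis i 1) $ j) = (\<lambda>z. g i * z)"
    by (rule ext) (simp add: axis_def if_distrib[where f = "\<lambda>c. _ * c"] cong: if_cong)
  ultimately have "((\<lambda>z. \<phi> (?s z)) has_field_derivative g i) (at (x $ i))"
    by (simp add: has_field_derivative_def)
  then show ?thesis
    unfolding partial_def by (rule DERIV_imp_deriv)
qed

text \<open>
Partial derivatives are local, so functions that are only meaningful on an open set may be
rewritten there before they are differentiated again.
\<close>

lemma partial_cong:
  assumes "open U" "x \<in> U" "\<And>y. y \<in> U \<Longrightarrow> \<psi> y = \<phi> y"
  shows "partial i \<psi> x = partial i \<phi> x"
proof -
  let ?s = "\<lambda>z. (\<chi> j. if j = i then z else x $ j) :: complex ^ 'a"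
  have "continuous_on UNIV ?s"
  proof (rule continuous_on_vec_lambda)
    fix j
    show "continuous_on UNIV (\<lambda>z. if j = i then z else x $ j)"
      by (cases "j = i") simp_all
  qed
  then have "open (?s -` U)" using assms(1) by (simp add: open_vimage)
  moreover have "?s (x $ i) = x" by (auto simp: Finite_Cartesian_Product.vec_eq_iff)
  ultimately have "\<forall>\<^sub>F z in nhds (x $ i). ?s z \<in> U"
    using assms(2) unfolding eventually_nhds by (intro exI[of _ "?s -` U"]) auto
  then have "\<forall>\<^sub>F z in nhds (x $ i). \<psi> (?s z) = \<phi> (?s z)"
    by eventually_elim (use assms(3) in auto)
  then show ?thesis
    unfolding partial_def by (intro deriv_cong_ev) auto
qed

section \<open>Families of functions connected by differentiation\<close>

text \<open>
The model for \<open>a \<ge> 0\<close> is \<open>H a s = (1/a!) \<integral> f\<^sup>a t\<^bsup>-s\<^esup> dt/t\<close>: the three clauses are differentiation under the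
integral sign, homogeneity of the integrand in \<open>x\<close>, and integration by parts. They are required only
outside the semigroup, where the integrand has no logarithmic primitive.
\<close>

definition contiguous_family ::
  "('n::finite \<Rightarrow> nat) \<Rightarrow> (complex ^ 'n) set \<Rightarrow> (int \<Rightarrow> int \<Rightarrow> complex ^ 'n \<Rightarrow> complex) \<Rightarrow> bool" where
  "contiguous_family e U H \<longleftrightarrow>
     (\<forall>a s. (a, s) \<notin> I_set (range e) \<longrightarrow> (\<forall>x\<in>U.
        has_gradient (H a s) (\<lambda>i. H (a - 1) (s - int (e i)) x) x \<and>
        (\<Sum>i\<in>UNIV. x $ i * H (a - 1) (s - int (e i)) x) = of_int a * H a s x \<and>
        (\<Sum>i\<in>UNIV. of_nat (e i) * x $ i * H (a - 1) (s - int (e i)) x) = of_int s * H a s x))"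

lemma contiguous_familyD:
  assumes "contiguous_family e U H" "(a, s) \<notin> I_set (range e)" "x \<in> U"
  shows "has_gradient (H a s) (\<lambda>i. H (a - 1) (s - int (e i)) x) x"
    and "(\<Sum>i\<in>UNIV. x $ i * H (a - 1) (s - int (e i)) x) = of_int a * H a s x"
    and "(\<Sum>i\<in>UNIV. of_nat (e i) * x $ i * H (a - 1) (s - int (e i)) x) = of_int s * H a s x"
  using assms unfolding contiguous_family_def by blast+

lemma contiguous_family_add:
  assumes "contiguous_family e U H" "contiguous_family e U G"
  shows "contiguous_family e U (\<lambda>a s x. H a s x + G a s x)"
  using assms unfolding contiguous_family_def
  by (auto simp: distrib_left sum.distrib intro: has_gradient_add)

lemma contiguous_family_cmult:
  assumes "contiguous_family e U H"
  shows "contiguous_family e U (\<lambda>a s x. c * H a s x)"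
proof -
  have "(\<Sum>i\<in>UNIV. f i * (c * g i)) = c * (\<Sum>i\<in>UNIV. f i * g i)" for f g :: "'a \<Rightarrow> complex"
    by (simp add: sum_distrib_left mult_ac)
  then show ?thesis
    using assms unfolding contiguous_family_def
    by (auto intro: has_gradient_cmult)
qed

lemma contiguous_family_zero: "contiguous_family e U (\<lambda>a s x. 0)"
  by (simp add: contiguous_family_def has_gradient_const)

lemma contiguous_family_sum:
  assumes "\<And>j. j \<in> A \<Longrightarrow> contiguous_family e U (H j)"
  shows "contiguous_family e U (\<lambda>a s x. \<Sum>j\<in>A. H j a s x)"
  using assms
  by (induction A rule: infinite_finite_induct)
    (auto intro: contiguous_family_zero contiguous_family_add)

lemma nat_span_image:
  fixes e :: "'n::finite \<Rightarrow> nat"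
  assumes "inj e"
  shows "(a, s) \<in> nat_span (e ` J) \<longleftrightarrow>
    (\<exists>w :: 'n \<Rightarrow> nat. a = int (\<Sum>i\<in>J. w i) \<and> s = int (\<Sum>i\<in>J. w i * e i))"
proof
  assume "(a, s) \<in> nat_span (e ` J)"
  then obtain u where u: "a = (\<Sum>j\<in>e ` J. int (u j))" "s = (\<Sum>j\<in>e ` J. int (u j) * int j)"
    unfolding nat_span_def by auto
  have "inj_on e J" using assms by (rule inj_on_subset) auto
  with u show "\<exists>w :: 'n \<Rightarrow> nat. a = int (\<Sum>i\<in>J. w i) \<and> s = int (\<Sum>i\<in>J. w i * e i)"
    by (intro exI[of _ "u \<circ> e"]) (auto simp: sum.reindex)
next
  assume "\<exists>w :: 'n \<Rightarrow> nat. a = int (\<Sum>i\<in>J. w i) \<and> s = int (\<Sum>i\<in>J. w i * e i)"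
  then obtain w where w: "a = int (\<Sum>i\<in>J. w i)" "s = int (\<Sum>i\<in>J. w i * e i)" by auto
  have inj: "inj_on e J" using assms by (rule inj_on_subset) auto
  define u where "u = w \<circ> inv_into UNIV e"
  have [simp]: "u (e i) = w i" for i using assms by (simp add: u_def)
  have "a = (\<Sum>j\<in>e ` J. int (u j))" "s = (\<Sum>j\<in>e ` J. int (u j) * int j)"
    using w inj by (auto simp: sum.reindex)
  then show "(a, s) \<in> nat_span (e ` J)" unfolding nat_span_def by blast
qed

lemma nat_span_step:
  fixes e :: "'n::finite \<Rightarrow> nat"
  assumes "inj e" "(a - 1, s - int (e i)) \<in> nat_span (e ` J)" "i \<in> J"
  shows "(a, s) \<in> nat_span (e ` J)"
proof -
  obtain w where w: "a - 1 = int (\<Sum>j\<in>J. w j)" "s - int (e i) = int (\<Sum>j\<in>J. w j * e j)"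
    using assms(2) nat_span_image[OF assms(1)] by metis
  have J: "finite J" by simp
  have "(\<Sum>j\<in>J. (w(i := Suc (w i))) j) = Suc (\<Sum>j\<in>J. w j)"
    using sum.remove[OF J assms(3), of "w(i := Suc (w i))"] sum.remove[OF J assms(3), of w] by simp
  moreover have "(\<Sum>j\<in>J. (w(i := Suc (w i))) j * e j) = e i + (\<Sum>j\<in>J. w j * e j)"
    using sum.remove[OF J assms(3), of "\<lambda>j. (w(i := Suc (w i))) j * e j"]
      sum.remove[OF J assms(3), of "\<lambda>j. w j * e j"] by simp
  ultimately have "a = int (\<Sum>j\<in>J. (w(i := Suc (w i))) j)"
      "s = int (\<Sum>j\<in>J. (w(i := Suc (w i))) j * e j)"
    using w by simp_all
  then show ?thesis unfolding nat_span_image[OF assms(1)] by blast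
qed

lemma nat_span_add:
  assumes "(a, s) \<in> nat_span J" "(a', s') \<in> nat_span J"
  shows "(a + a', s + s') \<in> nat_span J"
proof -
  obtain u u' where "a = (\<Sum>j\<in>J. int (u j))" "s = (\<Sum>j\<in>J. int (u j) * int j)"
     "a' = (\<Sum>j\<in>J. int (u' j))" "s' = (\<Sum>j\<in>J. int (u' j) * int j)"
    using assms unfolding nat_span_def by auto
  then have "a + a' = (\<Sum>j\<in>J. int (u j + u' j))" "s + s' = (\<Sum>j\<in>J. int (u j + u' j) * int j)"
    by (simp_all add: sum.distrib distrib_right)
  then show ?thesis unfolding nat_span_def by (intro CollectI exI[of _ "\<lambda>j. u j + u' j"]) simp
qed

text \<open>
This is what makes contiguous families closed under differentiation: from an index outside the
semigroup, derivatives never lead into it.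
\<close>

lemma not_I_set_step:
  fixes e :: "'n::finite \<Rightarrow> nat"
  assumes "inj e" "(a, s) \<notin> I_set (range e)"
  shows "(a - 1, s - int (e i)) \<notin> I_set (range e)"
  using nat_span_step[OF assms(1), of a s i UNIV] assms(2) unfolding I_set_def by auto

lemma partial_power_family:
  assumes fam: "contiguous_family e U H" and "open U" "inj e"
  assumes "(a, s) \<notin> I_set (range e)" "\<And>x. x \<in> U \<Longrightarrow> \<phi> x = H a s x"
  shows "(a - int n, s - int n * int (e i)) \<notin> I_set (range e) \<and>
    (\<forall>x\<in>U. (partial i ^^ n) \<phi> x = H (a - int n) (s - int n * int (e i)) x)"
proof (induction n)
  case 0
  then show ?case using assms by simp
next
  case (Suc n)
  let ?a = "a - int n" and ?s = "s - int n * int (e i)"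
  have eq: "?a - 1 = a - int (Suc n)" "?s - int (e i) = s - int (Suc n) * int (e i)"
    by (simp_all add: algebra_simps)
  have "(partial i ^^ Suc n) \<phi> x = H (?a - 1) (?s - int (e i)) x" if x: "x \<in> U" for x
  proof -
    have "partial i ((partial i ^^ n) \<phi>) x = partial i (H ?a ?s) x"
      using Suc by (intro partial_cong[OF \<open>open U\<close> x]) auto
    also have "\<dots> = H (?a - 1) (?s - int (e i)) x"
      using Suc x by (intro has_gradient_partial contiguous_familyD(1)[OF fam]) auto
    finally show ?thesis by simp
  qed
  then show ?case
    using not_I_set_step[OF \<open>inj e\<close>, of ?a ?s i] Suc unfolding eq by auto
qed

text \<open>
An iterated derivative of a member of the family depends on the exponents \<open>u\<close> only through the
lattice point that they represent. This is the reason why the binomial equations hold.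
\<close>

lemma mixed_partial_family:
  assumes fam: "contiguous_family e U H" and "open U" "inj e"
  assumes "(a, s) \<notin> I_set (range e)" "\<And>x. x \<in> U \<Longrightarrow> \<phi> x = H a s x" "x \<in> U"
  shows "mixed_partial e u \<phi> x =
    H (a - int (\<Sum>i\<in>UNIV. u i)) (s - int (\<Sum>i\<in>UNIV. u i * e i)) x"
proof -
  define v where "v = (\<lambda>j. u (inv_into UNIV e j))"
  have *: "(a - int (sum_list (map v js)), s - int (\<Sum>j\<leftarrow>js. v j * j)) \<notin> I_set (range e) \<and>
      (\<forall>x\<in>U. foldr (\<lambda>j. partial (inv_into UNIV e j) ^^ u (inv_into UNIV e j)) js \<phi> x =
         H (a - int (sum_list (map v js))) (s - int (\<Sum>j\<leftarrow>js. v j * j)) x)"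
    if "set js \<subseteq> range e" for js
    using that
  proof (induction js)
    case Nil
    then show ?case using assms by simp
  next
    case (Cons j js)
    have e: "e (inv_into UNIV e j) = j" using Cons.prems by (simp add: f_inv_into_f)
    have eq: "a - int (sum_list (map v js)) - int (v j) = a - int (sum_list (map v (j # js)))"
      "s - int (\<Sum>j\<leftarrow>js. v j * j) - int (v j) * int j = s - int (\<Sum>j\<leftarrow>j # js. v j * j)"
      by simp_all
    show ?case
      using partial_power_family[OF fam \<open>open U\<close> \<open>inj e\<close>, where i = "inv_into UNIV e j" and n = "v j"
          and a = "a - int (sum_list (map v js))" and s = "s - int (\<Sum>j\<leftarrow>js. v j * j)"
          and \<phi> = "foldr (\<lambda>j. partial (inv_into UNIV e j) ^^ u (inv_into UNIV e j)) js \<phi>"] Cons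
      unfolding e eq by (simp add: v_def)
  qed
  let ?L = "sorted_list_of_set (range e)"
  have "sum_list (map v ?L) = (\<Sum>i\<in>UNIV. u i)"
    using \<open>inj e\<close> by (simp add: sum_list_distinct_conv_sum_set sum.reindex v_def)
  moreover have "(\<Sum>j\<leftarrow>?L. v j * j) = (\<Sum>i\<in>UNIV. u i * e i)"
    using \<open>inj e\<close> by (simp add: sum_list_distinct_conv_sum_set sum.reindex v_def)
  ultimately show ?thesis
    using *[of ?L] \<open>x \<in> U\<close> unfolding mixed_partial_def by simp
qed

lemma contiguous_family_solves:
  fixes e :: "'n::finite \<Rightarrow> nat"
  assumes fam: "contiguous_family e U H" and "open U" "inj e" and I: "(a, s) \<notin> I_set (range e)"
    and \<phi>: "\<And>x. x \<in> U \<Longrightarrow> \<phi> x = H a s x"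
  shows "solves_hypergeometric e (of_int a, of_int s) U \<phi>"
proof -
  have grad: "has_gradient \<phi> (\<lambda>i. H (a - 1) (s - int (e i)) x) x" if "x \<in> U" for x
    by (rule has_gradient_cong[OF contiguous_familyD(1)[OF fam I that] \<open>open U\<close> that \<phi> refl])
  have "mixed_partial e (\<lambda>i. nat (v i)) \<phi> x = mixed_partial e (\<lambda>i. nat (- v i)) \<phi> x"
    if "(\<Sum>i\<in>UNIV. v i) = 0" "(\<Sum>i\<in>UNIV. int (e i) * v i) = 0" "x \<in> U" for v x
  proof -
    have "int (\<Sum>i\<in>UNIV. nat (v i)) - int (\<Sum>i\<in>UNIV. nat (- v i)) = (\<Sum>i\<in>UNIV. v i)"
      unfolding of_nat_sum sum_subtractf[symmetric] by (intro sum.cong) auto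
    moreover have "int (\<Sum>i\<in>UNIV. nat (v i) * e i) - int (\<Sum>i\<in>UNIV. nat (- v i) * e i)
        = (\<Sum>i\<in>UNIV. int (e i) * v i)"
      unfolding of_nat_sum sum_subtractf[symmetric] by (intro sum.cong) (auto simp: left_diff_distrib[symmetric])
    ultimately have "int (\<Sum>i\<in>UNIV. nat (v i)) = int (\<Sum>i\<in>UNIV. nat (- v i))"
      "int (\<Sum>i\<in>UNIV. nat (v i) * e i) = int (\<Sum>i\<in>UNIV. nat (- v i) * e i)"
      using that by linarith+
    moreover have "mixed_partial e u \<phi> x =
        H (a - int (\<Sum>i\<in>UNIV. u i)) (s - int (\<Sum>i\<in>UNIV. u i * e i)) x" for u
      using \<phi> that(3) by (intro mixed_partial_family[OF fam \<open>open U\<close> \<open>inj e\<close> I])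
    ultimately show ?thesis by (simp only:)
  qed
  then show ?thesis
    unfolding solves_hypergeometric_def
    using contiguous_familyD(2,3)[OF fam I] by (simp add: has_gradient_partial[OF grad] \<phi>)
qed

lemma contiguous_family_holomorphic:
  assumes fam: "contiguous_family e U H" and "open U" and I: "(a, s) \<notin> I_set (range e)"
    and \<phi>: "\<And>x. x \<in> U \<Longrightarrow> \<phi> x = H a s x"
  shows "holomorphic_several \<phi> U"
proof -
  have "has_gradient \<phi> (\<lambda>i. H (a - 1) (s - int (e i)) x) x" if "x \<in> U" for x
    by (rule has_gradient_cong[OF contiguous_familyD(1)[OF fam I that] \<open>open U\<close> that \<phi> refl])
  then show ?thesis
    unfolding holomorphic_several_def has_gradient_def
    by (intro ballI exI conjI allI) (assumption | auto simp: sum_distrib_left mult_ac)+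
qed

text \<open>
Derivatives of the zero function are zero, and the derivatives of \<open>H a s\<close> are the members of the
family at the indices \<open>(a, s) - t\<close>, \<open>t\<close> in the semigroup. Applied to a linear combination of
families, this turns one linear relation into infinitely many.
\<close>

lemma contiguous_family_vanish:
  fixes e :: "'n::finite \<Rightarrow> nat"
  assumes fam: "contiguous_family e U H" and "open U" "inj e" and I: "(a, s) \<notin> I_set (range e)"
    and 0: "\<And>x. x \<in> U \<Longrightarrow> H a s x = 0"
    and t: "(a', s') \<in> I_set (range e)" and x: "x \<in> U"
  shows "H (a - a') (s - s') x = 0"
proof -
  obtain w where w: "a' = int (\<Sum>i\<in>UNIV. w i)" "s' = int (\<Sum>i\<in>UNIV. w i * e i)"
    using t nat_span_image[OF \<open>inj e\<close>] unfolding I_set_def by metis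
  have "mixed_partial e w (H a s) x = H (a - a') (s - s') x"
    unfolding w by (rule mixed_partial_family[OF fam \<open>open U\<close> \<open>inj e\<close> I refl x])
  moreover have "mixed_partial e w (H a s) x = (0 :: complex)"
    using mixed_partial_family[OF contiguous_family_zero[of e U] \<open>open U\<close> \<open>inj e\<close> I, of "H a s" x w] 0 x
    by simp
  ultimately show ?thesis by simp
qed

section \<open>Divided powers of the generic polynomial\<close>

text \<open>
The coefficient of \<open>t\<^sup>c\<close> in the divided power \<open>f\<^sub>J\<^sup>a / a!\<close>, where \<open>f\<^sub>J\<close> is the sum of the terms
\<open>x\<^sub>i t\<^bsup>e i\<^esup>\<close> with \<open>i \<in> J\<close>. The recursion is multiplication by \<open>f\<^sub>J\<close>; with this normalization,
differentiation shifts the index without introducing a factor.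
\<close>

fun divpow :: "('n::finite \<Rightarrow> nat) \<Rightarrow> 'n set \<Rightarrow> nat \<Rightarrow> int \<Rightarrow> complex ^ 'n \<Rightarrow> complex" where
  "divpow e J 0 c x = (if c = 0 then 1 else 0)"
| "divpow e J (Suc a) c x = (\<Sum>i\<in>J. x $ i * divpow e J a (c - int (e i)) x) / of_nat (Suc a)"

text \<open>
The extension by zero to negative \<open>a\<close> makes the contiguity relations hold for all integers \<open>a\<close>.
\<close>

definition divided_power ::
  "('n::finite \<Rightarrow> nat) \<Rightarrow> 'n set \<Rightarrow> int \<Rightarrow> int \<Rightarrow> complex ^ 'n \<Rightarrow> complex" where
  "divided_power e J a c x = (if a < 0 then 0 else divpow e J (nat a) c x)"

lemma divided_power_neg: "a < 0 \<Longrightarrow> divided_power e J a c x = 0"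
  by (simp add: divided_power_def)

lemma divided_power_0: "divided_power e J 0 c x = (if c = 0 then 1 else 0)"
  by (simp add: divided_power_def)

lemma divided_power_euler1:
  "(\<Sum>i\<in>J. x $ i * divided_power e J (a - 1) (c - int (e i)) x) = of_int a * divided_power e J a c x"
proof (cases "a \<ge> 1")
  case True
  then obtain n where n: "a = int (Suc n)"
    by (intro that[of "nat (a - 1)"]) simp
  have "nat (1 + int n) = Suc n" by simp
  then show ?thesis
    unfolding n by (simp add: divided_power_def del: of_nat_Suc) (simp add: field_simps)
next
  case False
  then consider "a = 0" | "a < 0" by linarith
  then show ?thesis by cases (simp_all add: divided_power_def)
qed

lemma divided_power_induct [case_names neg zero step]:
  assumes "\<And>a. a < 0 \<Longrightarrow> P a" "P 0" "\<And>a. a \<ge> 1 \<Longrightarrow> P (a - 1) \<Longrightarrow> P a"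
  shows "P (a :: int)"
proof (cases "a < 0")
  case False
  then have "0 \<le> a" by simp
  then show ?thesis
  proof (induction a rule: int_ge_induct)
    case (step i)
    then show ?case using assms(3)[of "i + 1"] by simp
  qed (use assms in auto)
qed (use assms in auto)

lemma divided_power_rec:
  assumes "a \<ge> 1"
  shows "divided_power e J a c x =
    (\<Sum>i\<in>J. x $ i * divided_power e J (a - 1) (c - int (e i)) x) / of_int a"
  unfolding divided_power_euler1 using assms by simp

text \<open>
The coefficient form of \<open>t (f\<^sup>a/a!)' = (f\<^bsup>a-1\<^esup>/(a-1)!) t f'\<close>. In the induction, \<open>f\<close> is split off one
of the factors, and the first Euler relation is used twice.
\<close>

lemma divided_power_euler2:
  "(\<Sum>i\<in>J. of_nat (e i) * x $ i * divided_power e J (a - 1) (c - int (e i)) x) =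
     of_int c * divided_power e J a c x"
proof (induction a arbitrary: c rule: divided_power_induct)
  case (step a)
  let ?D = "divided_power e J"
  let ?S = "\<Sum>j\<in>J. of_nat (e j) * x $ j * ?D (a - 1) (c - int (e j)) x"
  have "of_int (a - 1) * ?S =
     (\<Sum>j\<in>J. \<Sum>i\<in>J. of_nat (e j) * x $ j * (x $ i * ?D (a - 1 - 1) (c - int (e j) - int (e i)) x))"
    unfolding sum_distrib_left[symmetric] divided_power_euler1
    by (simp add: sum_distrib_left mult_ac)
  also have "\<dots> = (\<Sum>i\<in>J. x $ i * (\<Sum>j\<in>J. of_nat (e j) * x $ j * ?D (a - 1 - 1) (c - int (e i) - int (e j)) x))"
    by (subst sum.swap) (simp add: sum_distrib_left mult_ac diff_diff_eq add.commute)
  also have "\<dots> = (\<Sum>i\<in>J. x $ i * (of_int (c - int (e i)) * ?D (a - 1) (c - int (e i)) x))"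
    unfolding step.IH ..
  also have "\<dots> = of_int c * (\<Sum>i\<in>J. x $ i * ?D (a - 1) (c - int (e i)) x) - ?S"
    by (simp add: algebra_simps sum_subtractf sum_distrib_left)
  also have "(\<Sum>i\<in>J. x $ i * ?D (a - 1) (c - int (e i)) x) = of_int a * ?D a c x"
    by (rule divided_power_euler1)
  finally have "of_int a * ?S = of_int a * (of_int c * ?D a c x)"
    by (simp add: algebra_simps)
  then show ?case using step.hyps by simp
qed (simp_all add: divided_power_def)

lemma divided_power_gradient:
  "has_gradient (divided_power e J a c)
     (\<lambda>i. if i \<in> J then divided_power e J (a - 1) (c - int (e i)) x else 0) x"
proof (induction a arbitrary: c rule: divided_power_induct)
  case (neg a)
  then show ?case
    using has_gradient_cong[OF has_gradient_const[of 0 x] open_UNIV UNIV_I] by (simp add: divided_power_def)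
next
  case zero
  show ?case
    using has_gradient_cong[OF has_gradient_const[of "if c = 0 then 1 else 0" x] open_UNIV UNIV_I]
    by (simp add: divided_power_def)
next
  case (step a)
  let ?D = "divided_power e J"
  let ?g = "\<lambda>c i. if i \<in> J then ?D (a - 1 - 1) (c - int (e i)) x else 0"
  have grad: "has_gradient (\<lambda>x. (1 / of_int a) * (\<Sum>j\<in>J. x $ j * ?D (a - 1) (c - int (e j)) x))
     (\<lambda>i. (1 / of_int a) * (\<Sum>j\<in>J. (if i = j then 1 else 0) * ?D (a - 1) (c - int (e j)) x
              + x $ j * ?g (c - int (e j)) i)) x"
    by (intro has_gradient_cmult has_gradient_sum has_gradient_mult has_gradient_coord step.IH)
  have comp: "(1 / of_int a) * (\<Sum>j\<in>J. (if i = j then 1 else 0) * ?D (a - 1) (c - int (e j)) x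
              + x $ j * ?g (c - int (e j)) i) = (if i \<in> J then ?D (a - 1) (c - int (e i)) x else 0)" for i
  proof (cases "i \<in> J")
    case True
    have "(\<Sum>j\<in>J. x $ j * ?g (c - int (e j)) i) =
       (\<Sum>j\<in>J. x $ j * ?D (a - 1 - 1) (c - int (e i) - int (e j)) x)"
      using True by (simp add: diff_diff_eq add.commute)
    also have "\<dots> = of_int (a - 1) * ?D (a - 1) (c - int (e i)) x"
      by (rule divided_power_euler1)
    finally show ?thesis
      using True step.hyps
      by (simp add: sum.distrib if_distrib[where f = "\<lambda>c. c * _"] field_simps cong: if_cong)
  next
    case False
    then have "(if i = j then 1 else 0) * ?D (a - 1) (c - int (e j)) x + x $ j * ?g (c - int (e j)) i = 0"
      if "j \<in> J" for j
      using that by auto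
    then have "(\<Sum>j\<in>J. (if i = j then 1 else 0) * ?D (a - 1) (c - int (e j)) x
              + x $ j * ?g (c - int (e j)) i) = 0"
      by (rule sum.neutral[rule_format])
    then show ?thesis using False by (simp only: mult_zero_right if_False)
  qed
  show ?case
    by (rule has_gradient_cong[OF grad open_UNIV UNIV_I _ comp[symmetric]])
      (simp add: divided_power_rec[OF step.hyps(1)])
qed

lemma divided_power_support:
  fixes e :: "'n::finite \<Rightarrow> nat"
  assumes "inj e" "divided_power e J a c x \<noteq> 0"
  shows "(a, c) \<in> nat_span (e ` J)"
  using assms(2)
proof (induction a arbitrary: c rule: divided_power_induct)
  case zero
  then have "c = 0" by (simp add: divided_power_0 split: if_splits)
  then show ?case unfolding nat_span_image[OF assms(1)] by (intro exI[of _ "\<lambda>_. 0"]) simp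
next
  case (step a)
  then have "(\<Sum>i\<in>J. x $ i * divided_power e J (a - 1) (c - int (e i)) x) \<noteq> 0"
    by (auto simp: divided_power_rec)
  then obtain i where "i \<in> J" "divided_power e J (a - 1) (c - int (e i)) x \<noteq> 0"
    by (elim sum.not_neutral_contains_not_neutral) simp
  then show ?case using nat_span_step[OF assms(1)] step.IH by blast
qed (simp add: divided_power_neg)

lemma nat_span_bounds:
  fixes e :: "'n::finite \<Rightarrow> nat"
  assumes "inj e" "(a, c) \<in> nat_span (e ` J)" "\<And>i. i \<in> J \<Longrightarrow> lo \<le> e i" "\<And>i. i \<in> J \<Longrightarrow> e i \<le> hi"
  shows "0 \<le> a" "int lo * a \<le> c" "c \<le> int hi * a"
proof -
  obtain w where w: "a = int (\<Sum>i\<in>J. w i)" "c = int (\<Sum>i\<in>J. w i * e i)"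
    using assms(2) nat_span_image[OF assms(1)] by metis
  have "lo * (\<Sum>i\<in>J. w i) \<le> (\<Sum>i\<in>J. w i * e i)" "(\<Sum>i\<in>J. w i * e i) \<le> hi * (\<Sum>i\<in>J. w i)"
    unfolding sum_distrib_left using assms(3,4) by (auto intro!: sum_mono simp: mult.commute)
  then show "0 \<le> a" "int lo * a \<le> c" "c \<le> int hi * a"
    unfolding w by (simp_all only: of_nat_mult[symmetric] of_nat_le_iff of_nat_0_le_iff)
qed

section \<open>Laurent polynomial solutions\<close>

text \<open>
The exponents of the generic polynomial are distinct and at most \<open>d\<close>.
\<close>

locale monomial_curve =
  fixes e :: "'n::finite \<Rightarrow> nat" and d :: nat
  assumes inj_e: "inj e" and d_ge_2: "d \<ge> 2" and e_le: "e i \<le> d"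
begin

text \<open>
Up to a factor \<open>-1\<close>, which is irrelevant for the dimension, these are the coefficients of the divided powers of
\<open>f - x\<^sub>l t\<^bsup>e l\<^esup>\<close> in the expansion of \<open>log f\<close> around the single term \<open>x\<^sub>l t\<^bsup>e l\<^esup>\<close>, with factorials
arranged so that each one is the derivative of its predecessor.
\<close>

definition laurent_coeff :: "'n \<Rightarrow> nat \<Rightarrow> complex ^ 'n \<Rightarrow> complex" where
  "laurent_coeff l k x = (- 1) ^ k * fact (k - 1) * inverse (x $ l) ^ k"

definition laurent_term :: "'n \<Rightarrow> int \<Rightarrow> int \<Rightarrow> nat \<Rightarrow> complex ^ 'n \<Rightarrow> complex" where
  "laurent_term l a s k x =
     laurent_coeff l k x * divided_power e (- {l}) (a + int k) (s + int k * int (e l)) x"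

text \<open>
Beyond this index all terms vanish if \<open>e l\<close> is one of the extreme exponents \<open>0\<close> and \<open>d\<close>; one bound is
used for both of them.
\<close>

definition laurent_bound :: "int \<Rightarrow> int \<Rightarrow> nat" where
  "laurent_bound a s = nat (\<bar>s\<bar> + int d * \<bar>a\<bar>)"

definition laurent_solution :: "'n \<Rightarrow> int \<Rightarrow> int \<Rightarrow> complex ^ 'n \<Rightarrow> complex" where
  "laurent_solution l a s x = (\<Sum>k\<in>{1..laurent_bound a s}. laurent_term l a s k x)"

lemma exponent_ne_bounds:
  assumes "i \<noteq> l"
  shows "e l = 0 \<Longrightarrow> 1 \<le> e i" "e l = d \<Longrightarrow> e i \<le> d - 1"
proof -
  have "e i \<noteq> e l" using inj_e assms by (meson injD)
  then show "e l = 0 \<Longrightarrow> 1 \<le> e i" "e l = d \<Longrightarrow> e i \<le> d - 1" using e_le[of i] by auto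
qed

text \<open>
Without the constant term, \<open>f\<^sup>a\<close> has order at least \<open>a\<close> at \<open>0\<close>; without the leading term, it has
degree at most \<open>(d - 1) a\<close>.
\<close>

lemma punctured_support:
  assumes "divided_power e (- {l}) a c x \<noteq> 0"
  shows "0 \<le> a" "e l = 0 \<Longrightarrow> a \<le> c" "e l = d \<Longrightarrow> c \<le> (int d - 1) * a"
proof -
  have s: "(a, c) \<in> nat_span (e ` (- {l}))" by (rule divided_power_support[OF inj_e assms])
  show "0 \<le> a" using nat_span_bounds(1)[OF inj_e s, of 0 d] e_le by simp
  show "a \<le> c" if "e l = 0"
    using nat_span_bounds(2)[OF inj_e s, of 1 d] e_le exponent_ne_bounds(1) that by simp
  show "c \<le> (int d - 1) * a" if "e l = d"
    using nat_span_bounds(3)[OF inj_e s, of 0 "d - 1"] exponent_ne_bounds(2) that d_ge_2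
    by (simp add: of_nat_diff)
qed

lemma laurent_term_zero:
  assumes l: "e l \<in> {0, d}" and k: "k > laurent_bound a s"
  shows "laurent_term l a s k x = 0"
proof (rule ccontr)
  assume "laurent_term l a s k x \<noteq> 0"
  then have nz: "divided_power e (- {l}) (a + int k) (s + int k * int (e l)) x \<noteq> 0"
    by (simp add: laurent_term_def)
  have k: "int k > \<bar>s\<bar> + int d * \<bar>a\<bar>"
    using k unfolding laurent_bound_def by linarith
  have da: "(int d - 1) * a \<le> int d * \<bar>a\<bar>" "\<bar>a\<bar> \<le> int d * \<bar>a\<bar>"
  proof -
    have "(int d - 1) * a \<le> (int d - 1) * \<bar>a\<bar>" using d_ge_2 by (intro mult_left_mono) auto
    also have "\<dots> \<le> int d * \<bar>a\<bar>" by (intro mult_right_mono) auto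
    finally show "(int d - 1) * a \<le> int d * \<bar>a\<bar>" .
    show "\<bar>a\<bar> \<le> int d * \<bar>a\<bar>" using d_ge_2 mult_right_mono[of 1 "int d" "\<bar>a\<bar>"] by simp
  qed
  from l consider "e l = 0" | "e l = d" by auto
  then show False
  proof cases
    case 1
    then show False using punctured_support(2)[OF nz] k da by simp
  next
    case 2
    have "s + int k * int d \<le> (int d - 1) * (a + int k)" using punctured_support(3)[OF nz] 2 by simp
    then have "int k \<le> (int d - 1) * a - s" by (simp add: algebra_simps)
    then show False using k da by linarith
  qed
qed

lemma laurent_solution_eq:
  assumes "e l \<in> {0, d}" "K \<ge> laurent_bound a s"
  shows "laurent_solution l a s x = (\<Sum>k\<in>{1..K}. laurent_term l a s k x)"
  unfolding laurent_solution_def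
  using assms by (intro sum.mono_neutral_left) (auto intro: laurent_term_zero)

lemma laurent_coeff_gradient:
  assumes "x $ l \<noteq> 0" "k \<ge> 1"
  shows "has_gradient (laurent_coeff l k) (\<lambda>i. if i = l then laurent_coeff l (Suc k) x else 0) x"
proof -
  have "((\<lambda>z. (- 1) ^ k * fact (k - 1) * inverse z ^ k) has_field_derivative
      laurent_coeff l (Suc k) x) (at (x $ l))"
  proof -
    have "fact k = of_nat k * (fact (k - 1) :: complex)" using assms(2) by (intro fact_reduce) simp
    then show ?thesis
      using assms by (auto intro!: derivative_eq_intros simp: laurent_coeff_def power_Suc[symmetric] field_simps simp del: power_Suc)
       (cases k; simp add: field_simps)
  qed
  from has_gradient_chain[OF has_gradient_coord this]
  have "has_gradient (laurent_coeff l k) (\<lambda>i. laurent_coeff l (Suc k) x * (if i = l then 1 else 0)) x"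
    unfolding laurent_coeff_def .
  then show ?thesis by (simp add: if_distrib cong: if_cong)
qed

lemma laurent_coeff_euler:
  assumes "x $ l \<noteq> 0" "k \<ge> 1"
  shows "x $ l * laurent_coeff l (Suc k) x = - of_nat k * laurent_coeff l k x"
proof -
  have "fact k = of_nat k * (fact (k - 1) :: complex)" using assms(2) by (intro fact_reduce) simp
  then show ?thesis using assms by (simp add: laurent_coeff_def)
qed

text \<open>
Derivatives in the directions \<open>i \<noteq> l\<close> act on the divided powers and those in direction \<open>l\<close> on the
powers of \<open>x\<^sub>l\<close>, where \<open>k\<close> becomes \<open>k + 1\<close>. The sum on the right then lacks its first term, which is a
coefficient of \<open>f\<^sup>a\<close> at an index outside the semigroup and hence zero.
\<close>

lemma laurent_contiguous:
  assumes l: "e l \<in> {0, d}" and U: "\<And>x. x \<in> U \<Longrightarrow> x $ l \<noteq> 0"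
  shows "contiguous_family e U (laurent_solution l)"
  unfolding contiguous_family_def
proof (intro allI impI ballI)
  fix a s x assume I: "(a, s) \<notin> I_set (range e)" and x: "x \<in> U"
  let ?D = "divided_power e (- {l})"
  \<comment> \<open>one range of summation that serves all indices involved\<close>
  define K where "K = Suc (laurent_bound a s + (\<Sum>i\<in>UNIV. laurent_bound (a - 1) (s - int (e i))))"
  have K: "laurent_bound a s < K" "laurent_bound (a - 1) (s - int (e i)) < K" for i
    unfolding K_def using member_le_sum[of i UNIV "\<lambda>i. laurent_bound (a - 1) (s - int (e i))"] by auto
  have xl: "x $ l \<noteq> 0" using U x by auto
  have D0: "?D a s x = 0"
  proof (rule ccontr)
    assume "?D a s x \<noteq> 0"
    then have "(a, s) \<in> nat_span (e ` (- {l}))" by (rule divided_power_support[OF inj_e])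
    then obtain w where w: "a = int (\<Sum>i\<in>-{l}. w i)" "s = int (\<Sum>i\<in>-{l}. w i * e i)"
      using nat_span_image[OF inj_e] by metis
    have "(\<Sum>i\<in>-{l}. w i) = (\<Sum>i\<in>UNIV. (w(l := 0)) i)"
         "(\<Sum>i\<in>-{l}. w i * e i) = (\<Sum>i\<in>UNIV. (w(l := 0)) i * e i)"
      by (intro sum.mono_neutral_cong_left; auto)+
    then have "(a, s) \<in> nat_span (range e)" unfolding w nat_span_image[OF inj_e] by metis
    then show False using I by (simp add: I_set_def)
  qed
  \<comment> \<open>the derivative in direction \<open>i\<close> of the term with index \<open>k\<close>\<close>
  let ?T = "\<lambda>k i. if i = l
      then laurent_coeff l (Suc k) x * ?D (a + int k) (s + int k * int (e l)) x
      else laurent_coeff l k x * ?D (a + int k - 1) (s + int k * int (e l) - int (e i)) x"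
  have T: "has_gradient (laurent_term l a s k) (?T k) x" if "k \<ge> 1" for k
  proof -
    have "has_gradient (laurent_term l a s k) (\<lambda>i. (if i = l then laurent_coeff l (Suc k) x else 0) *
        ?D (a + int k) (s + int k * int (e l)) x + laurent_coeff l k x *
        (if i \<in> - {l} then ?D (a + int k - 1) (s + int k * int (e l) - int (e i)) x else 0)) x"
      unfolding laurent_term_def
      by (intro has_gradient_mult laurent_coeff_gradient divided_power_gradient xl that)
    then show ?thesis by (rule has_gradient_cong[of _ _ _ UNIV]) auto
  qed
  have G: "has_gradient (laurent_solution l a s) (\<lambda>i. \<Sum>k\<in>{1..K}. ?T k i) x"
    by (rule has_gradient_cong[OF has_gradient_sum[OF T], where U = UNIV])
      (use laurent_solution_eq[OF l, of a s K] K in auto)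
  have eq: "(\<Sum>k\<in>{1..K}. ?T k i) = laurent_solution l (a - 1) (s - int (e i)) x" for i
  proof (cases "i = l")
    case True
    have "(\<Sum>k\<in>{1..K}. ?T k i) = (\<Sum>k\<in>{1..K}. laurent_term l (a - 1) (s - int (e l)) (Suc k) x)"
      using True by (intro sum.cong) (auto simp: laurent_term_def algebra_simps)
    also have "\<dots> = (\<Sum>k\<in>{Suc 1..Suc K}. laurent_term l (a - 1) (s - int (e l)) k x)"
      by (rule sum.shift_bounds_cl_Suc_ivl[symmetric])
    also have "\<dots> = (\<Sum>k\<in>{1..Suc K}. laurent_term l (a - 1) (s - int (e l)) k x)"
    proof (rule sum.mono_neutral_left)
      show "\<forall>k\<in>{1..Suc K} - {Suc 1..Suc K}. laurent_term l (a - 1) (s - int (e l)) k x = 0"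
      proof
        fix k assume "k \<in> {1..Suc K} - {Suc 1..Suc K}"
        then have "k = 1" by auto
        then show "laurent_term l (a - 1) (s - int (e l)) k x = 0"
          using D0 by (simp add: laurent_term_def)
      qed
    qed auto
    also have "\<dots> = laurent_solution l (a - 1) (s - int (e l)) x"
      by (rule laurent_solution_eq[OF l, symmetric]) (use K(2)[of l] in simp)
    finally show ?thesis using True by simp
  next
    case False
    have "(\<Sum>k\<in>{1..K}. ?T k i) = (\<Sum>k\<in>{1..K}. laurent_term l (a - 1) (s - int (e i)) k x)"
      using False by (intro sum.cong) (auto simp: laurent_term_def algebra_simps)
    also have "\<dots> = laurent_solution l (a - 1) (s - int (e i)) x"
      by (rule laurent_solution_eq[OF l, symmetric]) (use K(2)[of i] in simp)
    finally show ?thesis .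
  qed
  have euler: "(\<Sum>i\<in>UNIV. c i * x $ i * ?T k i) =
      (of_int (z + int k * y) - of_nat k * c l) * laurent_term l a s k x"
    if "k \<ge> 1" and D: "(\<Sum>i\<in>-{l}. c i * x $ i * ?D (a + int k - 1) (s + int k * int (e l) - int (e i)) x)
       = of_int (z + int k * y) * ?D (a + int k) (s + int k * int (e l)) x" for c k z y
  proof -
    have "(\<Sum>i\<in>UNIV. c i * x $ i * ?T k i) = c l * x $ l * ?T k l + (\<Sum>i\<in>-{l}. c i * x $ i * ?T k i)"
      by (subst sum.remove[of _ l]) (auto simp: Compl_eq_Diff_UNIV)
    also have "(\<Sum>i\<in>-{l}. c i * x $ i * ?T k i) = laurent_coeff l k x * (\<Sum>i\<in>-{l}. c i * x $ i *
        ?D (a + int k - 1) (s + int k * int (e l) - int (e i)) x)"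
      by (simp add: sum_distrib_left mult_ac)
    also have "\<dots> = of_int (z + int k * y) * laurent_term l a s k x"
      unfolding D by (simp add: laurent_term_def)
    also have "c l * x $ l * ?T k l = c l * (x $ l * laurent_coeff l (Suc k) x) * ?D (a + int k) (s + int k * int (e l)) x"
      by (simp add: mult_ac)
    also have "\<dots> = - of_nat k * c l * laurent_term l a s k x"
      unfolding laurent_coeff_euler[OF xl \<open>k \<ge> 1\<close>] by (simp add: laurent_term_def)
    finally show ?thesis by (simp add: algebra_simps)
  qed
  have sol: "laurent_solution l a s x = (\<Sum>k\<in>{1..K}. laurent_term l a s k x)"
    by (rule laurent_solution_eq[OF l]) (use K in simp)
  have swap: "(\<Sum>i\<in>UNIV. c i * (\<Sum>k\<in>{1..K}. ?T k i)) = (\<Sum>k\<in>{1..K}. \<Sum>i\<in>UNIV. c i * ?T k i)" for c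
    unfolding sum_distrib_left by (rule sum.swap)
  have "(\<Sum>i\<in>UNIV. x $ i * (\<Sum>k\<in>{1..K}. ?T k i)) = of_int a * laurent_solution l a s x"
    unfolding swap sol unfolding sum_distrib_left[of "of_int _"]
  proof (intro sum.cong refl)
    fix k assume "k \<in> {1..K}"
    then show "(\<Sum>i\<in>UNIV. x $ i * ?T k i) = of_int a * laurent_term l a s k x"
      using euler[of k "\<lambda>_. 1" a 1] divided_power_euler1[of x e "-{l}" "a + int k" "s + int k * int (e l)"]
      by simp
  qed
  moreover have "(\<Sum>i\<in>UNIV. of_nat (e i) * x $ i * (\<Sum>k\<in>{1..K}. ?T k i)) = of_int s * laurent_solution l a s x"
    unfolding swap sol unfolding sum_distrib_left[of "of_int _"]
  proof (intro sum.cong refl)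
    fix k assume "k \<in> {1..K}"
    then show "(\<Sum>i\<in>UNIV. of_nat (e i) * x $ i * ?T k i) = of_int s * laurent_term l a s k x"
      using euler[of k "\<lambda>i. of_nat (e i)" s "int (e l)"]
        divided_power_euler2[of e x "-{l}" "a + int k" "s + int k * int (e l)"]
      by simp
  qed
  ultimately show "has_gradient (laurent_solution l a s) (\<lambda>i. laurent_solution l (a - 1) (s - int (e i)) x) x \<and>
      (\<Sum>i\<in>UNIV. x $ i * laurent_solution l (a - 1) (s - int (e i)) x) = of_int a * laurent_solution l a s x \<and>
      (\<Sum>i\<in>UNIV. of_nat (e i) * x $ i * laurent_solution l (a - 1) (s - int (e i)) x) =
        of_int s * laurent_solution l a s x"
    using G unfolding eq by blast
qed

text \<open>
In the open strip between the two extreme rays of the negative cone both Laurent families vanish, so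
that only the root solutions contribute to a linear relation there.
\<close>

lemma laurent_solution_interior:
  assumes l: "e l \<in> {0, d}" and "int d * a < s" "s < 0"
  shows "laurent_solution l a s x = 0"
  unfolding laurent_solution_def
proof (rule sum.neutral, rule ballI, rule ccontr)
  fix k assume "laurent_term l a s k x \<noteq> 0"
  then have nz: "divided_power e (- {l}) (a + int k) (s + int k * int (e l)) x \<noteq> 0"
    by (simp add: laurent_term_def)
  from l consider "e l = 0" | "e l = d" by auto
  then show False
  proof cases
    case 1
    then show False using punctured_support(1,2)[OF nz] assms by simp
  next
    case 2
    have "s + int k * int d \<le> (int d - 1) * (a + int k)" using punctured_support(3)[OF nz] 2 by simp
    then have "s + (a + int k) \<le> int d * a" by (simp add: algebra_simps)
    then show False using punctured_support(1)[OF nz] assms by linarith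
  qed
qed

text \<open>
On each edge of the strip exactly one Laurent family survives, with a single term. Taking derivatives that
lead to a point of an edge therefore detects its coefficient in a linear relation, on any open set.
\<close>

lemma laurent_solution_corner:
  assumes l: "e l \<in> {0, d}" and l': "e l' \<in> {0, d}" and k: "k \<ge> 1"
  shows "laurent_solution l' (- int k) (- int k * int (e l)) x = (if l' = l then laurent_coeff l k x else 0)"
proof -
  have trm: "laurent_term l' (- int k) (- int k * int (e l)) k' x =
      (if l' = l \<and> k' = k then laurent_coeff l k x else 0)" for k'
  proof (cases "laurent_term l' (- int k) (- int k * int (e l)) k' x = 0")
    case True
    moreover have "laurent_term l (- int k) (- int k * int (e l)) k x = laurent_coeff l k x"
      by (simp add: laurent_term_def divided_power_0)
    ultimately show ?thesis by auto
  next
    case False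
    then have nz: "divided_power e (- {l'}) (- int k + int k') (- int k * int (e l) + int k' * int (e l')) x \<noteq> 0"
      by (simp add: laurent_term_def)
    note p = punctured_support[OF nz]
    have "l' = l"
    proof (rule ccontr)
      assume "l' \<noteq> l"
      then have "e l' \<noteq> e l" using inj_e by (meson injD)
      with l l' consider "e l' = 0" "e l = d" | "e l' = d" "e l = 0" by auto
      then show False
      proof cases
        case 1
        have "0 \<le> - int k * int d" using p(1,2) 1 by simp
        then show False using k d_ge_2 by (simp add: mult_le_0_iff)
      next
        case 2
        then have "int k' * int d \<le> (int d - 1) * (- int k + int k')" using p(3) by simp
        then have "int d * int k + int k' \<le> int k" by (simp add: algebra_simps)
        moreover have "int d * int k \<ge> 2 * int k" using d_ge_2 by (intro mult_right_mono) auto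
        ultimately show False using k by linarith
      qed
    qed
    moreover have "k' = k"
    proof -
      from l consider "e l = 0" | "e l = d" by auto
      then show ?thesis
      proof cases
        case 1
        then show ?thesis using p(1,2) \<open>l' = l\<close> by simp
      next
        case 2
        then have "int d * (int k' - int k) \<le> (int d - 1) * (int k' - int k)"
          using p(3) \<open>l' = l\<close> by (simp add: algebra_simps)
        then have "int k' \<le> int k" by (simp add: algebra_simps)
        then show ?thesis using p(1) by simp
      qed
    qed
    ultimately show ?thesis by (simp add: laurent_term_def divided_power_0)
  qed
  have "k \<le> laurent_bound (- int k) (- int k * int (e l))"
  proof -
    have "int k \<le> int d * \<bar>- int k\<bar>" using d_ge_2 mult_right_mono[of 1 "int d" "int k"] by simp
    also have "\<dots> \<le> \<bar>- int k * int (e l)\<bar> + int d * \<bar>- int k\<bar>" by simp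
    finally show ?thesis unfolding laurent_bound_def by linarith
  qed
  then show ?thesis
    unfolding laurent_solution_def trm using k by (auto intro: sum.neutral)
qed

end

section \<open>The gradient of a root\<close>

text \<open>
Caratheodory's criterion: a difference that factors through the increments with coefficients that are
continuous at the point is differentiable there. It replaces the implicit function theorem for the
roots, whose divided differences are explicit.
\<close>

lemma has_gradient_caratheodory:
  fixes x :: "complex ^ 'n::finite"
  assumes ev: "\<forall>\<^sub>F y in nhds x. \<phi> y - \<phi> x = (\<Sum>i\<in>UNIV. h i y * (y $ i - x $ i))"
    and cont: "\<And>i. isCont (h i) x"
  shows "has_gradient \<phi> (\<lambda>i. h i x) x"
proof -
  let ?D = "\<lambda>v. \<Sum>i\<in>UNIV. h i x * v $ i"
  have lin: "bounded_linear ?D"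
    by (intro bounded_linear_sum bounded_linear_const_mult bounded_linear_vec_nth)
  have lim: "((\<lambda>y. \<Sum>i\<in>UNIV. norm (h i y - h i x)) \<longlongrightarrow> 0) (at x)"
  proof -
    have "((\<lambda>y. \<Sum>i\<in>UNIV. norm (h i y - h i x)) \<longlongrightarrow> (\<Sum>i\<in>(UNIV::'n set). 0)) (at x)"
      using cont unfolding isCont_def by (intro tendsto_sum tendsto_norm_zero) (simp add: LIM_zero)
    then show ?thesis by simp
  qed
  have "\<forall>\<^sub>F y in at x. norm (norm (\<phi> y - \<phi> x - ?D (y - x)) / norm (y - x)) \<le>
      (\<Sum>i\<in>UNIV. norm (h i y - h i x))"
    using eventually_nhds_conv_at[of _ x, THEN iffD1, OF ev, THEN conjunct1]
  proof eventually_elim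
    case (elim y)
    have "\<phi> y - \<phi> x - ?D (y - x) = (\<Sum>i\<in>UNIV. (h i y - h i x) * (y - x) $ i)"
      unfolding elim by (simp add: sum_subtractf left_diff_distrib)
    also have "norm \<dots> \<le> (\<Sum>i\<in>UNIV. norm (h i y - h i x) * norm (y - x))"
    proof (rule order_trans[OF norm_sum sum_mono])
      fix i :: 'n
      show "norm ((h i y - h i x) * (y - x) $ i) \<le> norm (h i y - h i x) * norm (y - x)"
        unfolding norm_mult
        by (rule mult_left_mono[OF Finite_Cartesian_Product.norm_nth_le norm_ge_zero])
    qed
    finally have "norm (\<phi> y - \<phi> x - ?D (y - x)) \<le> (\<Sum>i\<in>UNIV. norm (h i y - h i x)) * norm (y - x)"
      by (simp add: sum_distrib_right)
    then show ?case
      by (cases "y = x") (auto simp: divide_simps sum_nonneg)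
  qed
  then have "((\<lambda>y. norm (\<phi> y - \<phi> x - ?D (y - x)) / norm (y - x)) \<longlongrightarrow> 0) (at x)"
    by (rule Lim_null_comparison[OF _ lim])
  then show ?thesis
    unfolding has_gradient_def has_derivative_iff_norm using lin by simp
qed

definition generic_eval :: "('n::finite \<Rightarrow> nat) \<Rightarrow> complex ^ 'n \<Rightarrow> complex \<Rightarrow> complex" where
  "generic_eval e x t = (\<Sum>i\<in>UNIV. x $ i * t ^ e i)"

definition generic_deriv :: "('n::finite \<Rightarrow> nat) \<Rightarrow> complex ^ 'n \<Rightarrow> complex \<Rightarrow> complex" where
  "generic_deriv e x t = (\<Sum>i\<in>UNIV. of_nat (e i) * x $ i * t ^ (e i - 1))"

text \<open>
A continuous choice of a simple nonzero root of \<open>f(x;t)\<close> over an open set.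
\<close>

locale root_section = monomial_curve e d for e :: "'n::finite \<Rightarrow> nat" and d +
  fixes U :: "(complex ^ 'n) set" and \<rho> :: "complex ^ 'n \<Rightarrow> complex" and i0 :: 'n
  assumes open_U: "open U" and e_i0: "e i0 = 0"
    and root_cont: "continuous_on U \<rho>"
    and root_eq: "\<And>x. x \<in> U \<Longrightarrow> generic_eval e x (\<rho> x) = 0"
    and root_simple: "\<And>x. x \<in> U \<Longrightarrow> generic_deriv e x (\<rho> x) \<noteq> 0"
    and root_nonzero: "\<And>x. x \<in> U \<Longrightarrow> \<rho> x \<noteq> 0"
begin

text \<open>
The derivative of the root with respect to the constant term \<open>x\<^sub>0\<close>; the derivative in direction \<open>i\<close> is
\<open>\<rho>\<^bsup>e i\<^esup>\<close> times this one.
\<close>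

definition slope :: "complex ^ 'n \<Rightarrow> complex" where
  "slope x = - inverse (generic_deriv e x (\<rho> x))"

text \<open>
Subtracting \<open>f(x;\<rho> x) = 0\<close> from \<open>f(y;\<rho> y) = 0\<close> and factoring \<open>\<rho> y - \<rho> x\<close> out of the differences of powers
leaves a cofactor \<open>Q y\<close> that is continuous in \<open>y\<close> and tends to \<open>f'(x;\<rho> x) \<noteq> 0\<close>.
\<close>

lemma root_gradient:
  assumes "x \<in> U"
  shows "has_gradient \<rho> (\<lambda>i. \<rho> x ^ e i * slope x) x"
proof -
  define Q where "Q = (\<lambda>y. \<Sum>i\<in>UNIV. x $ i * (\<Sum>j<e i. \<rho> x ^ (e i - Suc j) * \<rho> y ^ j))"
  have cont: "isCont \<rho> x"
    using root_cont open_U assms by (simp add: continuous_on_eq_continuous_at)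
  have Qx: "Q x = generic_deriv e x (\<rho> x)"
  proof -
    have "(\<Sum>j<e i. \<rho> x ^ (e i - Suc j) * \<rho> x ^ j) = of_nat (e i) * \<rho> x ^ (e i - 1)" for i
    proof -
      have "(\<Sum>j<e i. \<rho> x ^ (e i - Suc j) * \<rho> x ^ j) = (\<Sum>j<e i. \<rho> x ^ (e i - 1))"
        by (intro sum.cong) (auto simp: power_add[symmetric])
      then show ?thesis by simp
    qed
    then show ?thesis unfolding Q_def generic_deriv_def by (simp add: mult_ac)
  qed
  have contQ: "isCont Q x"
    unfolding Q_def by (intro continuous_intros cont)
  have "\<forall>\<^sub>F y in nhds x. Q y \<noteq> 0"
  proof -
    have "Q x \<noteq> 0" using Qx root_simple assms by simp
    moreover have "(Q \<longlongrightarrow> Q x) (nhds x)" using contQ by (simp add: isCont_def tendsto_at_iff_tendsto_nhds)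
    ultimately show ?thesis using tendsto_imp_eventually_ne by blast
  qed
  moreover have "\<forall>\<^sub>F y in nhds x. y \<in> U" using open_U assms by (rule eventually_nhds_in_open)
  ultimately have "\<forall>\<^sub>F y in nhds x. \<rho> y - \<rho> x = (\<Sum>i\<in>UNIV. (- (\<rho> y ^ e i) / Q y) * (y $ i - x $ i))"
  proof eventually_elim
    case (elim y)
    have pd: "\<rho> y ^ k - \<rho> x ^ k = (\<rho> y - \<rho> x) * (\<Sum>j<k. \<rho> x ^ (k - Suc j) * \<rho> y ^ j)" for k
      by (rule power_diff_sumr2)
    have "0 = generic_eval e y (\<rho> y) - generic_eval e x (\<rho> x)" using elim root_eq assms by simp
    also have "\<dots> = (\<Sum>i\<in>UNIV. (y $ i - x $ i) * \<rho> y ^ e i + x $ i * (\<rho> y ^ e i - \<rho> x ^ e i))"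
      unfolding generic_eval_def sum_subtractf[symmetric] by (simp add: algebra_simps)
    also have "\<dots> = (\<Sum>i\<in>UNIV. (y $ i - x $ i) * \<rho> y ^ e i) + (\<rho> y - \<rho> x) * Q y"
      unfolding pd Q_def by (simp add: sum.distrib sum_distrib_left mult_ac)
    finally have "(\<rho> y - \<rho> x) * Q y = - (\<Sum>i\<in>UNIV. (y $ i - x $ i) * \<rho> y ^ e i)"
      by (simp add: eq_neg_iff_add_eq_0 add.commute)
    then have "\<rho> y - \<rho> x = - (\<Sum>i\<in>UNIV. (y $ i - x $ i) * \<rho> y ^ e i) / Q y"
      using elim by (simp add: field_simps)
    then show ?case by (simp add: sum_divide_distrib sum_negf mult_ac)
  qed
  then have "has_gradient \<rho> (\<lambda>i. - (\<rho> x ^ e i) / Q x) x"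
  proof (rule has_gradient_caratheodory)
    show "isCont (\<lambda>y. - (\<rho> y ^ e i) / Q y) x" for i
      using Qx root_simple assms by (intro continuous_intros cont contQ) simp
  qed
  then show ?thesis by (simp add: Qx slope_def divide_inverse)
qed

section \<open>Commuting derivatives of functions of a root\<close>

text \<open>
The field operations applied to coordinates and the root produce a class of functions that is closed
under partial derivatives. It supplies derivatives of all orders, and induction on its construction shows that
they commute.
\<close>

inductive smooth :: "(complex ^ 'n \<Rightarrow> complex) \<Rightarrow> bool" where
  const: "smooth (\<lambda>x. c)"
| coord: "smooth (\<lambda>x. x $ i)"
| root: "smooth \<rho>"
| add: "smooth g \<Longrightarrow> smooth h \<Longrightarrow> smooth (\<lambda>x. g x + h x)"
| mult: "smooth g \<Longrightarrow> smooth h \<Longrightarrow> smooth (\<lambda>x. g x * h x)"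
| inverse: "smooth g \<Longrightarrow> (\<And>x. x \<in> U \<Longrightarrow> g x \<noteq> 0) \<Longrightarrow> smooth (\<lambda>x. inverse (g x))"
| agree: "smooth g \<Longrightarrow> (\<And>x. x \<in> U \<Longrightarrow> h x = g x) \<Longrightarrow> smooth h"

lemma smooth_power: "smooth g \<Longrightarrow> smooth (\<lambda>x. g x ^ n)"
  by (induction n) (auto intro: smooth.intros)

lemma smooth_sum: "(\<And>k. k \<in> A \<Longrightarrow> smooth (g k)) \<Longrightarrow> smooth (\<lambda>x. \<Sum>k\<in>A. g k x)"
  by (induction A rule: infinite_finite_induct) (auto intro: smooth.intros)

lemma smooth_power_int: "smooth (\<lambda>x. \<rho> x powi p)"
  unfolding power_int_def
  by (cases "p \<ge> 0") (simp_all add: smooth.root smooth.inverse smooth_power root_nonzero)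

lemma smooth_generic_deriv: "smooth (\<lambda>x. generic_deriv e x (\<rho> x))"
  unfolding generic_deriv_def by (intro smooth_sum smooth_power smooth.intros)

lemma smooth_slope: "smooth slope"
proof -
  have "smooth (\<lambda>x. - 1 * inverse (generic_deriv e x (\<rho> x)))"
    by (intro smooth.mult smooth.const smooth.inverse smooth_generic_deriv root_simple)
  then show ?thesis by (rule smooth.agree) (simp add: slope_def)
qed

lemma smooth_gradient_ex:
  assumes "smooth g"
  shows "\<exists>g'. (\<forall>i. smooth (g' i)) \<and> (\<forall>x\<in>U. has_gradient g (\<lambda>i. g' i x) x)"
  using assms
proof induction
  case (const c)
  then show ?case by (intro exI[of _ "\<lambda>i x. 0"]) (auto intro: smooth.const has_gradient_const)
next
  case (coord j)
  show ?case
    by (intro exI[of _ "\<lambda>i x. if i = j then 1 else 0"]) (auto intro: smooth.const has_gradient_coord)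
next
  case root
  have "smooth (\<lambda>x. \<rho> x ^ e i * slope x)" for i
    by (intro smooth.mult smooth_power smooth.root smooth_slope)
  then show ?case
    by (intro exI[of _ "\<lambda>i x. \<rho> x ^ e i * slope x"]) (auto intro: root_gradient)
next
  case (add g h)
  then obtain g' h' where "\<forall>i. smooth (g' i)" "\<forall>x\<in>U. has_gradient g (\<lambda>i. g' i x) x"
    "\<forall>i. smooth (h' i)" "\<forall>x\<in>U. has_gradient h (\<lambda>i. h' i x) x" by auto
  then show ?case
    by (intro exI[of _ "\<lambda>i x. g' i x + h' i x"]) (auto intro: smooth.add has_gradient_add)
next
  case (mult g h)
  then obtain g' h' where gh: "\<forall>i. smooth (g' i)" "\<forall>x\<in>U. has_gradient g (\<lambda>i. g' i x) x"
    "\<forall>i. smooth (h' i)" "\<forall>x\<in>U. has_gradient h (\<lambda>i. h' i x) x" by auto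
  have "smooth (\<lambda>x. g' i x * h x + g x * h' i x)" for i
    by (intro smooth.add smooth.mult mult.hyps gh(1,3)[rule_format])
  then show ?case
    using gh by (intro exI[of _ "\<lambda>i x. g' i x * h x + g x * h' i x"]) (auto intro: has_gradient_mult)
next
  case (inverse g)
  then obtain g' where g': "\<forall>i. smooth (g' i)" "\<forall>x\<in>U. has_gradient g (\<lambda>i. g' i x) x" by auto
  have "has_gradient (\<lambda>x. inverse (g x)) (\<lambda>i. - (inverse (g x) * inverse (g x)) * g' i x) x"
    if "x \<in> U" for x
    using g' that inverse(2)
    by (intro has_gradient_chain) (auto intro!: derivative_eq_intros simp: power2_eq_square)
  moreover have "smooth (\<lambda>x. - (inverse (g x) * inverse (g x)) * g' i x)" for i
  proof -
    have "smooth (\<lambda>x. (- 1 * (inverse (g x) * inverse (g x))) * g' i x)"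
      using inverse g' by (intro smooth.mult smooth.const smooth.inverse) auto
    then show ?thesis by (rule smooth.agree) simp
  qed
  ultimately show ?case
    by (intro exI[of _ "\<lambda>i x. - (inverse (g x) * inverse (g x)) * g' i x"]) auto
next
  case (agree g h)
  then obtain g' where g': "\<forall>i. smooth (g' i)" "\<forall>x\<in>U. has_gradient g (\<lambda>i. g' i x) x" by auto
  then show ?case
    using agree(2) open_U by (intro exI[of _ g']) (auto intro: has_gradient_cong)
qed

lemma smooth_has_gradient:
  assumes "smooth g" "x \<in> U"
  shows "has_gradient g (\<lambda>i. partial i g x) x"
proof -
  obtain g' where "\<forall>x\<in>U. has_gradient g (\<lambda>i. g' i x) x" using smooth_gradient_ex[OF assms(1)] by auto
  then have "has_gradient g (\<lambda>i. g' i x) x" using assms by auto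
  moreover from this have "(\<lambda>i. partial i g x) = (\<lambda>i. g' i x)"
    by (auto intro: has_gradient_partial)
  ultimately show ?thesis by simp
qed

lemma smooth_partial:
  assumes "smooth g"
  shows "smooth (partial i g)"
proof -
  obtain g' where g': "\<forall>i. smooth (g' i)" "\<forall>x\<in>U. has_gradient g (\<lambda>i. g' i x) x"
    using smooth_gradient_ex[OF assms(1)] by auto
  show ?thesis
    by (rule smooth.agree[of "g' i"]) (use g' in \<open>auto intro: has_gradient_partial\<close>)
qed

lemma partial_add:
  "smooth g \<Longrightarrow> smooth h \<Longrightarrow> x \<in> U \<Longrightarrow>
    partial i (\<lambda>x. g x + h x) x = partial i g x + partial i h x"
  by (rule has_gradient_partial) (intro has_gradient_add smooth_has_gradient)

lemma partial_mult:
  "smooth g \<Longrightarrow> smooth h \<Longrightarrow> x \<in> U \<Longrightarrow>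
    partial i (\<lambda>x. g x * h x) x = partial i g x * h x + g x * partial i h x"
  by (rule has_gradient_partial) (intro has_gradient_mult smooth_has_gradient)

lemma partial_inverse:
  assumes "smooth g" "x \<in> U" "g x \<noteq> 0"
  shows "partial i (\<lambda>x. inverse (g x)) x = - (inverse (g x) * inverse (g x)) * partial i g x"
  using assms
  by (intro has_gradient_partial has_gradient_chain smooth_has_gradient)
    (auto intro!: derivative_eq_intros simp: power2_eq_square)

lemma partial_root: "x \<in> U \<Longrightarrow> partial i \<rho> x = \<rho> x ^ e i * slope x"
  by (rule has_gradient_partial) (rule root_gradient)

text \<open>
The value \<open>f''(x;\<rho> x)\<close>.
\<close>

definition second_deriv_at_root :: "complex ^ 'n \<Rightarrow> complex" where
  "second_deriv_at_root x = (\<Sum>k\<in>UNIV. of_nat (e k) * x $ k * (of_nat (e k - 1) * \<rho> x ^ (e k - 1 - 1)))"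

lemma power_gradient:
  assumes "has_gradient \<phi> g x"
  shows "has_gradient (\<lambda>x. \<phi> x ^ n) (\<lambda>i. of_nat n * \<phi> x ^ (n - 1) * g i) x"
  by (rule has_gradient_chain[OF assms]) (auto intro!: derivative_eq_intros)

lemma slope_gradient:
  assumes "x \<in> U"
  shows "has_gradient slope (\<lambda>i. (of_nat (e i) * \<rho> x ^ (e i - 1) + second_deriv_at_root x * (\<rho> x ^ e i * slope x))
    * slope x ^ 2) x"
proof -
  let ?G = "\<lambda>x. generic_deriv e x (\<rho> x)"
  let ?p = "\<lambda>i k. of_nat (e k - 1) * \<rho> x ^ (e k - 1 - 1) * (\<rho> x ^ e i * slope x)"
  have "has_gradient ?G (\<lambda>i. \<Sum>k\<in>UNIV. (of_nat (e k) * (if i = k then 1 else 0)) * \<rho> x ^ (e k - 1)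
       + of_nat (e k) * x $ k * ?p i k) x"
    unfolding generic_deriv_def
    by (intro has_gradient_sum has_gradient_mult has_gradient_cmult has_gradient_coord
        power_gradient root_gradient assms)
  moreover have "(\<Sum>k\<in>UNIV. (of_nat (e k) * (if i = k then 1 else 0)) * \<rho> x ^ (e k - 1)
       + of_nat (e k) * x $ k * ?p i k) = of_nat (e i) * \<rho> x ^ (e i - 1) + second_deriv_at_root x * (\<rho> x ^ e i * slope x)" for i
  proof -
    have "(\<Sum>k\<in>UNIV. (of_nat (e k) * (if i = k then 1 else 0)) * \<rho> x ^ (e k - 1)) =
        (\<Sum>k\<in>UNIV. if i = k then of_nat (e k) * \<rho> x ^ (e k - 1) else 0)"
      by (intro sum.cong) auto
    then have "(\<Sum>k\<in>UNIV. (of_nat (e k) * (if i = k then 1 else 0)) * \<rho> x ^ (e k - 1)) =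
        of_nat (e i) * \<rho> x ^ (e i - 1)" by simp
    moreover have "(\<Sum>k\<in>UNIV. of_nat (e k) * x $ k * ?p i k) = second_deriv_at_root x * (\<rho> x ^ e i * slope x)"
      unfolding second_deriv_at_root_def sum_distrib_right by (intro sum.cong refl) (simp only: mult_ac)
    ultimately show ?thesis by (simp only: sum.distrib)
  qed
  ultimately have G: "has_gradient ?G
      (\<lambda>i. of_nat (e i) * \<rho> x ^ (e i - 1) + second_deriv_at_root x * (\<rho> x ^ e i * slope x)) x"
    by simp
  have "has_gradient (\<lambda>x. - inverse (?G x)) (\<lambda>i. slope x ^ 2 *
      (of_nat (e i) * \<rho> x ^ (e i - 1) + second_deriv_at_root x * (\<rho> x ^ e i * slope x))) x"
    by (rule has_gradient_chain[OF G])
      (use root_simple[OF assms] in \<open>auto intro!: derivative_eq_intros simp: slope_def power2_eq_square\<close>)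
  then show ?thesis unfolding slope_def[abs_def, symmetric] by (simp add: mult.commute)
qed

text \<open>
By induction on the construction of the function; the generator \<open>\<rho>\<close> is the only case with content.
There the derivative of \<open>\<rho>\<^bsup>e j\<^esup> slope\<close> in direction \<open>i\<close> is symmetric in \<open>i\<close> and \<open>j\<close> by inspection.
\<close>

lemma smooth_commute:
  assumes "smooth g" "x \<in> U"
  shows "partial i (partial j g) x = partial j (partial i g) x"
  using assms
proof (induction arbitrary: x)
  case (const c)
  then show ?case
    by (simp add: has_gradient_partial[OF has_gradient_const] fun_eq_iff
        has_gradient_partial[OF has_gradient_const, abs_def])
next
  case (coord k)
  have "partial j (\<lambda>x. x $ k) = (\<lambda>_::complex^'n. if j = k then 1 else 0)" for j
    by (rule ext) (rule has_gradient_partial[OF has_gradient_coord])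
  then show ?case by (simp add: has_gradient_partial[OF has_gradient_const])
next
  case root
  have "partial i (partial j \<rho>) x = of_nat (e j) * \<rho> x ^ (e j - 1) * (\<rho> x ^ e i * slope x) * slope x
      + \<rho> x ^ e j * ((of_nat (e i) * \<rho> x ^ (e i - 1) + second_deriv_at_root x * (\<rho> x ^ e i * slope x)) * slope x ^ 2)"
    for i j
  proof -
    have "partial i (partial j \<rho>) x = partial i (\<lambda>x. \<rho> x ^ e j * slope x) x"
      by (rule partial_cong[OF open_U root(1)]) (rule partial_root)
    also have "\<dots> = of_nat (e j) * \<rho> x ^ (e j - 1) * (\<rho> x ^ e i * slope x) * slope x
      + \<rho> x ^ e j * ((of_nat (e i) * \<rho> x ^ (e i - 1) + second_deriv_at_root x * (\<rho> x ^ e i * slope x)) * slope x ^ 2)"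
      by (rule has_gradient_partial)
       (intro has_gradient_mult power_gradient root_gradient slope_gradient root(1))
    finally show ?thesis .
  qed
  then show ?case by (simp add: algebra_simps power2_eq_square)
next
  case (add g h)
  have "partial i (partial j (\<lambda>x. g x + h x)) x = partial i (partial j g) x + partial i (partial j h) x" for i j
  proof -
    have "partial i (partial j (\<lambda>x. g x + h x)) x = partial i (\<lambda>x. partial j g x + partial j h x) x"
      by (rule partial_cong[OF open_U add.prems]) (rule partial_add[OF add.hyps])
    also have "\<dots> = partial i (partial j g) x + partial i (partial j h) x"
      by (rule partial_add[OF smooth_partial smooth_partial]) (use add in auto)
    finally show ?thesis .
  qed
  then show ?case using add by simp
next
  case (mult g h)
  have "partial i (partial j (\<lambda>x. g x * h x)) x =
     (partial i (partial j g) x * h x + partial j g x * partial i h x) +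
     (partial i g x * partial j h x + g x * partial i (partial j h) x)" for i j
  proof -
    have "partial i (partial j (\<lambda>x. g x * h x)) x = partial i (\<lambda>x. partial j g x * h x + g x * partial j h x) x"
      by (rule partial_cong[OF open_U mult.prems]) (rule partial_mult[OF mult.hyps])
    also have "\<dots> = (partial i (partial j g) x * h x + partial j g x * partial i h x) +
       (partial i g x * partial j h x + g x * partial i (partial j h) x)"
      by (rule has_gradient_partial)
        (intro has_gradient_add has_gradient_mult smooth_has_gradient smooth_partial mult.hyps mult.prems)
    finally show ?thesis .
  qed
  then show ?case using mult by simp
next
  case (inverse g)
  let ?r = "\<lambda>x. inverse (g x)"
  have r: "smooth ?r" using inverse by (intro smooth.inverse) auto
  have p: "partial i ?r x = - (?r x * ?r x) * partial i g x" if "x \<in> U" for i x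
    using partial_inverse[OF inverse.hyps(1) that] inverse.hyps(2) that by auto
  have "partial i (partial j ?r) x = - 1 * ((partial i ?r x * ?r x + ?r x * partial i ?r x) * partial j g x +
       ?r x * ?r x * partial i (partial j g) x)" for i j
  proof -
    have "partial i (partial j ?r) x = partial i (\<lambda>x. - 1 * ((?r x * ?r x) * partial j g x)) x"
      by (rule partial_cong[OF open_U inverse.prems]) (simp add: p)
    also have "\<dots> = - 1 * ((partial i ?r x * ?r x + ?r x * partial i ?r x) * partial j g x +
       ?r x * ?r x * partial i (partial j g) x)"
      by (rule has_gradient_partial)
        (intro has_gradient_cmult has_gradient_mult smooth_has_gradient smooth_partial inverse.hyps(1) r inverse.prems)
    finally show ?thesis .
  qed
  then show ?case using inverse.IH[OF inverse.prems] by (simp only: p[OF inverse.prems]) (simp only: algebra_simps)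
next
  case (agree g h)
  have "partial i (partial j h) x = partial i (partial j g) x" for i j
    by (intro partial_cong[OF open_U agree.prems] partial_cong[OF open_U] agree.hyps)
  then show ?case using agree by simp
qed

section \<open>Residues at a root\<close>

text \<open>
Up to a constant factor this is the residue at \<open>t = \<rho>\<close> of \<open>t\<^bsup>-s-1\<^esup> / f\<^bsup>k+1\<^esup>\<close>, the member of the
family at level \<open>-1 - k\<close>. Generating all levels by derivatives in the direction of the constant term
avoids residue calculus at multiple poles.
\<close>

definition residue_solution :: "nat \<Rightarrow> int \<Rightarrow> complex ^ 'n \<Rightarrow> complex" where
  "residue_solution k s = (partial i0 ^^ k) (\<lambda>x. \<rho> x powi (- s - 1) * slope x)"

lemma residue_solution_0: "residue_solution 0 s x = \<rho> x powi (- s - 1) * slope x"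
  by (simp add: residue_solution_def)

lemma residue_solution_Suc: "residue_solution (Suc k) s = partial i0 (residue_solution k s)"
  by (simp add: residue_solution_def)

lemma smooth_residue_solution: "smooth (residue_solution k s)"
proof (induction k)
  case 0
  show ?case unfolding residue_solution_def
    by (auto intro: smooth.mult smooth_power_int smooth_slope)
qed (simp add: residue_solution_Suc smooth_partial)

lemma power_int_gradient:
  assumes "x \<in> U"
  shows "has_gradient (\<lambda>x. \<rho> x powi p) (\<lambda>i. of_int p * \<rho> x powi (p - 1) * (\<rho> x ^ e i * slope x)) x"
  by (rule has_gradient_chain[OF root_gradient[OF assms]])
    (use root_nonzero[OF assms] in \<open>auto intro!: derivative_eq_intros\<close>)

text \<open>
A Lagrange inversion identity: a derivative in direction \<open>i\<close> may be traded for one in direction \<open>i0\<close> at the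
price of a factor \<open>\<rho>\<^bsup>e i\<^esup>\<close> inside. For \<open>k = 0\<close> this is a computation; commuting derivatives carry it to
all \<open>k\<close>.
\<close>

lemma partial_residue_solution:
  assumes "x \<in> U"
  shows "partial i (residue_solution k s) x = residue_solution (Suc k) (s - int (e i)) x"
  using assms
proof (induction k arbitrary: x)
  case 0
  let ?r = "\<rho> x"
  have nz: "?r \<noteq> 0" using root_nonzero 0 .
  have pw: "partial i (\<lambda>x. \<rho> x powi p * slope x) x = of_int p * ?r powi (p - 1) * (?r ^ e i * slope x) * slope x +
      ?r powi p * ((of_nat (e i) * ?r ^ (e i - 1) + second_deriv_at_root x * (?r ^ e i * slope x)) * slope x ^ 2)" for p i
    by (rule has_gradient_partial) (intro has_gradient_mult power_int_gradient slope_gradient 0)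
  have mono: "?r ^ e i = ?r powi int (e i)" "of_nat (e i) * ?r ^ (e i - 1) = of_nat (e i) * ?r powi (int (e i) - 1)"
  proof -
    show "?r ^ e i = ?r powi int (e i)" by simp
    show "of_nat (e i) * ?r ^ (e i - 1) = of_nat (e i) * ?r powi (int (e i) - 1)"
      by (cases "e i = 0") (simp_all add: power_int_def of_nat_diff nat_diff_distrib)
  qed
  \<comment> \<open>both sides are brought into a form that involves \<open>p\<close> and \<open>e i\<close> only through \<open>p + e i\<close>\<close>
  define p where "p = - s - 1"
  have "partial i (residue_solution 0 s) x = of_int p * ?r powi (p - 1) * (?r ^ e i * slope x) * slope x +
      ?r powi p * ((of_nat (e i) * ?r ^ (e i - 1) + second_deriv_at_root x * (?r ^ e i * slope x)) * slope x ^ 2)"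
    unfolding residue_solution_def p_def by (simp add: pw)
  also have "\<dots> = of_int (p + int (e i)) * ?r powi (p + int (e i) - 1) * slope x ^ 2 +
      second_deriv_at_root x * ?r powi (p + int (e i)) * slope x ^ 3"
  proof -
    have "?r powi (p - 1) * ?r powi int (e i) = ?r powi (p + int (e i) - 1)"
         "?r powi p * ?r powi (int (e i) - 1) = ?r powi (p + int (e i) - 1)"
         "?r powi p * ?r powi (int (e i)) = ?r powi (p + int (e i))"
      unfolding power_int_add[symmetric, OF disjI1[OF nz]] by (simp_all add: algebra_simps del: power_int_of_nat)
    note mult_powers = this
    have "of_int p * ?r powi (p - 1) * (?r powi int (e i) * slope x) * slope x +
      ?r powi p * ((of_nat (e i) * ?r powi (int (e i) - 1) + second_deriv_at_root x * (?r powi int (e i) * slope x)) * slope x ^ 2)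
      = (of_int p * (?r powi (p - 1) * ?r powi int (e i)) + of_nat (e i) * (?r powi p * ?r powi (int (e i) - 1)))
        * slope x ^ 2 + second_deriv_at_root x * (?r powi p * ?r powi int (e i)) * slope x ^ 3"
      by (simp only: algebra_simps power2_eq_square power3_eq_cube)
    then show ?thesis unfolding mono mult_powers by (simp add: distrib_right)
  qed
  also have "\<dots> = partial i0 (\<lambda>x. \<rho> x powi (p + int (e i)) * slope x) x"
    unfolding pw by (simp add: e_i0 power2_eq_square power3_eq_cube algebra_simps)
  also have "(\<lambda>x. \<rho> x powi (p + int (e i)) * slope x) = residue_solution 0 (s - int (e i))"
    by (simp add: residue_solution_def p_def algebra_simps)
  finally show ?case by (simp add: residue_solution_Suc)
next
  case (Suc k)
  have "partial i (residue_solution (Suc k) s) x = partial i0 (partial i (residue_solution k s)) x"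
    unfolding residue_solution_Suc by (rule smooth_commute[OF smooth_residue_solution Suc.prems])
  also have "\<dots> = partial i0 (residue_solution (Suc k) (s - int (e i))) x"
    by (rule partial_cong[OF open_U Suc.prems]) (rule Suc.IH)
  finally show ?case by (simp add: residue_solution_Suc)
qed

lemma residue_solution_gradient:
  "x \<in> U \<Longrightarrow> has_gradient (residue_solution k s) (\<lambda>i. residue_solution (Suc k) (s - int (e i)) x) x"
  using smooth_has_gradient[OF smooth_residue_solution] by (simp add: partial_residue_solution)

lemma root_power_sum: "x \<in> U \<Longrightarrow> (\<Sum>i\<in>UNIV. x $ i * \<rho> x ^ e i) = 0"
  using root_eq by (simp add: generic_eval_def)

text \<open>
These are the equations \<open>f(\<rho>) = 0\<close> and \<open>f'(\<rho>) slope = -1\<close>.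
\<close>

lemma residue_euler_start:
  assumes "x \<in> U"
  shows "(\<Sum>i\<in>UNIV. x $ i * residue_solution 0 (s - int (e i)) x) = 0"
    and "(\<Sum>i\<in>UNIV. of_nat (e i) * x $ i * residue_solution 0 (s - int (e i)) x) = - (\<rho> x powi (- s))"
proof -
  have nz: "\<rho> x \<noteq> 0" using root_nonzero assms .
  have r: "residue_solution 0 (s - int (e i)) x = \<rho> x powi (- s - 1) * \<rho> x ^ e i * slope x" for i
  proof -
    have "\<rho> x powi (- (s - int (e i)) - 1) = \<rho> x powi ((- s - 1) + int (e i))" by (simp add: algebra_simps)
    also have "\<dots> = \<rho> x powi (- s - 1) * \<rho> x powi int (e i)" by (rule power_int_add) (use nz in auto)
    finally show ?thesis by (simp add: residue_solution_0)
  qed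
  have "(\<Sum>i\<in>UNIV. x $ i * residue_solution 0 (s - int (e i)) x) =
      (\<rho> x powi (- s - 1) * slope x) * (\<Sum>i\<in>UNIV. x $ i * \<rho> x ^ e i)"
    unfolding r by (simp add: sum_distrib_left mult_ac)
  then show "(\<Sum>i\<in>UNIV. x $ i * residue_solution 0 (s - int (e i)) x) = 0"
    using root_power_sum[OF assms] by simp
  have "of_nat (e i) * \<rho> x ^ e i = of_nat (e i) * \<rho> x ^ (e i - 1) * \<rho> x" for i
    by (cases "e i") auto
  then have "(\<Sum>i\<in>UNIV. of_nat (e i) * x $ i * residue_solution 0 (s - int (e i)) x) =
      (\<rho> x powi (- s - 1) * \<rho> x) * (slope x * generic_deriv e x (\<rho> x))"
    unfolding r generic_deriv_def sum_distrib_left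
    by (intro sum.cong refl) (simp add: mult_ac, metis mult.assoc mult.commute)
  also have "slope x * generic_deriv e x (\<rho> x) = - 1" using root_simple[OF assms] by (simp add: slope_def)
  also have "\<rho> x powi (- s - 1) * \<rho> x = \<rho> x powi (- s)"
    using power_int_add_1[of "\<rho> x" "- s - 1"] nz by simp
  finally show "(\<Sum>i\<in>UNIV. of_nat (e i) * x $ i * residue_solution 0 (s - int (e i)) x) = - (\<rho> x powi (- s))"
    by simp
qed

lemma weighted_sum_gradient:
  assumes "\<And>i. has_gradient (\<phi> i) (g i) x"
  shows "has_gradient (\<lambda>x. \<Sum>i\<in>UNIV. c i * x $ i * \<phi> i x)
    (\<lambda>j. c j * \<phi> j x + (\<Sum>i\<in>(UNIV::'n set). c i * x $ i * g i j)) x"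
proof -
  have "has_gradient (\<lambda>x. \<Sum>i\<in>UNIV. c i * x $ i * \<phi> i x)
    (\<lambda>j. \<Sum>i\<in>(UNIV::'n set). (c i * (if j = i then 1 else 0)) * \<phi> i x + c i * x $ i * g i j) x"
    by (intro has_gradient_sum has_gradient_mult has_gradient_cmult has_gradient_coord assms)
  moreover have "(\<Sum>i\<in>(UNIV::'n set). (c i * (if j = i then 1 else 0)) * \<phi> i x + c i * x $ i * g i j) =
     c j * \<phi> j x + (\<Sum>i\<in>(UNIV::'n set). c i * x $ i * g i j)" for j
  proof -
    have "(\<Sum>i\<in>UNIV. (c i * (if j = i then 1 else 0)) * \<phi> i x) = (\<Sum>i\<in>UNIV. if j = i then c i * \<phi> i x else 0)"
      by (intro sum.cong) auto
    then show ?thesis by (simp add: sum.distrib)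
  qed
  ultimately show ?thesis by simp
qed

text \<open>
Differentiation of the Euler relations of one level with respect to the constant term gives those of the
next level. The second relation acquires no extra term because the weight \<open>e i0\<close> is zero.
\<close>

lemma residue_euler:
  assumes "x \<in> U"
  shows "(\<Sum>i\<in>UNIV. x $ i * residue_solution (Suc k) (s - int (e i)) x) = - of_nat (Suc k) * residue_solution k s x"
    and "(\<Sum>i\<in>UNIV. of_nat (e i) * x $ i * residue_solution (Suc k) (s - int (e i)) x) = of_int s * residue_solution k s x"
proof -
  let ?R = residue_solution
  have diff: "c i0 * ?R k s x + (\<Sum>i\<in>UNIV. c i * x $ i * ?R (Suc k) (s - int (e i)) x) = partial i0 \<psi> x"
    if "\<And>x. x \<in> U \<Longrightarrow> (\<Sum>i\<in>UNIV. c i * x $ i * ?R k (s - int (e i)) x) = \<psi> x" "x \<in> U" for c \<psi> k x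
  proof -
    have "partial i0 \<psi> x = partial i0 (\<lambda>x. \<Sum>i\<in>UNIV. c i * x $ i * ?R k (s - int (e i)) x) x"
      by (rule partial_cong[OF open_U that(2)]) (simp add: that(1))
    also have "\<dots> = c i0 * ?R k (s - int (e i0)) x +
        (\<Sum>i\<in>UNIV. c i * x $ i * ?R (Suc k) (s - int (e i) - int (e i0)) x)"
      by (rule has_gradient_partial)
        (intro weighted_sum_gradient residue_solution_gradient that(2))
    finally show ?thesis by (simp add: e_i0)
  qed
  have "(\<forall>x\<in>U. (\<Sum>i\<in>UNIV. x $ i * ?R (Suc k) (s - int (e i)) x) = - of_nat (Suc k) * ?R k s x) \<and>
    (\<forall>x\<in>U. (\<Sum>i\<in>UNIV. of_nat (e i) * x $ i * ?R (Suc k) (s - int (e i)) x) = of_int s * ?R k s x)"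
  proof (induction k)
    case 0
    have "?R 0 s x + (\<Sum>i\<in>UNIV. x $ i * ?R (Suc 0) (s - int (e i)) x) = 0" if "x \<in> U" for x
      using diff[of "\<lambda>_. 1" 0 "\<lambda>_. 0" x] residue_euler_start(1) that
      by (simp add: has_gradient_partial[OF has_gradient_const])
    moreover have "(\<Sum>i\<in>UNIV. of_nat (e i) * x $ i * ?R (Suc 0) (s - int (e i)) x) = of_int s * ?R 0 s x"
      if "x \<in> U" for x
    proof -
      have "partial i0 (\<lambda>x. - 1 * \<rho> x powi (- s)) x = - 1 * (of_int (- s) * \<rho> x powi (- s - 1) * (\<rho> x ^ e i0 * slope x))"
        by (rule has_gradient_partial) (intro has_gradient_cmult power_int_gradient that)
      then show ?thesis
        using diff[of "\<lambda>i. of_nat (e i)" 0 "\<lambda>x. - 1 * \<rho> x powi (- s)" x] residue_euler_start(2) that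
        by (simp add: e_i0 residue_solution_0)
    qed
    ultimately show ?case by (simp add: eq_neg_iff_add_eq_0 add.commute)
  next
    case (Suc k)
    have p: "partial i0 (\<lambda>x. c * ?R k s x) x = c * ?R (Suc k) s x" if "x \<in> U" for c x
      unfolding residue_solution_Suc
      by (rule has_gradient_partial)
        (intro has_gradient_cmult smooth_has_gradient smooth_residue_solution that)
    have "?R (Suc k) s x + (\<Sum>i\<in>UNIV. x $ i * ?R (Suc (Suc k)) (s - int (e i)) x)
        = - of_nat (Suc k) * ?R (Suc k) s x" if "x \<in> U" for x
      using diff[of "\<lambda>_. 1" "Suc k" "\<lambda>x. - of_nat (Suc k) * ?R k s x" x] Suc that p[OF that, of "- of_nat (Suc k)"]
      by simp
    moreover have "(\<Sum>i\<in>UNIV. of_nat (e i) * x $ i * ?R (Suc (Suc k)) (s - int (e i)) x)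
        = of_int s * ?R (Suc k) s x" if "x \<in> U" for x
      using diff[of "\<lambda>i. of_nat (e i)" "Suc k" "\<lambda>x. of_int s * ?R k s x" x] Suc that p[OF that, of "of_int s"]
      by (simp add: e_i0)
    ultimately show ?case by (simp add: algebra_simps eq_neg_iff_add_eq_0)
  qed
  then show "(\<Sum>i\<in>UNIV. x $ i * ?R (Suc k) (s - int (e i)) x) = - of_nat (Suc k) * ?R k s x"
    "(\<Sum>i\<in>UNIV. of_nat (e i) * x $ i * ?R (Suc k) (s - int (e i)) x) = of_int s * ?R k s x"
    using assms by blast+
qed

end

section \<open>Primitives evaluated at a root\<close>

context root_section begin

text \<open>
The primitive of \<open>t\<^bsup>z-1\<^esup>\<close> at the root. The value \<open>0\<close> for \<open>z = 0\<close> discards the logarithm; the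
corresponding coefficient is zero at the indices of interest.
\<close>

definition root_primitive :: "int \<Rightarrow> complex ^ 'n \<Rightarrow> complex" where
  "root_primitive z x = (if z = 0 then 0 else \<rho> x powi z / of_int z)"

text \<open>
For \<open>a \<ge> 0\<close> the primitive of \<open>(f\<^sup>a / a!) t\<^bsup>-s-1\<^esup>\<close>, formed term by term and evaluated at the root.
\<close>

definition root_solution :: "int \<Rightarrow> int \<Rightarrow> complex ^ 'n \<Rightarrow> complex" where
  "root_solution a s x =
     (if a < 0 then residue_solution (nat (- a - 1)) s x
      else (\<Sum>c\<in>{0..int d * a}. divided_power e UNIV a c x * root_primitive (c - s) x))"

lemma full_support:
  assumes "divided_power e UNIV a c x \<noteq> 0"
  shows "(a, c) \<in> I_set (range e)" "0 \<le> c" "c \<le> int d * a"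
proof -
  have s: "(a, c) \<in> nat_span (e ` UNIV)" by (rule divided_power_support[OF inj_e assms])
  then show "(a, c) \<in> I_set (range e)" by (simp add: I_set_def)
  show "0 \<le> c" "c \<le> int d * a"
    using nat_span_bounds(2,3)[OF inj_e s, of 0 d] e_le by simp_all
qed

lemma divided_power_shift:
  "(\<Sum>c\<in>{0..int d * a}. divided_power e UNIV (a - 1) (c - int (e i)) x * F c) =
   (\<Sum>c\<in>{0..int d * (a - 1)}. divided_power e UNIV (a - 1) c x * F (c + int (e i)))"
proof -
  let ?D = "divided_power e UNIV (a - 1)"
  have "(\<Sum>c\<in>{0..int d * (a - 1)}. ?D c x * F (c + int (e i))) =
      (\<Sum>c\<in>(\<lambda>c. c + int (e i)) ` {0..int d * (a - 1)}. ?D (c - int (e i)) x * F c)"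
    by (subst sum.reindex) auto
  also have "\<dots> = (\<Sum>c\<in>{0..int d * a}. ?D (c - int (e i)) x * F c)"
  proof (rule sum.mono_neutral_left)
    have "int d * (a - 1) + int (e i) \<le> int d * a" using e_le[of i] by (simp add: algebra_simps)
    then show "(\<lambda>c. c + int (e i)) ` {0..int d * (a - 1)} \<subseteq> {0..int d * a}" by auto
    show "\<forall>c\<in>{0..int d * a} - (\<lambda>c. c + int (e i)) ` {0..int d * (a - 1)}. ?D (c - int (e i)) x * F c = 0"
    proof
      fix c assume c: "c \<in> {0..int d * a} - (\<lambda>c. c + int (e i)) ` {0..int d * (a - 1)}"
      have "?D (c - int (e i)) x = 0"
      proof (rule ccontr)
        assume "?D (c - int (e i)) x \<noteq> 0"
        from full_support(2,3)[OF this] have "c \<in> (\<lambda>c. c + int (e i)) ` {0..int d * (a - 1)}"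
          by (intro image_eqI[of _ _ "c - int (e i)"]) auto
        then show False using c by simp
      qed
      then show "?D (c - int (e i)) x * F c = 0" by simp
    qed
  qed simp
  finally show ?thesis ..
qed

text \<open>
This says \<open>f\<^sup>a = 0\<close> at a root for \<open>a \<ge> 1\<close>; the factor \<open>\<rho>\<^sup>z\<close> makes it directly applicable to primitives.
\<close>

lemma divided_power_root_sum:
  assumes "x \<in> U" "a \<ge> 1"
  shows "(\<Sum>c\<in>{0..int d * a}. divided_power e UNIV a c x * \<rho> x powi (c + z)) = 0"
proof -
  let ?D = "divided_power e UNIV"
  have nz: "\<rho> x \<noteq> 0" using root_nonzero assms by blast
  have "of_int a * (\<Sum>c\<in>{0..int d * a}. ?D a c x * \<rho> x powi (c + z)) =
      (\<Sum>c\<in>{0..int d * a}. \<Sum>i\<in>UNIV. x $ i * (?D (a - 1) (c - int (e i)) x * \<rho> x powi (c + z)))"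
  proof -
    have "of_int a * (?D a c x * \<rho> x powi (c + z)) =
        (\<Sum>i\<in>UNIV. x $ i * (?D (a - 1) (c - int (e i)) x * \<rho> x powi (c + z)))" for c
    proof -
      have "of_int a * (?D a c x * \<rho> x powi (c + z)) = (of_int a * ?D a c x) * \<rho> x powi (c + z)" by simp
      also have "of_int a * ?D a c x = (\<Sum>i\<in>UNIV. x $ i * ?D (a - 1) (c - int (e i)) x)"
        by (rule divided_power_euler1[symmetric])
      finally show ?thesis by (simp only: sum_distrib_right mult.assoc)
    qed
    then show ?thesis by (simp only: sum_distrib_left)
  qed
  also have "\<dots> = (\<Sum>i\<in>UNIV. x $ i * (\<Sum>c\<in>{0..int d * a}. ?D (a - 1) (c - int (e i)) x * \<rho> x powi (c + z)))"
    by (subst sum.swap) (simp add: sum_distrib_left)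
  also have "\<dots> = (\<Sum>i\<in>UNIV. x $ i * (\<Sum>c\<in>{0..int d * (a - 1)}. ?D (a - 1) c x * \<rho> x powi (c + int (e i) + z)))"
    unfolding divided_power_shift ..
  also have "\<dots> = (\<Sum>i\<in>UNIV. (x $ i * \<rho> x ^ e i) * (\<Sum>c\<in>{0..int d * (a - 1)}. ?D (a - 1) c x * \<rho> x powi (c + z)))"
  proof (rule sum.cong[OF refl])
    fix i
    have "\<rho> x powi (c + int (e i) + z) = \<rho> x ^ e i * \<rho> x powi (c + z)" for c
      using power_int_add[of "\<rho> x" "int (e i)" "c + z"] nz by (simp add: add_ac)
    then show "x $ i * (\<Sum>c\<in>{0..int d * (a - 1)}. ?D (a - 1) c x * \<rho> x powi (c + int (e i) + z)) =
        (x $ i * \<rho> x ^ e i) * (\<Sum>c\<in>{0..int d * (a - 1)}. ?D (a - 1) c x * \<rho> x powi (c + z))"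
      by (simp add: sum_distrib_left mult_ac)
  qed
  also have "\<dots> = 0"
    unfolding sum_distrib_right[symmetric] root_power_sum[OF assms(1)] by simp
  finally show ?thesis using assms(2) by simp
qed

lemma root_primitive_gradient:
  assumes "x \<in> U"
  shows "has_gradient (root_primitive z)
    (\<lambda>i. (if z = 0 then 0 else \<rho> x powi (z - 1)) * (\<rho> x ^ e i * slope x)) x"
proof (cases "z = 0")
  case True
  then show ?thesis using has_gradient_const[of 0 x] by (simp add: root_primitive_def[abs_def])
next
  case False
  then have "root_primitive z = (\<lambda>x. inverse (of_int z) * \<rho> x powi z)"
    by (simp add: root_primitive_def[abs_def] divide_inverse mult.commute)
  moreover have "has_gradient (\<lambda>x. inverse (of_int z) * \<rho> x powi z)
      (\<lambda>i. inverse (of_int z) * (of_int z * \<rho> x powi (z - 1) * (\<rho> x ^ e i * slope x))) x"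
    by (intro has_gradient_cmult power_int_gradient assms)
  moreover have "inverse (of_int z) * (of_int z * w * v) = w * v" for w v :: complex
    using False by (simp add: field_simps)
  ultimately show ?thesis using False by simp
qed

lemma root_solution_zero:
  "root_solution 0 s x = root_primitive (- s) x"
  by (simp add: root_solution_def divided_power_0)

text \<open>
For \<open>a \<ge> 1\<close> the dependence of the upper end \<open>\<rho>\<close> of the integral on \<open>x\<close> does not contribute, since the
integrand contains the factor \<open>f\<^sup>a\<close>; what remains is the derivative of the coefficients. At \<open>a = 0\<close> the
factor \<open>f\<close> is exhausted and the derivative of \<open>\<rho>\<^bsup>-s\<^esup>\<close> starts the family of residues.
\<close>

lemma root_contiguous: "contiguous_family e U root_solution"
  unfolding contiguous_family_def
proof (intro allI impI ballI)
  fix a s x assume I: "(a, s) \<notin> I_set (range e)" and x: "x \<in> U"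
  have nz: "\<rho> x \<noteq> 0" using root_nonzero x by blast
  let ?D = "divided_power e UNIV"
  let ?G = "has_gradient (root_solution a s) (\<lambda>i. root_solution (a - 1) (s - int (e i)) x) x"
  let ?E1 = "(\<Sum>i\<in>UNIV. x $ i * root_solution (a - 1) (s - int (e i)) x) = of_int a * root_solution a s x"
  let ?E2 = "(\<Sum>i\<in>UNIV. of_nat (e i) * x $ i * root_solution (a - 1) (s - int (e i)) x)
    = of_int s * root_solution a s x"
  consider "a < 0" | "a = 0" | "a \<ge> 1" by linarith
  then show "?G \<and> ?E1 \<and> ?E2"
  proof cases
    case 1
    then have eq: "root_solution a s = residue_solution (nat (- a - 1)) s"
      "root_solution (a - 1) s' = residue_solution (Suc (nat (- a - 1))) s'" for s'
    proof -
      have "nat (- (a - 1) - 1) = Suc (nat (- a - 1))" using 1 by linarith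
      then show "root_solution (a - 1) s' = residue_solution (Suc (nat (- a - 1))) s'"
        using 1 by (simp add: root_solution_def fun_eq_iff)
    qed (use 1 in \<open>simp add: root_solution_def fun_eq_iff\<close>)
    have "- of_nat (Suc (nat (- a - 1))) = (of_int a :: complex)" using 1 by (simp add: of_nat_nat)
    then show ?thesis
      unfolding eq using residue_solution_gradient[OF x] residue_euler[OF x] by simp
  next
    case 2
    have "(0, 0) \<in> I_set (range e)"
      unfolding I_set_def nat_span_image[OF inj_e] by (intro exI[of _ "\<lambda>_. 0"]) simp
    then have s: "s \<noteq> 0" using I 2 by auto
    have eq: "root_solution (a - 1) s' = residue_solution 0 s'" for s'
      using 2 by (simp add: root_solution_def fun_eq_iff)
    have "has_gradient (root_primitive (- s)) (\<lambda>i. \<rho> x powi (- s - 1) * (\<rho> x ^ e i * slope x)) x"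
      using root_primitive_gradient[OF x, of "- s"] s by simp
    moreover have "\<rho> x powi (- s - 1) * (\<rho> x ^ e i * slope x) = residue_solution 0 (s - int (e i)) x" for i
    proof -
      have "\<rho> x powi (- (s - int (e i)) - 1) = \<rho> x powi ((- s - 1) + int (e i))" by (simp add: algebra_simps)
      also have "\<dots> = \<rho> x powi (- s - 1) * \<rho> x powi int (e i)" by (rule power_int_add) (use nz in auto)
      finally show ?thesis by (simp add: residue_solution_0)
    qed
    ultimately have ?G unfolding eq using 2 root_solution_zero[abs_def] by simp
    moreover have ?E1 unfolding eq using residue_euler_start(1)[OF x] 2 by simp
    moreover have ?E2 unfolding eq residue_euler_start(2)[OF x]
      using 2 s by (simp add: root_solution_zero root_primitive_def)
    ultimately show ?thesis by blast
  next
    case 3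
    have D0: "?D a s x = 0" using full_support(1) I by blast
    have eq: "root_solution a s = (\<lambda>x. \<Sum>c\<in>{0..int d * a}. ?D a c x * root_primitive (c - s) x)"
      using 3 by (simp add: root_solution_def fun_eq_iff)
    have shift: "root_solution (a - 1) (s - int (e i)) x =
        (\<Sum>c\<in>{0..int d * a}. ?D (a - 1) (c - int (e i)) x * root_primitive (c - s) x)" for i
    proof -
      have "root_solution (a - 1) (s - int (e i)) x =
         (\<Sum>c\<in>{0..int d * (a - 1)}. ?D (a - 1) c x * root_primitive (c + int (e i) - s) x)"
        using 3 by (simp add: root_solution_def algebra_simps)
      then show ?thesis
        unfolding divided_power_shift[of a i x "\<lambda>c. root_primitive (c - s) x"] by simp
    qed
    have G: "has_gradient (root_solution a s) (\<lambda>i. \<Sum>c\<in>{0..int d * a}.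
        (if i \<in> UNIV then ?D (a - 1) (c - int (e i)) x else 0) * root_primitive (c - s) x +
        ?D a c x * ((if c - s = 0 then 0 else \<rho> x powi (c - s - 1)) * (\<rho> x ^ e i * slope x))) x"
      unfolding eq
      by (intro has_gradient_sum has_gradient_mult divided_power_gradient root_primitive_gradient x)
    have rho: "(\<Sum>c\<in>{0..int d * a}. ?D a c x * ((if c - s = 0 then 0 else \<rho> x powi (c - s - 1)) * w)) = 0" for w
    proof -
      have "(\<Sum>c\<in>{0..int d * a}. ?D a c x * ((if c - s = 0 then 0 else \<rho> x powi (c - s - 1)) * w)) =
          (\<Sum>c\<in>{0..int d * a}. ?D a c x * \<rho> x powi (c + (- s - 1))) * w"
        unfolding sum_distrib_right using D0 by (intro sum.cong) (auto simp: algebra_simps)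
      then show ?thesis using divided_power_root_sum[OF x 3] by simp
    qed
    have ?G
      by (rule has_gradient_cong[OF G open_UNIV UNIV_I refl])
        (simp only: shift sum.distrib rho UNIV_I if_True add_0_right)
    moreover have E: "(\<Sum>i\<in>UNIV. w i * root_solution (a - 1) (s - int (e i)) x) =
       (\<Sum>c\<in>{0..int d * a}. (\<Sum>i\<in>UNIV. w i * ?D (a - 1) (c - int (e i)) x) * root_primitive (c - s) x)" for w
    proof -
      have "(\<Sum>i\<in>UNIV. w i * root_solution (a - 1) (s - int (e i)) x) =
        (\<Sum>i\<in>UNIV. \<Sum>c\<in>{0..int d * a}. w i * ?D (a - 1) (c - int (e i)) x * root_primitive (c - s) x)"
        unfolding shift by (simp add: sum_distrib_left mult_ac)
      then show ?thesis by (subst (asm) sum.swap) (simp add: sum_distrib_right)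
    qed
    have ?E1
      unfolding E divided_power_euler1 unfolding eq by (simp add: sum_distrib_left mult_ac)
    moreover have ?E2
    proof -
      have "of_int c * ?D a c x * root_primitive (c - s) x =
         ?D a c x * \<rho> x powi (c + (- s)) + of_int s * (?D a c x * root_primitive (c - s) x)" for c
      proof (cases "c = s")
        case True
        then show ?thesis using D0 by simp
      next
        case False
        then have "of_int (c - s) * root_primitive (c - s) x = \<rho> x powi (c + (- s))"
          by (simp add: root_primitive_def)
        then have "?D a c x * (of_int (c - s) * root_primitive (c - s) x) = ?D a c x * \<rho> x powi (c + (- s))"
          by simp
        then show ?thesis by (simp add: algebra_simps)
      qed
      then show ?thesis
        unfolding E divided_power_euler2 using divided_power_root_sum[OF x 3, of "- s"]
        unfolding eq by (simp add: sum.distrib sum_distrib_left)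
    qed
    ultimately show ?thesis by blast
  qed
qed

lemma root_solution_minus_one: "root_solution (- 1) s x = \<rho> x powi (- s - 1) * slope x"
  by (simp add: root_solution_def residue_solution_0)

end

section \<open>Global sections of the roots\<close>

lemma poly_generic_poly: "poly (generic_poly e x) t = generic_eval e x t"
  by (simp add: generic_poly_def generic_eval_def poly_sum poly_monom)

lemma poly_pderiv_generic_poly: "poly (pderiv (generic_poly e x)) t = generic_deriv e x t"
proof -
  have "pderiv (generic_poly e x) = (\<Sum>i\<in>UNIV. pderiv (monom (x $ i) (e i)))"
    unfolding generic_poly_def using pderiv_sum[of "\<lambda>i. monom (x $ i) (e i)" UNIV] by simp
  then show ?thesis
    by (simp add: generic_deriv_def pderiv_monom poly_sum poly_monom mult_ac)
qed

text \<open>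
The leading coefficient and the discriminant of \<open>f(x;t)\<close> do not vanish, in the form in which this is used: the
degree is \<open>d\<close> and all roots are simple.
\<close>

locale nonsingular_domain = monomial_curve e d for e :: "'n::finite \<Rightarrow> nat" and d +
  fixes U :: "(complex ^ 'n) set" and l :: 'n
  assumes open_U: "open U" and e_l: "e l = d"
    and lead_nonzero: "\<And>x. x \<in> U \<Longrightarrow> x $ l \<noteq> 0"
    and simple: "\<And>x t. x \<in> U \<Longrightarrow> generic_eval e x t = 0 \<Longrightarrow> generic_deriv e x t \<noteq> 0"
begin

definition roots :: "complex ^ 'n \<Rightarrow> complex set" where
  "roots x = {t. generic_eval e x t = 0}"

lemma degree_generic_poly:
  assumes "x \<in> U"
  shows "degree (generic_poly e x) = d" "lead_coeff (generic_poly e x) = x $ l"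
proof -
  have "coeff (generic_poly e x) d = (\<Sum>i\<in>UNIV. if e i = d then x $ i else 0)"
    by (simp add: generic_poly_def coeff_sum coeff_monom)
  also have "\<dots> = (\<Sum>i\<in>UNIV. if i = l then x $ i else 0)"
    using e_l inj_e by (intro sum.cong) (auto dest: injD)
  finally have c: "coeff (generic_poly e x) d = x $ l" by simp
  moreover have "degree (generic_poly e x) \<le> d"
    unfolding generic_poly_def by (intro degree_sum_le) (auto intro: order_trans[OF degree_monom_le] e_le)
  moreover have "x $ l \<noteq> 0" using lead_nonzero assms .
  ultimately show "degree (generic_poly e x) = d" by (metis le_antisym le_degree)
  then show "lead_coeff (generic_poly e x) = x $ l" using c by simp
qed

lemma finite_roots: "x \<in> U \<Longrightarrow> finite (roots x)"
  using poly_roots_finite[of "generic_poly e x"] lead_nonzero[of x] degree_generic_poly(2)[of x]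
  unfolding roots_def by (metis (no_types, lifting) poly_generic_poly Collect_cong leading_coeff_0_iff)

lemma generic_eval_factor:
  assumes "x \<in> U"
  shows "generic_eval e x t = x $ l * (\<Prod>r\<in>roots x. t - r)" and "card (roots x) = d"
proof -
  let ?p = "generic_poly e x"
  have "rsquarefree ?p"
    unfolding rsquarefree_roots poly_generic_poly poly_pderiv_generic_poly using simple[OF assms] by blast
  then have p: "?p = Polynomial.smult (x $ l) (\<Prod>r\<in>roots x. [:- r, 1:])"
    using complex_poly_decompose_rsquarefree[of ?p] degree_generic_poly(2)[OF assms]
    unfolding roots_def poly_generic_poly by simp
  have "poly ?p t = x $ l * (\<Prod>r\<in>roots x. t - r)"
    by (subst p) (simp add: poly_prod)
  then show "generic_eval e x t = x $ l * (\<Prod>r\<in>roots x. t - r)" by (simp add: poly_generic_poly)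
  have "degree ?p = card (roots x)"
    by (subst p) (use lead_nonzero[OF assms] in \<open>simp add: degree_prod_eq_sum_degree\<close>)
  then show "card (roots x) = d" using degree_generic_poly(1)[OF assms] by simp
qed

text \<open>
Otherwise \<open>\<bar>f(y;r)\<bar> = \<bar>y\<^sub>l\<bar> \<Prod>\<^sub>t \<bar>r - t\<bar>\<close> would be at least \<open>\<bar>y\<^sub>l\<bar> \<epsilon>\<^sup>d\<close> for \<open>y\<close> arbitrarily close to \<open>x\<close>, although
\<open>f(x;r) = 0\<close>.
\<close>

lemma root_near:
  assumes x: "x \<in> U" and r: "r \<in> roots x" and \<epsilon>: "\<epsilon> > 0"
  shows "\<forall>\<^sub>F y in nhds x. \<exists>t\<in>roots y. dist r t < \<epsilon>"
proof -
  let ?g = "\<lambda>y. norm (generic_eval e y r) - norm (y $ l) * \<epsilon> ^ d"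
  have "continuous_on UNIV ?g"
    unfolding generic_eval_def by (intro continuous_intros)
  then have "isCont ?g x" by (simp add: continuous_on_eq_continuous_at)
  then have "(?g \<longlongrightarrow> ?g x) (nhds x)"
    unfolding isCont_def tendsto_at_iff_tendsto_nhds[of ?g x] .
  moreover have "?g x < 0"
    using r \<epsilon> lead_nonzero[OF x] by (simp add: roots_def)
  ultimately have "\<forall>\<^sub>F y in nhds x. ?g y < 0" by (rule order_tendstoD(2))
  moreover have "\<forall>\<^sub>F y in nhds x. y \<in> U" using open_U x by (rule eventually_nhds_in_open)
  ultimately show ?thesis
  proof eventually_elim
    case (elim y)
    show ?case
    proof (rule ccontr)
      assume "\<not> (\<exists>t\<in>roots y. dist r t < \<epsilon>)"
      then have "(\<Prod>t\<in>roots y. \<epsilon>) \<le> (\<Prod>t\<in>roots y. norm (r - t))"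
        using \<epsilon> by (intro prod_mono) (auto simp: dist_norm not_less)
      then have "\<epsilon> ^ d \<le> norm (\<Prod>t\<in>roots y. r - t)"
        using generic_eval_factor(2)[OF elim(2)] by (simp add: prod_norm)
      then have "norm (y $ l) * \<epsilon> ^ d \<le> norm (generic_eval e y r)"
        unfolding generic_eval_factor(1)[OF elim(2)] norm_mult by (rule mult_left_mono) simp
      then show False using elim(1) by simp
    qed
  qed
qed

text \<open>
Near \<open>x\<close> every root of \<open>f(x;t)\<close> has a root of \<open>f(y;t)\<close> close to it. As both polynomials have exactly \<open>d\<close>
roots, this accounts for all of them, one in each of the disjoint discs.
\<close>

lemma roots_separated:
  assumes x: "x \<in> U"
  obtains T \<epsilon> where "open T" "x \<in> T" "T \<subseteq> U" "\<epsilon> > 0"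
    "\<And>r r'. r \<in> roots x \<Longrightarrow> r' \<in> roots x \<Longrightarrow> r \<noteq> r' \<Longrightarrow> ball r \<epsilon> \<inter> ball r' \<epsilon> = {}"
    "\<And>y. y \<in> T \<Longrightarrow> roots y \<subseteq> (\<Union>r\<in>roots x. ball r \<epsilon>)"
    "\<And>y r. y \<in> T \<Longrightarrow> r \<in> roots x \<Longrightarrow> \<exists>!t. t \<in> roots y \<inter> ball r \<epsilon>"
proof -
  have fin: "finite (roots x)" by (rule finite_roots[OF x])
  obtain \<epsilon> where \<epsilon>: "\<epsilon> > 0" and sep: "\<And>r r'. r \<in> roots x \<Longrightarrow> r' \<in> roots x \<Longrightarrow> r \<noteq> r' \<Longrightarrow> 2 * \<epsilon> \<le> dist r r'"
  proof -
    have "\<exists>\<delta>>0. \<forall>r'\<in>roots x. r' \<noteq> r \<longrightarrow> \<delta> \<le> dist r r'" for r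
      using finite_set_avoid[OF fin, of r] .
    then obtain \<delta> where \<delta>: "\<And>r. \<delta> r > 0" "\<And>r r'. r' \<in> roots x \<Longrightarrow> r' \<noteq> r \<Longrightarrow> \<delta> r \<le> dist r r'"
      by metis
    define \<epsilon> where "\<epsilon> = Min (insert 1 (\<delta> ` roots x)) / 2"
    have "\<epsilon> > 0" unfolding \<epsilon>_def using fin \<delta>(1) by simp
    moreover have "2 * \<epsilon> \<le> \<delta> r" if "r \<in> roots x" for r
      unfolding \<epsilon>_def using fin that by simp
    ultimately show ?thesis using that \<delta>(2) by (metis order_trans)
  qed
  have disj: "ball r \<epsilon> \<inter> ball r' \<epsilon> = {}" if "r \<in> roots x" "r' \<in> roots x" "r \<noteq> r'" for r r'
  proof -
    have False if "dist r t < \<epsilon>" "dist r' t < \<epsilon>" for t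
      using dist_triangle2[of r r' t] sep[OF \<open>r \<in> roots x\<close> \<open>r' \<in> roots x\<close> \<open>r \<noteq> r'\<close>] that by linarith
    then show ?thesis by auto
  qed
  have "\<forall>\<^sub>F y in nhds x. \<forall>r\<in>roots x. \<exists>t\<in>roots y. dist r t < \<epsilon>"
    using root_near[OF x _ \<epsilon>] fin by (intro eventually_ball_finite) auto
  then obtain S where S: "open S" "x \<in> S" "\<And>y. y \<in> S \<Longrightarrow> \<forall>r\<in>roots x. \<exists>t\<in>roots y. dist r t < \<epsilon>"
    unfolding eventually_nhds by auto
  define T where "T = S \<inter> U"
  have T: "\<exists>t\<in>roots y. dist r t < \<epsilon>" if "y \<in> T" "r \<in> roots x" for y r using that S by (auto simp: T_def)
  have *: "roots y \<subseteq> (\<Union>r\<in>roots x. ball r \<epsilon>) \<and> (\<forall>r\<in>roots x. \<exists>!t. t \<in> roots y \<inter> ball r \<epsilon>)"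
    if y: "y \<in> T" for y
  proof -
    obtain \<tau> where \<tau>: "\<And>r. r \<in> roots x \<Longrightarrow> \<tau> r \<in> roots y \<and> dist r (\<tau> r) < \<epsilon>"
      using T[OF y] by metis
    have "inj_on \<tau> (roots x)"
    proof (rule inj_onI)
      fix r r' assume r: "r \<in> roots x" "r' \<in> roots x" "\<tau> r = \<tau> r'"
      then have "\<tau> r \<in> ball r \<epsilon> \<inter> ball r' \<epsilon>" using \<tau>[OF r(1)] \<tau>[OF r(2)] by auto
      then show "r = r'" using disj[OF r(1,2)] by blast
    qed
    moreover have "y \<in> U" using y by (simp add: T_def)
    ultimately have img: "\<tau> ` roots x = roots y"
      using \<tau> finite_roots generic_eval_factor(2) x by (intro card_subset_eq) (auto simp: card_image)
    have "t = \<tau> r" if "r \<in> roots x" "t \<in> roots y" "t \<in> ball r \<epsilon>" for t r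
    proof -
      have "t \<in> \<tau> ` roots x" using that(2) unfolding img .
      then obtain r' where r': "t = \<tau> r'" "r' \<in> roots x" by (rule imageE)
      then have "t \<in> ball r \<epsilon> \<inter> ball r' \<epsilon>" using that \<tau>[OF r'(2)] by simp
      then have "r = r'" using disj[OF that(1) r'(2)] by (metis empty_iff)
      then show ?thesis using r'(1) by simp
    qed
    note unique = this
    have "\<exists>!t. t \<in> roots y \<inter> ball r \<epsilon>" if "r \<in> roots x" for r
      using \<tau>[OF that] unique[OF that] by (intro ex1I[of _ "\<tau> r"]) auto
    moreover have "roots y \<subseteq> (\<Union>r\<in>roots x. ball r \<epsilon>)"
      unfolding img[symmetric] using \<tau> by auto
    ultimately show ?thesis by blast
  qed
  show ?thesis
    by (rule that[of T \<epsilon>]) (use S open_U x \<epsilon> disj * in \<open>auto simp: T_def\<close>)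
qed

definition root_cover :: "((complex ^ 'n) \<times> complex) set" where
  "root_cover = {(y, t). y \<in> U \<and> t \<in> roots y}"

text \<open>
The sheets over a small neighbourhood are cut out by the discs around the roots at its centre. The
inverse of the projection is continuous because \<open>root_near\<close> applies at every point of the
neighbourhood, with discs small enough to stay inside the given one.
\<close>

lemma covering_space_roots: "covering_space root_cover fst U"
proof
  show "continuous_on root_cover fst" by (intro continuous_intros)
  have "roots y \<noteq> {}" if "y \<in> U" for y
    using generic_eval_factor(2)[OF that] d_ge_2 by auto
  then show "fst ` root_cover = U" unfolding root_cover_def by force
  fix x assume x: "x \<in> U"
  obtain T \<epsilon> where T: "open T" "x \<in> T" "T \<subseteq> U" "\<epsilon> > 0"
    and disj: "\<And>r r'. r \<in> roots x \<Longrightarrow> r' \<in> roots x \<Longrightarrow> r \<noteq> r' \<Longrightarrow> ball r \<epsilon> \<inter> ball r' \<epsilon> = {}"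
    and cov: "\<And>y. y \<in> T \<Longrightarrow> roots y \<subseteq> (\<Union>r\<in>roots x. ball r \<epsilon>)"
    and ex1: "\<And>y r. y \<in> T \<Longrightarrow> r \<in> roots x \<Longrightarrow> \<exists>!t. t \<in> roots y \<inter> ball r \<epsilon>"
    by (rule roots_separated[OF x]) blast
  define sheet where "sheet = (\<lambda>r. root_cover \<inter> (T \<times> ball r \<epsilon>))"
  have "\<Union>(sheet ` roots x) = root_cover \<inter> fst -` T"
    using cov unfolding sheet_def root_cover_def by fastforce
  moreover have "openin (top_of_set root_cover) (sheet r)" for r
    unfolding sheet_def using T(1) by (intro openin_open_Int open_Times open_ball)
  moreover have "pairwise disjnt (sheet ` roots x)"
  proof (rule pairwiseI)
    fix A B assume "A \<in> sheet ` roots x" "B \<in> sheet ` roots x" "A \<noteq> B"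
    then obtain r r' where "A = sheet r" "B = sheet r'" "r \<in> roots x" "r' \<in> roots x" "r \<noteq> r'" by blast
    then show "disjnt A B" using disj[of r r'] unfolding sheet_def disjnt_def by blast
  qed
  moreover have "\<exists>q. homeomorphism (sheet r) T fst q" if r: "r \<in> roots x" for r
  proof -
    define \<tau> where "\<tau> = (\<lambda>y. THE t. t \<in> roots y \<inter> ball r \<epsilon>)"
    have \<tau>: "\<tau> y \<in> roots y \<inter> ball r \<epsilon>" if "y \<in> T" for y
      unfolding \<tau>_def by (rule theI'[OF ex1[OF that r]])
    have \<tau>_eq: "t = \<tau> y" if "y \<in> T" "t \<in> roots y" "t \<in> ball r \<epsilon>" for y t
      using ex1[OF that(1) r] \<tau>[OF that(1)] that by blast
    have "continuous (at y) \<tau>" if y: "y \<in> T" for y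
      unfolding isCont_def tendsto_iff
    proof (intro allI impI)
      fix \<delta> :: real assume "\<delta> > 0"
      obtain \<eta> where \<eta>: "\<eta> > 0" "ball (\<tau> y) \<eta> \<subseteq> ball r \<epsilon>"
        using \<tau>[OF y] open_ball[of r \<epsilon>] unfolding open_contains_ball by blast
      have "\<forall>\<^sub>F z in nhds y. \<exists>t\<in>roots z. dist (\<tau> y) t < min \<delta> \<eta>"
        by (rule root_near) (use T(3) y \<tau>[OF y] \<open>\<delta> > 0\<close> \<eta>(1) in auto)
      moreover have "\<forall>\<^sub>F z in nhds y. z \<in> T" using T(1) y by (rule eventually_nhds_in_open)
      ultimately have "\<forall>\<^sub>F z in nhds y. dist (\<tau> z) (\<tau> y) < \<delta>"
      proof eventually_elim
        case (elim z)
        then obtain t where t: "t \<in> roots z" "dist (\<tau> y) t < \<delta>" "dist (\<tau> y) t < \<eta>" by auto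
        then have "t = \<tau> z" using \<eta>(2) by (intro \<tau>_eq elim(2)) auto
        then show ?case using t by (simp add: dist_commute)
      qed
      then show "\<forall>\<^sub>F z in at y. dist (\<tau> z) (\<tau> y) < \<delta>"
        unfolding eventually_nhds_conv_at by blast
    qed
    then have "continuous_on T \<tau>" by (intro continuous_at_imp_continuous_on) auto
    then have "homeomorphism (sheet r) T fst (\<lambda>y. (y, \<tau> y))"
      using \<tau> \<tau>_eq T(3)
      by (intro homeomorphismI continuous_intros) (auto simp: sheet_def root_cover_def)
    then show ?thesis by blast
  qed
  ultimately show "\<exists>T. x \<in> T \<and> openin (top_of_set U) T \<and> (\<exists>v. \<Union> v = root_cover \<inter> fst -` T \<and>
      (\<forall>u\<in>v. openin (top_of_set root_cover) u) \<and> pairwise disjnt v \<and> (\<forall>u\<in>v. \<exists>q. homeomorphism u T fst q))"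
    using T by (intro exI[of _ T] conjI exI[of _ "sheet ` roots x"]) (auto simp: open_subset)
qed

lemma global_root_sections:
  assumes sc: "simply_connected U" and x0: "x0 \<in> U"
  obtains \<sigma> where
    "\<And>r. r \<in> roots x0 \<Longrightarrow> continuous_on U (\<sigma> r)"
    "\<And>r x. r \<in> roots x0 \<Longrightarrow> x \<in> U \<Longrightarrow> generic_eval e x (\<sigma> r x) = 0"
    "\<And>r r' x. r \<in> roots x0 \<Longrightarrow> r' \<in> roots x0 \<Longrightarrow> r \<noteq> r' \<Longrightarrow> x \<in> U \<Longrightarrow> \<sigma> r x \<noteq> \<sigma> r' x"
proof -
  note cov = covering_space_roots
  have lpc: "locally path_connected U" using open_U by (rule open_imp_locally_path_connected)
  have "\<exists>g. continuous_on U g \<and> g \<in> U \<rightarrow> root_cover \<and> g x0 = (x0, r) \<and> (\<forall>y\<in>U. fst (g y) = y)"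
    if "r \<in> roots x0" for r
  proof -
    have "(x0, r) \<in> root_cover" using that x0 by (simp add: root_cover_def)
    moreover have "(\<lambda>x. x) \<in> U \<rightarrow> U" by simp
    moreover have "x0 = fst (x0, r)" by simp
    ultimately show ?thesis
    proof (rule covering_space_lift_strong[OF cov _ x0 sc lpc continuous_on_id])
      fix g assume "continuous_on U g" "g \<in> U \<rightarrow> root_cover" "g x0 = (x0, r)"
        "\<And>y. y \<in> U \<Longrightarrow> fst (g y) = y"
      then show ?thesis by (intro exI[of _ g]) simp
    qed
  qed
  then obtain g where "\<forall>r\<in>roots x0. continuous_on U (g r) \<and> g r \<in> U \<rightarrow> root_cover \<and>
      g r x0 = (x0, r) \<and> (\<forall>y\<in>U. fst (g r y) = y)"
    using bchoice[of "roots x0" "\<lambda>r g. continuous_on U g \<and> g \<in> U \<rightarrow> root_cover \<and>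
      g x0 = (x0, r) \<and> (\<forall>y\<in>U. fst (g y) = y)"] by blast
  then have g: "\<And>r. r \<in> roots x0 \<Longrightarrow> continuous_on U (g r)"
      "\<And>r. r \<in> roots x0 \<Longrightarrow> g r \<in> U \<rightarrow> root_cover"
      "\<And>r. r \<in> roots x0 \<Longrightarrow> g r x0 = (x0, r)"
      "\<And>r y. r \<in> roots x0 \<Longrightarrow> y \<in> U \<Longrightarrow> fst (g r y) = y"
    by blast+
  define \<sigma> where "\<sigma> = (\<lambda>r x. snd (g r x))"
  have inC: "(y, \<sigma> r y) \<in> root_cover" if "r \<in> roots x0" "y \<in> U" for r y
  proof -
    have "(y, \<sigma> r y) = g r y" using g(4)[OF that] by (simp add: \<sigma>_def prod_eq_iff)
    also have "\<dots> \<in> root_cover" using g(2)[OF that(1)] that(2) by (rule funcset_mem)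
    finally show ?thesis .
  qed
  show ?thesis
  proof (rule that[of \<sigma>])
    show "continuous_on U (\<sigma> r)" if "r \<in> roots x0" for r
      unfolding \<sigma>_def using g(1)[OF that] by (rule continuous_on_snd)
    show "generic_eval e x (\<sigma> r x) = 0" if "r \<in> roots x0" "x \<in> U" for r x
      using inC[OF that] by (simp add: root_cover_def roots_def)
    show "\<sigma> r x \<noteq> \<sigma> r' x" if r: "r \<in> roots x0" "r' \<in> roots x0" "r \<noteq> r'" and x: "x \<in> U" for r r' x
    proof
      assume eq: "\<sigma> r x = \<sigma> r' x"
      then have "g r x = g r' x" using g(4) r x by (simp add: prod_eq_iff \<sigma>_def)
      then have "g r x0 = g r' x0"
        by (rule covering_space_lift_unique[OF cov _ continuous_on_id _ g(1)[OF r(1)] g(2)[OF r(1)]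
              g(4)[OF r(1), symmetric] g(1)[OF r(2)] g(2)[OF r(2)] g(4)[OF r(2), symmetric]
              simply_connected_imp_connected[OF sc] x x0]) simp
      then show False using g(3) r by simp
    qed
  qed
qed

end

section \<open>Algebraicity\<close>

lemma complex_polynomial_sum:
  "(\<And>k. k \<in> A \<Longrightarrow> complex_polynomial (f k)) \<Longrightarrow> complex_polynomial (\<lambda>x. \<Sum>k\<in>A. f k x)"
  by (induction A rule: infinite_finite_induct) (auto intro: complex_polynomial.intros)

lemma complex_polynomial_power:
  "complex_polynomial p \<Longrightarrow> complex_polynomial (\<lambda>x. p x ^ n)"
  by (induction n) (auto intro: complex_polynomial.intros)

lemma complex_polynomial_minus: "complex_polynomial p \<Longrightarrow> complex_polynomial (\<lambda>x. - p x)"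
  using complex_polynomial.mult[OF complex_polynomial.const[of "- 1"], of p] by simp

lemma complex_polynomial_divided_power: "complex_polynomial (divided_power e J a c)"
proof (induction a arbitrary: c rule: divided_power_induct)
  case (step a)
  have "complex_polynomial (\<lambda>x. (1 / of_int a) * (\<Sum>i\<in>J. x $ i * divided_power e J (a - 1) (c - int (e i)) x))"
    by (intro complex_polynomial.mult complex_polynomial_sum complex_polynomial.const
        complex_polynomial.coord step.IH)
  moreover have "divided_power e J a c =
      (\<lambda>x. (1 / of_int a) * (\<Sum>i\<in>J. x $ i * divided_power e J (a - 1) (c - int (e i)) x))"
    by (rule ext) (simp add: divided_power_rec[OF step.hyps(1)])
  ultimately show ?case by simp
qed (simp_all add: divided_power_def[abs_def] complex_polynomial.const)

text \<open>
Polynomials in one further indeterminate with coefficients in \<open>\<complex>[x]\<close>.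
\<close>

definition polynomial_coeffs :: "(complex ^ 'n::finite \<Rightarrow> complex poly) \<Rightarrow> bool" where
  "polynomial_coeffs F \<longleftrightarrow> (\<forall>k. complex_polynomial (\<lambda>x. coeff (F x) k))"

lemma polynomial_coeffs_const: "polynomial_coeffs (\<lambda>x. p)"
  by (simp add: polynomial_coeffs_def complex_polynomial.const)

lemma polynomial_coeffs_lift: "complex_polynomial p \<Longrightarrow> polynomial_coeffs (\<lambda>x. [:p x:])"
  unfolding polynomial_coeffs_def
proof
  fix k assume "complex_polynomial p"
  then show "complex_polynomial (\<lambda>x. coeff [:p x:] k)"
    by (cases k) (simp_all add: complex_polynomial.const)
qed

lemma polynomial_coeffs_add:
  "polynomial_coeffs F \<Longrightarrow> polynomial_coeffs G \<Longrightarrow> polynomial_coeffs (\<lambda>x. F x + G x)"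
  by (simp add: polynomial_coeffs_def complex_polynomial.add)

lemma polynomial_coeffs_mult:
  "polynomial_coeffs F \<Longrightarrow> polynomial_coeffs G \<Longrightarrow> polynomial_coeffs (\<lambda>x. F x * G x)"
  unfolding polynomial_coeffs_def coeff_mult
  by (intro allI complex_polynomial_sum complex_polynomial.mult) blast+

lemma polynomial_coeffs_sum:
  "(\<And>k. k \<in> A \<Longrightarrow> polynomial_coeffs (F k)) \<Longrightarrow> polynomial_coeffs (\<lambda>x. \<Sum>k\<in>A. F k x)"
  by (induction A rule: infinite_finite_induct)
    (auto intro: polynomial_coeffs_const polynomial_coeffs_add)

lemma polynomial_coeffs_prod:
  "(\<And>k. k \<in> A \<Longrightarrow> polynomial_coeffs (F k)) \<Longrightarrow> polynomial_coeffs (\<lambda>x. \<Prod>k\<in>A. F k x)"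
  by (induction A rule: infinite_finite_induct)
    (auto intro: polynomial_coeffs_const polynomial_coeffs_mult)

lemma polynomial_coeffs_char_poly:
  assumes "\<And>i j. i < d \<Longrightarrow> j < d \<Longrightarrow> complex_polynomial (A i j)"
  shows "polynomial_coeffs (\<lambda>x. char_poly (mat d d (\<lambda>(i, j). A i j x)))"
proof -
  let ?C = "\<lambda>x. char_poly_matrix (mat d d (\<lambda>(i, j). A i j x))"
  have C: "?C x \<in> carrier_mat d d" for x by simp
  have det: "char_poly (mat d d (\<lambda>(i, j). A i j x)) =
      (\<Sum>p | p permutes {0..<d}. signof p * (\<Prod>i = 0..<d. ?C x $$ (i, p i)))" for x
    unfolding char_poly_def by (rule det_def'[OF C])
  have entry: "?C x $$ (i, j) = (if i = j then [:0, 1:] else 0) + [:- A i j x:]" if "i < d" "j < d" for i j x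
    using that by (simp add: char_poly_matrix_def)
  show ?thesis
    unfolding det
  proof (intro polynomial_coeffs_sum polynomial_coeffs_mult polynomial_coeffs_const polynomial_coeffs_prod)
    fix p i assume "p \<in> {p. p permutes {0..<d}}" "i \<in> {0..<d}"
    then have i: "i < d" "p i < d" using permutes_in_image by fastforce+
    show "polynomial_coeffs (\<lambda>x. ?C x $$ (i, p i))"
      unfolding entry[OF i]
      by (intro polynomial_coeffs_add polynomial_coeffs_const polynomial_coeffs_lift
          complex_polynomial_minus assms i)
  qed
qed

text \<open>
After clearing a denominator \<open>q\<close> without zeros on \<open>U\<close>, multiplication by \<open>\<phi>\<close> maps the \<open>\<complex>[x]\<close>-module
generated by \<open>1, \<rho>, \<dots>, \<rho>\<^bsup>d-1\<^esup>\<close> into itself. Such functions form a ring, and denominators without zeros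
can be multiplied freely.
\<close>

definition root_module_stable ::
  "(complex ^ 'n::finite) set \<Rightarrow> (complex ^ 'n \<Rightarrow> complex) \<Rightarrow> nat \<Rightarrow> (complex ^ 'n \<Rightarrow> complex) \<Rightarrow> bool" where
  "root_module_stable U \<rho> d \<phi> \<longleftrightarrow>
     (\<exists>q A. complex_polynomial q \<and> (\<forall>x\<in>U. q x \<noteq> 0) \<and>
        (\<forall>i<d. \<forall>j<d. complex_polynomial (A i j)) \<and>
        (\<forall>x\<in>U. \<forall>i<d. q x * \<phi> x * \<rho> x ^ i = (\<Sum>j<d. A i j x * \<rho> x ^ j)))"

lemma root_module_stableI:
  assumes "complex_polynomial q" "\<And>x. x \<in> U \<Longrightarrow> q x \<noteq> 0"
    "\<And>i j. i < d \<Longrightarrow> j < d \<Longrightarrow> complex_polynomial (A i j)"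
    "\<And>x i. x \<in> U \<Longrightarrow> i < d \<Longrightarrow> q x * \<phi> x * \<rho> x ^ i = (\<Sum>j<d. A i j x * \<rho> x ^ j)"
  shows "root_module_stable U \<rho> d \<phi>"
  unfolding root_module_stable_def
  by (rule exI[of _ q], rule exI[of _ A]) (use assms in blast)

text \<open>
The determinant trick: \<open>q \<phi>\<close> is an eigenvalue of the matrix of this multiplication, with eigenvector
\<open>(1, \<rho>, \<dots>, \<rho>\<^bsup>d-1\<^esup>)\<close>, so the characteristic polynomial annihilates it. Substituting \<open>q \<phi>\<close> turns the
leading coefficient \<open>1\<close> into \<open>q\<^sup>d\<close>, which is not the zero polynomial.
\<close>

lemma root_module_stable_algebraic:
  assumes "root_module_stable U \<rho> d \<phi>" "U \<noteq> {}" "d > 0"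
  shows "algebraic_on \<phi> U"
proof -
  obtain q A where q: "complex_polynomial q" "\<And>x. x \<in> U \<Longrightarrow> q x \<noteq> 0"
    and A: "\<And>i j. i < d \<Longrightarrow> j < d \<Longrightarrow> complex_polynomial (A i j)"
    and eq: "\<And>x i. x \<in> U \<Longrightarrow> i < d \<Longrightarrow> q x * \<phi> x * \<rho> x ^ i = (\<Sum>j<d. A i j x * \<rho> x ^ j)"
    using assms(1) unfolding root_module_stable_def by blast
  define M where "M = (\<lambda>x. mat d d (\<lambda>(i, j). A i j x))"
  have M: "M x \<in> carrier_mat d d" for x by (simp add: M_def)
  define a where "a = (\<lambda>k x. coeff (char_poly (M x)) k * q x ^ k)"
  have "polynomial_coeffs (\<lambda>x. char_poly (M x))"
    unfolding M_def by (rule polynomial_coeffs_char_poly) (rule A)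
  then have "complex_polynomial (a k)" for k
    using q(1) unfolding a_def polynomial_coeffs_def
    by (intro complex_polynomial.mult complex_polynomial_power) auto
  moreover have "\<exists>x. a d x \<noteq> 0"
    using q(2) assms(2) degree_monic_char_poly[OF M] by (auto simp: a_def)
  moreover have "(\<Sum>k\<le>d. a k x * \<phi> x ^ k) = 0" if x: "x \<in> U" for x
  proof -
    define v where "v = Matrix.vec d (\<lambda>i. \<rho> x ^ i)"
    have v: "v \<in> carrier_vec d" by (simp add: v_def)
    have "eigenvector (M x) v (q x * \<phi> x)"
      unfolding eigenvector_def
    proof (intro conjI)
      show "v \<in> carrier_vec (dim_row (M x))" using M[of x] v by simp
      have "vec_index v 0 = 1" using assms(3) by (simp add: v_def)
      then show "v \<noteq> 0\<^sub>v (dim_row (M x))" using M[of x] assms(3) by auto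
      show "M x *\<^sub>v v = (q x * \<phi> x) \<cdot>\<^sub>v v"
      proof (rule eq_vecI)
        fix i assume "i < dim_vec ((q x * \<phi> x) \<cdot>\<^sub>v v)"
        then have i: "i < d" by (simp add: v_def)
        have "vec_index (M x *\<^sub>v v) i = (\<Sum>j = 0..<d. A i j x * \<rho> x ^ j)"
          using i by (simp add: M_def v_def scalar_prod_def)
        also have "\<dots> = q x * \<phi> x * \<rho> x ^ i" using eq[OF x i] by (simp add: atLeast0LessThan)
        finally show "vec_index (M x *\<^sub>v v) i = vec_index ((q x * \<phi> x) \<cdot>\<^sub>v v) i"
          using i by (simp add: v_def)
      qed (simp add: M_def v_def)
    qed
    then have "eigenvalue (M x) (q x * \<phi> x)" unfolding eigenvalue_def by blast
    then have "poly (char_poly (M x)) (q x * \<phi> x) = 0"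
      using eigenvalue_root_char_poly[OF M] by blast
    then show ?thesis
      using degree_monic_char_poly[OF M[of x]]
      by (simp add: poly_altdef a_def power_mult_distrib mult_ac)
  qed
  ultimately show ?thesis
    unfolding algebraic_on_def by (intro exI[of _ d] exI[of _ a]) blast
qed

lemma root_module_stable_div:
  assumes "complex_polynomial p" "complex_polynomial q" "\<And>x. x \<in> U \<Longrightarrow> q x \<noteq> 0"
  shows "root_module_stable U \<rho> d (\<lambda>x. p x / q x)"
proof (rule root_module_stableI[where q = q and A = "\<lambda>i j x. if i = j then p x else 0"])
  show "complex_polynomial (\<lambda>x. if i = j then p x else 0)" for i j :: nat
    using assms(1) by (cases "i = j") (auto intro: complex_polynomial.const)
  show "q x * (p x / q x) * \<rho> x ^ i = (\<Sum>j<d. (if i = j then p x else 0) * \<rho> x ^ j)"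
    if "x \<in> U" "i < d" for x i
    using that assms(3) by (simp add: if_distrib[where f = "\<lambda>c. c * _"] cong: if_cong)
qed (use assms in auto)

lemma root_module_stable_poly:
  assumes "complex_polynomial p"
  shows "root_module_stable U \<rho> d p"
  using root_module_stable_div[OF assms complex_polynomial.const[of 1], of U \<rho> d] by simp

lemma root_module_stable_add:
  assumes "root_module_stable U \<rho> d \<phi>" "root_module_stable U \<rho> d \<psi>"
  shows "root_module_stable U \<rho> d (\<lambda>x. \<phi> x + \<psi> x)"
proof -
  obtain q A where q: "complex_polynomial q" "\<And>x. x \<in> U \<Longrightarrow> q x \<noteq> 0"
    and A: "\<And>i j. i < d \<Longrightarrow> j < d \<Longrightarrow> complex_polynomial (A i j)"
    and eq: "\<And>x i. x \<in> U \<Longrightarrow> i < d \<Longrightarrow> q x * \<phi> x * \<rho> x ^ i = (\<Sum>j<d. A i j x * \<rho> x ^ j)"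
    using assms(1) unfolding root_module_stable_def by blast
  obtain r B where r: "complex_polynomial r" "\<And>x. x \<in> U \<Longrightarrow> r x \<noteq> 0"
    and B: "\<And>i j. i < d \<Longrightarrow> j < d \<Longrightarrow> complex_polynomial (B i j)"
    and eq': "\<And>x i. x \<in> U \<Longrightarrow> i < d \<Longrightarrow> r x * \<psi> x * \<rho> x ^ i = (\<Sum>j<d. B i j x * \<rho> x ^ j)"
    using assms(2) unfolding root_module_stable_def by blast
  show ?thesis
  proof (rule root_module_stableI[where q = "\<lambda>x. q x * r x" and A = "\<lambda>i j x. r x * A i j x + q x * B i j x"])
    fix x i assume x: "x \<in> U" "i < d"
    have "q x * r x * (\<phi> x + \<psi> x) * \<rho> x ^ i = r x * (q x * \<phi> x * \<rho> x ^ i) + q x * (r x * \<psi> x * \<rho> x ^ i)"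
      by (simp add: algebra_simps)
    then show "q x * r x * (\<phi> x + \<psi> x) * \<rho> x ^ i = (\<Sum>j<d. (r x * A i j x + q x * B i j x) * \<rho> x ^ j)"
      unfolding eq[OF x] eq'[OF x] by (simp add: sum_distrib_left sum.distrib distrib_right mult.assoc)
  next
    fix i j assume "i < d" "j < d"
    then show "complex_polynomial (\<lambda>x. r x * A i j x + q x * B i j x)"
      by (intro complex_polynomial.add complex_polynomial.mult q r A B)
  qed (use q r in \<open>auto intro: complex_polynomial.intros\<close>)
qed

lemma root_module_stable_mult:
  assumes "root_module_stable U \<rho> d \<phi>" "root_module_stable U \<rho> d \<psi>"
  shows "root_module_stable U \<rho> d (\<lambda>x. \<phi> x * \<psi> x)"
proof -
  obtain q A where q: "complex_polynomial q" "\<And>x. x \<in> U \<Longrightarrow> q x \<noteq> 0"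
    and A: "\<And>i j. i < d \<Longrightarrow> j < d \<Longrightarrow> complex_polynomial (A i j)"
    and eq: "\<And>x i. x \<in> U \<Longrightarrow> i < d \<Longrightarrow> q x * \<phi> x * \<rho> x ^ i = (\<Sum>j<d. A i j x * \<rho> x ^ j)"
    using assms(1) unfolding root_module_stable_def by blast
  obtain r B where r: "complex_polynomial r" "\<And>x. x \<in> U \<Longrightarrow> r x \<noteq> 0"
    and B: "\<And>i j. i < d \<Longrightarrow> j < d \<Longrightarrow> complex_polynomial (B i j)"
    and eq': "\<And>x i. x \<in> U \<Longrightarrow> i < d \<Longrightarrow> r x * \<psi> x * \<rho> x ^ i = (\<Sum>j<d. B i j x * \<rho> x ^ j)"
    using assms(2) unfolding root_module_stable_def by blast
  show ?thesis
  proof (rule root_module_stableI[where q = "\<lambda>x. q x * r x" and A = "\<lambda>i k x. \<Sum>j<d. A i j x * B j k x"])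
    fix x i assume x: "x \<in> U" "i < d"
    have "q x * r x * (\<phi> x * \<psi> x) * \<rho> x ^ i = r x * \<psi> x * (q x * \<phi> x * \<rho> x ^ i)"
      by (simp add: mult_ac)
    also have "\<dots> = (\<Sum>j<d. A i j x * (r x * \<psi> x * \<rho> x ^ j))"
      unfolding eq[OF x] sum_distrib_left by (simp only: mult_ac)
    also have "\<dots> = (\<Sum>j<d. A i j x * (\<Sum>k<d. B j k x * \<rho> x ^ k))"
      using eq'[OF x(1)] by (intro sum.cong) auto
    also have "\<dots> = (\<Sum>k<d. \<Sum>j<d. A i j x * (B j k x * \<rho> x ^ k))"
      unfolding sum_distrib_left by (rule sum.swap)
    also have "\<dots> = (\<Sum>k<d. (\<Sum>j<d. A i j x * B j k x) * \<rho> x ^ k)"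
      by (simp only: sum_distrib_right mult.assoc)
    finally show "q x * r x * (\<phi> x * \<psi> x) * \<rho> x ^ i = (\<Sum>k<d. (\<Sum>j<d. A i j x * B j k x) * \<rho> x ^ k)" .
  qed (use q r A B in \<open>auto intro!: complex_polynomial.intros complex_polynomial_sum\<close>)
qed

lemma root_module_stable_sum:
  "(\<And>k. k \<in> K \<Longrightarrow> root_module_stable U \<rho> d (f k)) \<Longrightarrow> root_module_stable U \<rho> d (\<lambda>x. \<Sum>k\<in>K. f k x)"
  by (induction K rule: infinite_finite_induct)
    (auto intro: root_module_stable_add root_module_stable_poly complex_polynomial.const)

lemma root_module_stable_power:
  "root_module_stable U \<rho> d f \<Longrightarrow> root_module_stable U \<rho> d (\<lambda>x. f x ^ n)"
  by (induction n)
    (auto intro: root_module_stable_mult root_module_stable_poly complex_polynomial.const)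

context root_section begin

text \<open>
Multiplication by \<open>x\<^sub>l \<rho>\<close> is given by the companion matrix: \<open>x\<^sub>l \<rho>\<^sup>d\<close> is replaced by the negative of the
remaining terms of \<open>f(x;\<rho>) = 0\<close>.
\<close>

lemma root_module_stable_root:
  assumes e_l: "e l = d" and l: "\<And>x. x \<in> U \<Longrightarrow> x $ l \<noteq> 0"
  shows "root_module_stable U \<rho> d \<rho>"
proof (rule root_module_stableI[where q = "\<lambda>x. x $ l" and A = "\<lambda>i j x. if Suc i < d then (if j = Suc i then x $ l else 0)
      else - (\<Sum>k\<in>-{l}. if e k = j then x $ k else 0)"])
  fix i j
  have p: "complex_polynomial (\<lambda>x. if e k = j then x $ k else 0)" for k j
    by (cases "e k = j") (auto intro: complex_polynomial.intros)
  show "complex_polynomial (\<lambda>x. if Suc i < d then (if j = Suc i then x $ l else 0)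
      else - (\<Sum>k\<in>-{l}. if e k = j then x $ k else 0))"
    by (cases "Suc i < d"; cases "j = Suc i")
      (auto intro!: complex_polynomial.intros complex_polynomial_minus complex_polynomial_sum p)
next
  fix x i assume x: "x \<in> U" and i: "i < d"
  show "x $ l * \<rho> x * \<rho> x ^ i = (\<Sum>j<d. (if Suc i < d then (if j = Suc i then x $ l else 0)
      else - (\<Sum>k\<in>-{l}. if e k = j then x $ k else 0)) * \<rho> x ^ j)"
  proof (cases "Suc i < d")
    case True
    then have "(\<Sum>j<d. (if j = Suc i then x $ l else 0) * \<rho> x ^ j) = x $ l * \<rho> x ^ Suc i"
      by (simp add: if_distrib[where f = "\<lambda>c. c * _"] cong: if_cong)
    then show ?thesis using True by simp
  next
    case False
    then have "d = Suc i" using i by simp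
    have lt: "e k < d" if "k \<noteq> l" for k
      using exponent_ne_bounds(2)[OF that e_l] d_ge_2 by linarith
    have "0 = x $ l * \<rho> x ^ d + (\<Sum>k\<in>-{l}. x $ k * \<rho> x ^ e k)"
      using root_power_sum[OF x] sum.remove[of UNIV l "\<lambda>k. x $ k * \<rho> x ^ e k"] e_l
      by (simp add: Compl_eq_Diff_UNIV)
    then have "x $ l * \<rho> x ^ d = - (\<Sum>k\<in>-{l}. x $ k * \<rho> x ^ e k)"
      by (simp add: eq_neg_iff_add_eq_0)
    also have "(\<Sum>k\<in>-{l}. x $ k * \<rho> x ^ e k) = (\<Sum>k\<in>-{l}. \<Sum>j<d. (if e k = j then x $ k else 0) * \<rho> x ^ j)"
      using lt by (intro sum.cong) (auto simp: if_distrib[where f = "\<lambda>c. c * _"] cong: if_cong)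
    also have "\<dots> = (\<Sum>j<d. (\<Sum>k\<in>-{l}. if e k = j then x $ k else 0) * \<rho> x ^ j)"
      by (subst sum.swap) (simp only: sum_distrib_right)
    finally have "x $ l * \<rho> x ^ d = (\<Sum>j<d. - (\<Sum>k\<in>-{l}. if e k = j then x $ k else 0) * \<rho> x ^ j)"
      by (simp only: sum_negf mult_minus_left)
    then show ?thesis using False \<open>d = Suc i\<close> by (simp only: if_False power_Suc mult.assoc)
  qed
qed (use l in \<open>auto intro: complex_polynomial.intros\<close>)

text \<open>
Divided by \<open>\<rho>\<close>, the equation \<open>f(x;\<rho>) = 0\<close> expresses \<open>x\<^sub>0 / \<rho>\<close> by nonnegative powers of \<open>\<rho>\<close>.
\<close>

lemma root_module_stable_inverse_root:
  assumes i0: "\<And>x. x \<in> U \<Longrightarrow> x $ i0 \<noteq> 0"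
  shows "root_module_stable U \<rho> d (\<lambda>x. inverse (\<rho> x))"
proof (rule root_module_stableI[where q = "\<lambda>x. x $ i0" and A = "\<lambda>i j x. if i > 0 then (if Suc j = i then x $ i0 else 0)
      else - (\<Sum>k\<in>-{i0}. if e k = Suc j then x $ k else 0)"])
  fix i j
  have p: "complex_polynomial (\<lambda>x. if e k = Suc j then x $ k else 0)" for k j
    by (cases "e k = Suc j") (auto intro: complex_polynomial.intros)
  show "complex_polynomial (\<lambda>x. if i > 0 then (if Suc j = i then x $ i0 else 0)
      else - (\<Sum>k\<in>-{i0}. if e k = Suc j then x $ k else 0))"
    by (cases "i > 0"; cases "Suc j = i")
      (auto intro!: complex_polynomial.intros complex_polynomial_minus complex_polynomial_sum p)
next
  fix x i assume x: "x \<in> U" and i: "i < d"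
  have nz: "\<rho> x \<noteq> 0" using root_nonzero x .
  show "x $ i0 * inverse (\<rho> x) * \<rho> x ^ i = (\<Sum>j<d. (if i > 0 then (if Suc j = i then x $ i0 else 0)
      else - (\<Sum>k\<in>-{i0}. if e k = Suc j then x $ k else 0)) * \<rho> x ^ j)"
  proof (cases i)
    case (Suc i')
    then have "(\<Sum>j<d. (if Suc j = i then x $ i0 else 0) * \<rho> x ^ j) = x $ i0 * \<rho> x ^ i'"
      using i by (simp add: if_distrib[where f = "\<lambda>c. c * _"] cong: if_cong)
    then show ?thesis using Suc nz by simp
  next
    case 0
    have pos: "1 \<le> e k" "e k \<le> d" if "k \<noteq> i0" for k
      using exponent_ne_bounds(1)[OF that e_i0] e_le by auto
    have "0 = x $ i0 + (\<Sum>k\<in>-{i0}. x $ k * \<rho> x ^ e k)"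
      using root_power_sum[OF x] sum.remove[of UNIV i0 "\<lambda>k. x $ k * \<rho> x ^ e k"] e_i0
      by (simp add: Compl_eq_Diff_UNIV)
    then have "x $ i0 = - (\<Sum>k\<in>-{i0}. x $ k * \<rho> x ^ e k)"
      by (simp add: eq_neg_iff_add_eq_0)
    also have "(\<Sum>k\<in>-{i0}. x $ k * \<rho> x ^ e k) =
        (\<Sum>k\<in>-{i0}. \<rho> x * (\<Sum>j<d. (if e k = Suc j then x $ k else 0) * \<rho> x ^ j))"
    proof (rule sum.cong[OF refl])
      fix k assume "k \<in> - {i0}"
      then have k: "1 \<le> e k" "e k \<le> d" using pos by auto
      have "(\<Sum>j<d. (if e k = Suc j then x $ k else 0) * \<rho> x ^ j) = (\<Sum>j<d. if j = e k - 1 then x $ k * \<rho> x ^ j else 0)"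
        using k by (intro sum.cong) auto
      also have "\<dots> = x $ k * \<rho> x ^ (e k - 1)" using k by auto
      finally show "x $ k * \<rho> x ^ e k = \<rho> x * (\<Sum>j<d. (if e k = Suc j then x $ k else 0) * \<rho> x ^ j)"
        using k by (simp add: power_eq_if)
    qed
    also have "\<dots> = \<rho> x * (\<Sum>j<d. (\<Sum>k\<in>-{i0}. if e k = Suc j then x $ k else 0) * \<rho> x ^ j)"
      unfolding sum_distrib_left[symmetric] sum_distrib_right by (subst sum.swap) (rule refl)
    finally have "x $ i0 = \<rho> x * (\<Sum>j<d. - (\<Sum>k\<in>-{i0}. if e k = Suc j then x $ k else 0) * \<rho> x ^ j)"
      by (simp only: sum_negf mult_minus_left mult_minus_right)
    then have "x $ i0 * inverse (\<rho> x) = (\<Sum>j<d. - (\<Sum>k\<in>-{i0}. if e k = Suc j then x $ k else 0) * \<rho> x ^ j)"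
      using nz by (simp only:) (simp add: field_simps)
    then show ?thesis using 0 by simp
  qed
qed (use i0 in \<open>auto intro: complex_polynomial.intros\<close>)

lemma root_solution_algebraic:
  assumes "e l = d" "\<And>x. x \<in> U \<Longrightarrow> x $ l \<noteq> 0" "\<And>x. x \<in> U \<Longrightarrow> x $ i0 \<noteq> 0" "U \<noteq> {}" "a \<ge> 0"
  shows "algebraic_on (root_solution a s) U"
proof -
  have pw: "root_module_stable U \<rho> d (\<lambda>x. \<rho> x powi z)" for z
    unfolding power_int_def
    by (cases "z \<ge> 0") (simp_all add: root_module_stable_power root_module_stable_root[OF assms(1,2)]
        root_module_stable_inverse_root[OF assms(3)])
  have "root_module_stable U \<rho> d (\<lambda>x. if z = 0 then 0 else (1 / of_int z) * \<rho> x powi z)" for z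
  proof (cases "z = 0")
    case False
    have "root_module_stable U \<rho> d (\<lambda>x. (1 / of_int z) * \<rho> x powi z)"
      by (intro root_module_stable_mult pw root_module_stable_poly complex_polynomial.const)
    then show ?thesis using False by simp
  qed (simp add: root_module_stable_poly complex_polynomial.const)
  moreover have "root_primitive z = (\<lambda>x. if z = 0 then 0 else (1 / of_int z) * \<rho> x powi z)" for z
    by (simp add: root_primitive_def fun_eq_iff)
  ultimately have prim: "root_module_stable U \<rho> d (root_primitive z)" for z by simp
  have "root_module_stable U \<rho> d (\<lambda>x. \<Sum>c\<in>{0..int d * a}. divided_power e UNIV a c x * root_primitive (c - s) x)"
    by (intro root_module_stable_sum root_module_stable_mult prim
        root_module_stable_poly[OF complex_polynomial_divided_power])
  moreover have "root_solution a s = (\<lambda>x. \<Sum>c\<in>{0..int d * a}. divided_power e UNIV a c x * root_primitive (c - s) x)"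
    using assms(5) by (simp add: root_solution_def fun_eq_iff)
  ultimately show ?thesis
    using root_module_stable_algebraic[of U \<rho> d] assms(4) d_ge_2 by simp
qed

end

text \<open>
A rational function acts on the module generated by \<open>1\<close> alone, so the dummy root \<open>1\<close> and rank \<open>1\<close> suffice.
\<close>

lemma (in monomial_curve) laurent_solution_algebraic:
  assumes "\<And>x. x \<in> U \<Longrightarrow> x $ l \<noteq> 0" "U \<noteq> {}"
  shows "algebraic_on (laurent_solution l a s) U"
proof -
  have "root_module_stable U (\<lambda>_. 1) 1 (laurent_term l a s k)" for k
  proof -
    have "root_module_stable U (\<lambda>_. 1) 1
      (\<lambda>x. ((- 1) ^ k * fact (k - 1) * divided_power e (- {l}) (a + int k) (s + int k * int (e l)) x) / (x $ l) ^ k)"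
      using assms(1) by (intro root_module_stable_div complex_polynomial.mult complex_polynomial.const
          complex_polynomial_divided_power complex_polynomial_power complex_polynomial.coord) auto
    then show ?thesis
      by (simp add: laurent_term_def[abs_def] laurent_coeff_def divide_inverse power_inverse mult_ac)
  qed
  then have "root_module_stable U (\<lambda>_. 1) 1 (laurent_solution l a s)"
    unfolding laurent_solution_def[abs_def] by (intro root_module_stable_sum)
  then show ?thesis using root_module_stable_algebraic assms(2) by fastforce
qed

lemma nonzero_discriminant_simple:
  assumes "discriminant p \<noteq> 0" "poly p t = 0"
  shows "poly (pderiv p) t \<noteq> 0"
proof
  assume "poly (pderiv p) t = 0"
  then have dvd: "[:- t, 1:] dvd gcd p (pderiv p)"
    using assms(2) by (simp add: poly_eq_0_iff_dvd)
  have "resultant p (pderiv p) \<noteq> 0" "p \<noteq> 0" using assms(1) by (auto simp: discriminant_def)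
  then have "degree (gcd p (pderiv p)) = 0" "gcd p (pderiv p) \<noteq> 0"
    using resultant_0_gcd[of p "pderiv p"] by auto
  then show False using dvd_imp_degree_le[OF dvd] by simp
qed

section \<open>Consecutive lattice points\<close>

lemma nat_span_mono:
  assumes "(a, s) \<in> nat_span J" "J \<subseteq> K" "finite K"
  shows "(a, s) \<in> nat_span K"
proof -
  obtain u where u: "a = (\<Sum>j\<in>J. int (u j))" "s = (\<Sum>j\<in>J. int (u j) * int j)"
    using assms(1) unfolding nat_span_def by auto
  define v where "v = (\<lambda>j. if j \<in> J then u j else 0)"
  have "(\<Sum>j\<in>J. int (u j)) = (\<Sum>j\<in>K. int (v j))"
    "(\<Sum>j\<in>J. int (u j) * int j) = (\<Sum>j\<in>K. int (v j) * int j)"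
    using assms(2,3) by (intro sum.mono_neutral_cong_left; auto simp: v_def)+
  then show ?thesis unfolding u nat_span_def by blast
qed

lemma nat_span_single:
  assumes "j \<in> K" "finite K" "a \<ge> 0"
  shows "(a, a * int j) \<in> nat_span K"
proof -
  have "(a, a * int j) \<in> nat_span {j}"
    unfolding nat_span_def using assms(3) by (intro CollectI exI[of _ "\<lambda>_. nat a"]) simp
  then show ?thesis using assms nat_span_mono by blast
qed

lemma I_set_pad:
  assumes "(a, s) \<in> I_set K" "a \<le> a'" "0 \<in> K" "finite K"
  shows "(a', s) \<in> I_set K"
  using nat_span_add[OF assms(1)[unfolded I_set_def] nat_span_single[OF assms(3,4), of "a' - a"]] assms(2)
  by (simp add: I_set_def)

lemma bezout_finite:
  assumes "finite (A :: nat set)"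
  shows "\<exists>z :: nat \<Rightarrow> int. (\<Sum>j\<in>A. z j * int j) = int (Gcd A)"
  using assms
proof (induction A rule: finite_induct)
  case (insert a A)
  then obtain z where z: "(\<Sum>j\<in>A. z j * int j) = int (Gcd A)" by blast
  obtain p q where pq: "p * int a + q * int (Gcd A) = gcd (int a) (int (Gcd A))"
    using bezout_int by blast
  define y where "y = (\<lambda>j. if j = a then p else q * z j)"
  have "(\<Sum>j\<in>insert a A. y j * int j) = p * int a + (\<Sum>j\<in>A. q * (z j * int j))"
    using insert.hyps by (auto simp: y_def intro!: sum.cong)
  also have "\<dots> = int (Gcd (insert a A))"
    using pq z by (simp add: sum_distrib_left[symmetric])
  finally show ?case by blast
qed simp

text \<open>
Let \<open>z\<close> be Bezout coefficients of the exponents. The vectors \<open>D \<bar>z\<bar> + r z\<close> with \<open>r < D\<close> are nonnegative and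
represent consecutive integers; copies of the exponent \<open>0\<close> make their lengths equal.
\<close>

lemma consecutive_lattice_points:
  fixes D :: nat
  assumes "finite K" "0 \<in> K" "Gcd K = 1"
  obtains M p :: nat where "\<And>r. r < D \<Longrightarrow> (int M, int p + int r) \<in> I_set K"
proof -
  obtain z where z: "(\<Sum>j\<in>K. z j * int j) = 1" using bezout_finite[OF assms(1)] assms(3) by auto
  define w where "w = (\<lambda>r j. nat (int D * \<bar>z j\<bar> + int r * z j))"
  have w: "int (w r j) = int D * \<bar>z j\<bar> + int r * z j" if "r < D" for r j
  proof -
    have "- (int r * z j) \<le> int r * \<bar>z j\<bar>" by (metis abs_ge_minus_self abs_mult abs_of_nat)
    also have "\<dots> \<le> int D * \<bar>z j\<bar>" using that by (intro mult_right_mono) auto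
    finally show ?thesis unfolding w_def by simp
  qed
  define p where "p = nat (\<Sum>j\<in>K. int D * \<bar>z j\<bar> * int j)"
  define M where "M = nat (\<Sum>j\<in>K. 2 * (int D * \<bar>z j\<bar>))"
  have p: "int p = (\<Sum>j\<in>K. int D * \<bar>z j\<bar> * int j)" unfolding p_def by (simp add: sum_nonneg)
  have M: "int M = (\<Sum>j\<in>K. 2 * (int D * \<bar>z j\<bar>))" unfolding M_def by (simp add: sum_nonneg)
  show ?thesis
  proof (rule that[of M p])
    fix r assume r: "r < D"
    have "(\<Sum>j\<in>K. int (w r j) * int j) = int p + int r * (\<Sum>j\<in>K. z j * int j)"
      unfolding w[OF r] p by (simp add: sum.distrib sum_distrib_left algebra_simps)
    then have "int p + int r = (\<Sum>j\<in>K. int (w r j) * int j)" using z by simp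
    then have "((\<Sum>j\<in>K. int (w r j)), int p + int r) \<in> I_set K"
      unfolding I_set_def nat_span_def by blast
    moreover have "(\<Sum>j\<in>K. int (w r j)) \<le> int M"
      unfolding M
    proof (rule sum_mono)
      fix j
      have "int r * z j \<le> int r * \<bar>z j\<bar>" by (intro mult_left_mono) auto
      also have "\<dots> \<le> int D * \<bar>z j\<bar>" using r by (intro mult_right_mono) auto
      finally show "int (w r j) \<le> 2 * (int D * \<bar>z j\<bar>)" unfolding w[OF r] by simp
    qed
    ultimately show "(int M, int p + int r) \<in> I_set K" using assms(2,1) by (rule I_set_pad)
  qed
qed

section \<open>Linear independence\<close>

text \<open>
The relations for monomials extend to polynomials of degree less than \<open>card J\<close>; the one that vanishes at all
nodes except \<open>t j\<close> isolates the coefficient \<open>w j\<close>.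
\<close>

lemma vandermonde_kernel:
  fixes t w :: "'a \<Rightarrow> complex"
  assumes "finite J" "inj_on t J" "\<And>m. m < card J \<Longrightarrow> (\<Sum>j\<in>J. w j * t j ^ m) = 0" "j \<in> J"
  shows "w j = 0"
proof -
  define q where "q = (\<Prod>i\<in>J - {j}. [:- t i, 1:])"
  have deg: "degree q < card J"
  proof -
    have "degree q = card (J - {j})" unfolding q_def by (subst degree_prod_eq_sum_degree) auto
    moreover have "card (J - {j}) < card J" using assms(1,4) by (rule card_Diff1_less)
    ultimately show ?thesis by simp
  qed
  have "(\<Sum>i\<in>J. w i * poly q (t i)) = (\<Sum>i\<in>J. \<Sum>m\<le>degree q. coeff q m * (w i * t i ^ m))"
    unfolding poly_altdef sum_distrib_left by (simp add: mult_ac)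
  also have "\<dots> = (\<Sum>m\<le>degree q. coeff q m * (\<Sum>i\<in>J. w i * t i ^ m))"
    by (subst sum.swap) (simp add: sum_distrib_left)
  also have "\<dots> = 0" using assms(3) deg by (intro sum.neutral) auto
  finally have "(\<Sum>i\<in>J. w i * poly q (t i)) = 0" .
  moreover have "poly q (t i) = 0" if "i \<in> J - {j}" for i
    unfolding q_def poly_prod using that assms(1) by (intro prod_zero) auto
  ultimately have "w j * poly q (t j) = 0"
    using sum.remove[OF assms(1,4), of "\<lambda>i. w i * poly q (t i)"] by simp
  moreover have "poly q (t j) \<noteq> 0"
    unfolding q_def poly_prod using assms(1,2,4) by (auto simp: inj_on_def)
  ultimately show ?thesis by simp
qed

context monomial_curve begin

text \<open>
Eliminating \<open>C a s\<close> from the two Euler equations gives the recurrence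
\<open>\<Sum>\<^sub>i (a e\<^sub>i - s) x\<^sub>i C (a - 1) (s - e\<^sub>i) = 0\<close> on each level. Its coefficient for \<open>e\<^sub>i = 0\<close> is zero only if \<open>s = 0\<close>
and the one for \<open>e\<^sub>i = d\<close> only if \<open>s = d a\<close>, so \<open>d\<close> consecutive zeros on level \<open>-N\<close> spread to the whole interval
\<open>-N d < s < 0\<close>. From there the first Euler equation descends to level \<open>-1\<close>.
\<close>

lemma interior_zeros:
  fixes C :: "int \<Rightarrow> int \<Rightarrow> complex"
  assumes E1: "\<And>a s. a < 0 \<Longrightarrow> (\<Sum>i\<in>UNIV. x $ i * C (a - 1) (s - int (e i))) = of_int a * C a s"
    and E2: "\<And>a s. a < 0 \<Longrightarrow> (\<Sum>i\<in>UNIV. of_nat (e i) * x $ i * C (a - 1) (s - int (e i))) = of_int s * C a s"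
    and i0: "e i0 = 0" "x $ i0 \<noteq> 0" and l: "e l = d" "x $ l \<noteq> 0"
    and N: "N \<ge> 2" and s0: "s0 < 0"
    and zeros: "\<And>s. s0 - int d < s \<Longrightarrow> s \<le> s0 \<Longrightarrow> C (- int N) s = 0"
    and s: "- int d < s" "s < 0"
  shows "C (- 1) s = 0"
proof -
  define a where "a = - int N + 1"
  have a: "a < 0" "a - 1 = - int N" using N by (simp_all add: a_def)
  have rec: "(\<Sum>i\<in>UNIV. of_int (a * int (e i) - s) * x $ i * C (- int N) (s - int (e i))) = 0" for s
  proof -
    have "(\<Sum>i\<in>UNIV. of_int (a * int (e i) - s) * x $ i * C (- int N) (s - int (e i))) =
        of_int a * (\<Sum>i\<in>UNIV. of_nat (e i) * x $ i * C (a - 1) (s - int (e i)))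
        - of_int s * (\<Sum>i\<in>UNIV. x $ i * C (a - 1) (s - int (e i)))"
      unfolding a(2) sum_distrib_left sum_subtractf[symmetric] by (intro sum.cong) (auto simp: algebra_simps)
    then show ?thesis unfolding E1[OF a(1)] E2[OF a(1)] by simp
  qed
  have pos: "0 < e i" if "i \<noteq> i0" for i using exponent_ne_bounds(1)[OF that i0(1)] by simp
  have lt: "e i < d" if "i \<noteq> l" for i using exponent_ne_bounds(2)[OF that l(1)] d_ge_2 by simp
  have single: "of_int (a * int (e j) - s) * x $ j * C (- int N) (s - int (e j)) = 0"
    if "\<And>i. i \<noteq> j \<Longrightarrow> C (- int N) (s - int (e i)) = 0" for j s
  proof -
    have "(\<Sum>i\<in>UNIV - {j}. of_int (a * int (e i) - s) * x $ i * C (- int N) (s - int (e i))) = 0"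
      using that by (intro sum.neutral) auto
    then show ?thesis using rec[of s] by (subst (asm) sum.remove[of _ j]) auto
  qed
  have up: "C (- int N) s = 0" if "s0 - int d < s" "s < 0" for s
    using that
  proof (induction "nat (s - s0 + int d)" arbitrary: s rule: less_induct)
    case less
    show ?case
    proof (cases "s \<le> s0")
      case False
      have "C (- int N) (s - int (e i)) = 0" if "i \<noteq> i0" for i
        by (rule less.hyps) (use pos[OF that] e_le[of i] False less.prems in auto)
      then show ?thesis using single[of i0 s] i0 less.prems by simp
    qed (use zeros less.prems in auto)
  qed
  have top: "C (- int N) s = 0" if "- (int N * int d) < s" "s < 0" for s
    using that
  proof (induction "nat (- s)" arbitrary: s rule: less_induct)
    case less
    show ?case
    proof (cases "s0 - int d < s")
      case False
      have "C (- int N) (s + int d - int (e i)) = 0" if "i \<noteq> l" for i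
        by (rule less.hyps) (use lt[OF that] False less.prems s0 in auto)
      then have "of_int (a * int d - (s + int d)) * x $ l * C (- int N) s = 0"
        using single[of l "s + int d"] l by simp
      moreover have "a * int d - (s + int d) \<noteq> 0"
        using less.prems by (simp add: a_def algebra_simps)
      ultimately show ?thesis using l by (simp only: mult_eq_0_iff of_int_eq_0_iff) simp
    qed (use up less.prems in auto)
  qed
  have "\<forall>s. - (int M * int d) < s \<longrightarrow> s < 0 \<longrightarrow> C (- int M) s = 0" if "1 \<le> M" "M \<le> N" for M
    using that(2,1)
  proof (induction M rule: inc_induct)
    case base
    then show ?case using top by blast
  next
    case (step M)
    show ?case
    proof (intro allI impI)
      fix s assume s: "- (int M * int d) < s" "s < 0"
      have "C (- int M - 1) (s - int (e i)) = 0" for i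
      proof -
        have "- (int (Suc M) * int d) < s - int (e i)" using s e_le[of i] by (simp add: algebra_simps)
        moreover have "s - int (e i) < 0" using s by simp
        ultimately have "C (- int (Suc M)) (s - int (e i)) = 0" using step.IH by simp
        moreover have "- int M - 1 = - int (Suc M)" by simp
        ultimately show ?thesis by (simp only:)
      qed
      then show "C (- int M) s = 0" using E1[of "- int M" s] step.prems by simp
    qed
  qed
  from this[of 1] show ?thesis using s N by simp
qed

end

lemma sum_apply_fun: "(\<Sum>v\<in>S. g v) x = (\<Sum>v\<in>S. g v x)" for g :: "'b \<Rightarrow> 'a \<Rightarrow> complex"
  by (induction S rule: infinite_finite_induct) auto

lemma complex_dim_ge_card:
  fixes \<phi> :: "'b \<Rightarrow> 'a \<Rightarrow> complex"
  assumes fin: "finite Z" and V: "\<And>z. z \<in> Z \<Longrightarrow> \<phi> z \<in> V"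
    and indep: "\<And>c z. (\<And>x. (\<Sum>z\<in>Z. c z * \<phi> z x) = 0) \<Longrightarrow> z \<in> Z \<Longrightarrow> c z = 0"
  shows "enat (card Z) \<le> complex_dim V"
proof -
  interpret vs: vector_space "\<lambda>(c::complex) (f :: 'a \<Rightarrow> complex) x. c * f x"
    by (rule vector_space_complex_functions)
  have inj: "inj_on \<phi> Z"
  proof (rule inj_onI, rule ccontr)
    fix z z' assume z: "z \<in> Z" "z' \<in> Z" "\<phi> z = \<phi> z'" "z \<noteq> z'"
    define c :: "'b \<Rightarrow> complex" where "c = (\<lambda>y. if y = z then 1 else if y = z' then - 1 else 0)"
    have "(\<Sum>y\<in>Z. c y * \<phi> y x) = 0" for x
    proof -
      have "(\<Sum>y\<in>Z. c y * \<phi> y x) = c z * \<phi> z x + (c z' * \<phi> z' x + (\<Sum>y\<in>Z - {z} - {z'}. c y * \<phi> y x))"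
        using fin z by (subst sum.remove[of _ z]; simp) (subst sum.remove[of _ z']; simp)
      also have "(\<Sum>y\<in>Z - {z} - {z'}. c y * \<phi> y x) = 0" by (intro sum.neutral) (auto simp: c_def)
      finally show ?thesis using z by (simp add: c_def)
    qed
    from indep[OF this z(1)] show False by (simp add: c_def)
  qed
  have "\<not> vs.dependent (\<phi> ` Z)"
  proof
    assume "vs.dependent (\<phi> ` Z)"
    then obtain u v where u: "v \<in> \<phi> ` Z" "u v \<noteq> 0" "(\<Sum>v\<in>\<phi> ` Z. (\<lambda>x. u v * v x)) = 0"
      using vs.dependent_finite[of "\<phi> ` Z"] fin by auto
    then obtain z where z: "z \<in> Z" "v = \<phi> z" by auto
    have "(\<Sum>y\<in>Z. u (\<phi> y) * \<phi> y x) = 0" for x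
      using fun_cong[OF u(3), of x] unfolding sum_apply_fun by (simp add: sum.reindex[OF inj])
    from indep[OF this z(1)] show False using u z by simp
  qed
  then have "enat (card (\<phi> ` Z)) \<le> complex_dim V"
    unfolding complex_dim_def using V fin by (intro SUP_upper) auto
  then show ?thesis by (simp add: card_image[OF inj])
qed

text \<open>
The two ways of writing \<open>(n, b)\<close> with one negative coefficient bound \<open>b\<close> from below by \<open>0\<close> and from above by
\<open>d n\<close>. The negative coefficients are strictly negative since \<open>(n, b)\<close> is outside the semigroup; they say by how
many columns \<open>(1, 0)\<close> or \<open>(1, d)\<close> one has to move to enter it.
\<close>

lemma exponent_pairE:
  assumes E: "(n, b) \<in> E_set \<Lambda> d" and \<Lambda>: "finite \<Lambda>" "0 \<in> \<Lambda>" "d \<in> \<Lambda>" "\<And>j. j \<in> \<Lambda> \<Longrightarrow> j \<le> d" "d > 0"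
  obtains k k' :: nat where "(n, b) \<notin> I_set \<Lambda>" "n \<ge> 0" "b > 0"
    "k \<ge> 1" "(n + int k, b) \<in> I_set \<Lambda>" "k' \<ge> 1" "(n + int k', b + int k' * int d) \<in> I_set \<Lambda>"
proof -
  have I: "(n, b) \<notin> I_set \<Lambda>" using E by (simp add: E_set_def E0_set_def)
  obtain k where k: "(n + int k, b) \<in> nat_span (\<Lambda> - {0})"
  proof -
    obtain a k where "n = a - int k" "(a, b) \<in> nat_span (\<Lambda> - {0})"
      using E by (auto simp: E_set_def E0_set_def F0_set_def)
    then show ?thesis using that[of k] by simp
  qed
  obtain k' where k': "(n + int k', b + int k' * int d) \<in> nat_span (\<Lambda> - {d})"
  proof -
    obtain a c k where "n = a - int k" "b = c - int k * int d" "(a, c) \<in> nat_span (\<Lambda> - {d})"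
      using E by (auto simp: E_set_def Ed_set_def Fd_set_def)
    then show ?thesis using that[of k] by simp
  qed
  have kI: "(n + int k, b) \<in> I_set \<Lambda>" "(n + int k', b + int k' * int d) \<in> I_set \<Lambda>"
    using k k' \<Lambda> unfolding I_set_def by (auto intro: nat_span_mono)
  have "k \<noteq> 0" "k' \<noteq> 0" using I kI by (auto intro: gr0I)
  have "b \<ge> 0" using k unfolding nat_span_def by (auto intro: sum_nonneg)
  have "b + int k' * int d \<le> int d * (n + int k')"
  proof -
    obtain u where u: "n + int k' = (\<Sum>j\<in>\<Lambda> - {d}. int (u j))" "b + int k' * int d = (\<Sum>j\<in>\<Lambda> - {d}. int (u j) * int j)"
      using k' unfolding nat_span_def by auto
    show ?thesis unfolding u sum_distrib_left
      using \<Lambda>(4) by (intro sum_mono) (auto simp: mult.commute intro: mult_right_mono)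
  qed
  then have "b \<le> int d * n" by (simp add: algebra_simps)
  then have "0 \<le> int d * n" using \<open>b \<ge> 0\<close> by linarith
  then have "n \<ge> 0" using \<Lambda>(5) by (simp add: zero_le_mult_iff)
  have "b \<noteq> 0" using I nat_span_single[OF \<Lambda>(2,1) \<open>n \<ge> 0\<close>] by (auto simp: I_set_def)
  then show ?thesis
    using \<open>n \<ge> 0\<close> I kI \<open>k \<noteq> 0\<close> \<open>k' \<noteq> 0\<close> \<open>b \<ge> 0\<close>
    by (intro that[of k k']) auto
qed

lemma algebraic_on_cong:
  assumes "algebraic_on \<phi> U" "\<And>x. x \<in> U \<Longrightarrow> \<psi> x = \<phi> x"
  shows "algebraic_on \<psi> U"
  using assms unfolding algebraic_on_def by simp

text \<open>
One root \<open>r1\<close> is left out: the sum of all root solutions is a combination of the two Laurent solutions, by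
the residue theorem, so that the full set of \<open>d + 2\<close> functions is dependent.
\<close>

lemma (in nonsingular_domain) dim_algebraic_solutions_ge:
  assumes e_i0: "e i0 = 0" and i0_nonzero: "\<And>x. x \<in> U \<Longrightarrow> x $ i0 \<noteq> 0"
    and gcd: "Gcd (range e) = 1" and sc: "simply_connected U" and "U \<noteq> {}"
    and E: "(n, b) \<in> E_set (range e) d"
  shows "enat (d + 1) \<le> complex_dim (H_alg e (of_int n, of_int b) U)"
proof -
  have rng: "finite (range e)" "0 \<in> range e" "d \<in> range e" "\<And>j. j \<in> range e \<Longrightarrow> j \<le> d" "d > 0"
    using e_i0 e_l e_le d_ge_2 by (auto intro: range_eqI[of _ _ i0] range_eqI[of _ _ l])
  obtain k0 kd :: nat where I: "(n, b) \<notin> I_set (range e)" and n: "n \<ge> 0" and b: "b > 0"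
    and k0: "k0 \<ge> 1" "(n + int k0, b) \<in> I_set (range e)"
    and kd: "kd \<ge> 1" "(n + int kd, b + int kd * int d) \<in> I_set (range e)"
    by (rule exponent_pairE[OF E rng])
  obtain x0 where x0: "x0 \<in> U" using \<open>U \<noteq> {}\<close> by blast
  obtain \<sigma> where \<sigma>: "\<And>r. r \<in> roots x0 \<Longrightarrow> continuous_on U (\<sigma> r)"
    "\<And>r x. r \<in> roots x0 \<Longrightarrow> x \<in> U \<Longrightarrow> generic_eval e x (\<sigma> r x) = 0"
    "\<And>r r' x. r \<in> roots x0 \<Longrightarrow> r' \<in> roots x0 \<Longrightarrow> r \<noteq> r' \<Longrightarrow> x \<in> U \<Longrightarrow> \<sigma> r x \<noteq> \<sigma> r' x"
    by (rule global_root_sections[OF sc x0]) blast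
  have eval0: "generic_eval e x 0 = x $ i0" for x
  proof -
    have "generic_eval e x 0 = (\<Sum>i\<in>UNIV. if i = i0 then x $ i else 0)"
      unfolding generic_eval_def
      using exponent_ne_bounds(1)[OF _ e_i0] e_i0 by (intro sum.cong) (fastforce simp: power_0_left)+
    then show ?thesis by simp
  qed
  have sec: "root_section e d U (\<sigma> r) i0" if "r \<in> roots x0" for r
  proof unfold_locales
    show "\<sigma> r x \<noteq> 0" if "x \<in> U" for x
      using \<sigma>(2)[OF \<open>r \<in> roots x0\<close> that] eval0[of x] i0_nonzero[OF that] by auto
  qed (use \<sigma> simple that open_U e_i0 in auto)
  have card_roots: "card (roots x0) = d" by (rule generic_eval_factor(2)[OF x0])
  then obtain r1 where r1: "r1 \<in> roots x0" using d_ge_2 by (metis card.empty all_not_in_conv not_numeral_le_zero)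
  define J where "J = roots x0 - {r1}"
  have J: "finite J" "card J = d - 1" "\<And>r. r \<in> J \<Longrightarrow> r \<in> roots x0"
    using finite_roots[OF x0] card_roots r1 by (auto simp: J_def)
  have i0l: "i0 \<noteq> l" using e_i0 e_l d_ge_2 by auto
  define Z where "Z = J <+> {i0, l}"
  have Z: "finite Z" "card Z = d + 1"
    using J i0l d_ge_2 by (auto simp: Z_def card_Plus)
  define G where "G = case_sum (\<lambda>r. root_section.root_solution e d (\<sigma> r) i0) laurent_solution"
  have nonzero: "x $ l' \<noteq> 0" if "l' \<in> {i0, l}" "x \<in> U" for l' x
    using that i0_nonzero lead_nonzero by auto
  have fam: "contiguous_family e U (G z)" if "z \<in> Z" for z
    using that unfolding Z_def
  proof (rule PlusE)
    fix r assume r: "r \<in> J" "z = Inl r"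
    interpret root_section e d U "\<sigma> r" i0 using sec J(3) r by blast
    show ?thesis using root_contiguous r by (simp add: G_def)
  next
    fix l' assume l': "l' \<in> {i0, l}" "z = Inr l'"
    then show ?thesis using laurent_contiguous[of l' U] nonzero e_i0 e_l by (auto simp: G_def)
  qed
  have alg: "algebraic_on (G z n b) U" if "z \<in> Z" for z
    using that unfolding Z_def
  proof (rule PlusE)
    fix r assume r: "r \<in> J" "z = Inl r"
    interpret root_section e d U "\<sigma> r" i0 using sec J(3) r by blast
    show ?thesis
      using root_solution_algebraic[OF e_l lead_nonzero i0_nonzero \<open>U \<noteq> {}\<close> n] r by (simp add: G_def)
  next
    fix l' assume l': "l' \<in> {i0, l}" "z = Inr l'"
    then show ?thesis using laurent_solution_algebraic[of U l'] nonzero \<open>U \<noteq> {}\<close> by (simp add: G_def)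
  qed
  define \<phi> where "\<phi> = (\<lambda>z x. if x \<in> U then G z n b x else 0)"
  have "\<phi> z \<in> H_alg e (of_int n, of_int b) U" if z: "z \<in> Z" for z
  proof -
    have eq: "\<phi> z x = G z n b x" if "x \<in> U" for x using that by (simp add: \<phi>_def)
    have "holomorphic_several (\<phi> z) U"
      using fam[OF z] open_U I eq by (rule contiguous_family_holomorphic)
    moreover have "solves_hypergeometric e (of_int n, of_int b) U (\<phi> z)"
      using fam[OF z] open_U inj_e I eq by (rule contiguous_family_solves)
    moreover have "algebraic_on (\<phi> z) U" using alg[OF z] eq by (rule algebraic_on_cong)
    ultimately show ?thesis unfolding H_alg_def by (simp add: \<phi>_def)
  qed
  moreover have "c z = 0" if c: "\<And>x. (\<Sum>z\<in>Z. c z * \<phi> z x) = 0" and z: "z \<in> Z" for c z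
  proof -
    define C where "C = (\<lambda>a s x. \<Sum>z\<in>Z. c z * G z a s x)"
    have famC: "contiguous_family e U C"
      unfolding C_def by (intro contiguous_family_sum contiguous_family_cmult fam)
    have vanish: "C (n - a) (b - s) x0 = 0" if "(a, s) \<in> I_set (range e)" for a s
    proof (rule contiguous_family_vanish[OF famC open_U inj_e I _ that x0])
      show "C n b x = 0" if "x \<in> U" for x using c[of x] that by (simp add: C_def \<phi>_def)
    qed
    have split: "C a s x0 = (\<Sum>r\<in>J. c (Inl r) * G (Inl r) a s x0) +
        (c (Inr i0) * laurent_solution i0 a s x0 + c (Inr l) * laurent_solution l a s x0)" for a s
      using J(1) i0l by (simp add: C_def Z_def sum.Plus G_def)
    have neg: "(a, s) \<notin> I_set (range e)" if "a < 0" for a s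
      using nat_span_bounds(1)[OF inj_e, of a s UNIV 0 d] e_le that unfolding I_set_def by auto
    have C_interior: "C (- 1) s x0 = 0" if s: "- int d < s" "s < 0" for s
    proof -
      obtain M p :: nat where Mp: "\<And>r. r < d \<Longrightarrow> (int M, int p + int r) \<in> I_set (range e)"
        by (rule consecutive_lattice_points[OF rng(1,2) gcd, of d]) blast
      \<comment> \<open>\<open>b\<close> copies of the exponent \<open>d\<close> push the interval below \<open>0\<close>; a deep enough level keeps it above \<open>- N d\<close>\<close>
      define N where "N = M + p + nat b + 2"
      define s0 where "s0 = b - int p - b * int d"
      have bd: "b * 2 \<le> b * int d" using b d_ge_2 by (intro mult_left_mono) auto
      show ?thesis
      proof (rule interior_zeros[where x = x0 and C = "\<lambda>a s. C a s x0" and N = N and ?s0.0 = s0 and ?i0.0 = i0 and l = l])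
        show "(\<Sum>i\<in>UNIV. x0 $ i * C (a - 1) (s - int (e i)) x0) = of_int a * C a s x0"
          "(\<Sum>i\<in>UNIV. of_nat (e i) * x0 $ i * C (a - 1) (s - int (e i)) x0) = of_int s * C a s x0"
          if "a < 0" for a s
          using contiguous_familyD(2,3)[OF famC neg[OF that] x0] by simp_all
        show "N \<ge> 2" by (simp add: N_def)
        show "s0 < 0" unfolding s0_def using bd b by linarith
        show "C (- int N) s x0 = 0" if "s0 - int d < s" "s \<le> s0" for s
        proof -
          have r: "s = s0 - int (nat (s0 - s))" "nat (s0 - s) < d" using that by linarith+
          have "(int M + b, int p + int (nat (s0 - s)) + b * int d) \<in> I_set (range e)"
            using nat_span_add[OF Mp[OF r(2), unfolded I_set_def] nat_span_single[OF rng(3,1), of b]] b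
            by (simp add: I_set_def)
          then have "(n + int N, int p + int (nat (s0 - s)) + b * int d) \<in> I_set (range e)"
            using rng(2,1) by (elim I_set_pad) (use n b in \<open>auto simp: N_def\<close>)
          from vanish[OF this] show ?thesis using that by (simp add: s0_def algebra_simps)
        qed
      qed (use e_i0 e_l i0_nonzero[OF x0] lead_nonzero[OF x0] s in auto)
    qed
    have c_root: "c (Inl r) = 0" if r: "r \<in> J" for r
    proof -
      define w where "w = (\<lambda>r. c (Inl r) * root_section.slope e (\<sigma> r) x0)"
      have "w r = 0"
      proof (rule vandermonde_kernel[of J "\<lambda>r. \<sigma> r x0" w])
        show "inj_on (\<lambda>r. \<sigma> r x0) J" using \<sigma>(3) J(3) x0 by (meson inj_onI)
        fix m assume m: "m < card J"
        then have s: "- int d < - int m - 1" "- int m - 1 < 0" using J(2) by linarith+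
        have "G (Inl r) (- 1) (- int m - 1) x0 = root_section.slope e (\<sigma> r) x0 * \<sigma> r x0 ^ m" if "r \<in> J" for r
        proof -
          interpret root_section e d U "\<sigma> r" i0 using sec J(3) that by blast
          show ?thesis using root_solution_minus_one by (simp add: G_def)
        qed
        then have "C (- 1) (- int m - 1) x0 = (\<Sum>r\<in>J. w r * \<sigma> r x0 ^ m)"
          unfolding split using laurent_solution_interior[of _ "- 1" "- int m - 1" x0] e_i0 e_l s
          by (simp add: w_def mult.assoc)
        then show "(\<Sum>r\<in>J. w r * \<sigma> r x0 ^ m) = 0" using C_interior[OF s] by simp
      qed (use J r in auto)
      moreover have "root_section.slope e (\<sigma> r) x0 \<noteq> 0"
      proof -
        interpret root_section e d U "\<sigma> r" i0 using sec J(3) r by blast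
        show ?thesis using root_simple[OF x0] by (simp add: slope_def)
      qed
      ultimately show ?thesis by (simp add: w_def)
    qed
    have corner: "c (Inr l') = 0" if l': "l' \<in> {i0, l}" and k: "k \<ge> 1"
        and I': "(n + int k, b + int k * int (e l')) \<in> I_set (range e)" for l' k
    proof -
      have "C (- int k) (- int k * int (e l')) x0 = 0" using vanish[OF I'] by simp
      moreover have "C (- int k) (- int k * int (e l')) x0 = c (Inr l') * laurent_coeff l' k x0"
        unfolding split using c_root l' i0l k e_i0 e_l
          laurent_solution_corner[of l' i0 k x0] laurent_solution_corner[of l' l k x0]
        by auto
      moreover have "laurent_coeff l' k x0 \<noteq> 0"
        using nonzero[OF l' x0] by (simp add: laurent_coeff_def)
      ultimately show ?thesis by simp
    qed
    show "c z = 0"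
      using z c_root corner[of i0 k0] corner[of l kd] k0 kd e_i0 e_l unfolding Z_def by auto
  qed
  ultimately have "enat (card Z) \<le> complex_dim (H_alg e (of_int n, of_int b) U)"
    using Z(1) complex_dim_ge_card[of Z \<phi>] by blast
  then show ?thesis unfolding Z(2) .
qed

theorem theorem2p6:
  fixes m d :: nat and k :: "nat \<Rightarrow> nat"
    and e :: "'n::finite \<Rightarrow> nat"
    and U :: "(complex ^ 'n) set"
    and \<alpha> :: "int \<times> int"
  assumes "m \<ge> 1"
    and "0 < k 1" and "strict_mono_on {1..m} k" and "k m < d"
    and "Gcd (k ` {1..m} \<union> {d}) = 1"
    and "bij_betw e UNIV (exponents m k d)"
    and "open U" and "U \<noteq> {}" and "simply_connected U"
    and "U \<subseteq> - singular_locus e d"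
    and "\<alpha> \<in> E_set (exponents m k d) d"
  shows "complex_dim (H_alg e (of_int (fst \<alpha>), of_int (snd \<alpha>)) U) \<ge> enat (d + 1)"
proof -
  have k_le: "k j \<le> k m" if "j \<in> {1..m}" for j
    using strict_mono_on_leD[OF assms(3) that] that by simp
  have range: "range e = exponents m k d" and inj: "inj e"
    using assms(6) by (auto simp: bij_betw_def)
  have "d \<ge> 2" using assms(1,2,4) k_le[of 1] by simp
  have e_le: "e i \<le> d" for i
  proof -
    have "e i \<in> exponents m k d" using range by blast
    then show ?thesis using k_le assms(4) by (fastforce simp: exponents_def)
  qed
  have inv: "e (inv_into UNIV e j) = j" if "j \<in> exponents m k d" for j
    using that range by (metis f_inv_into_f)
  define i0 where "i0 = inv_into UNIV e 0"
  define l where "l = inv_into UNIV e d"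
  have e_i0: "e i0 = 0" and e_l: "e l = d"
    unfolding i0_def l_def by (auto intro!: inv simp: exponents_def)
  have U: "x $ i0 \<noteq> 0" "x $ l \<noteq> 0" "discriminant (generic_poly e x) \<noteq> 0" if "x \<in> U" for x
    using assms(10) that by (auto simp: singular_locus_def i0_def l_def)
  interpret nonsingular_domain e d U l
  proof
    show "generic_deriv e x t \<noteq> 0" if "x \<in> U" "generic_eval e x t = 0" for x t
      using nonzero_discriminant_simple[OF U(3)[OF that(1)], of t] that(2)
      by (simp add: poly_generic_poly poly_pderiv_generic_poly)
  qed (use inj \<open>d \<ge> 2\<close> e_le assms(7) e_l U in auto)
  have "exponents m k d = insert 0 (k ` {1..m} \<union> {d})" by (auto simp: exponents_def)
  then have "Gcd (range e) = 1" using assms(5) unfolding range by simp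
  moreover have "(fst \<alpha>, snd \<alpha>) \<in> E_set (range e) d" using assms(11) range by simp
  ultimately show ?thesis
    using dim_algebraic_solutions_ge[of i0] e_i0 U(1) assms(8,9) by simp
qed

end
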